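(* Let $\Lambda(x)=\sum_d \Lambda_d x^d$ and $P(x)=\sum_k P_k x^k$ be degree distributions (node perspective) with finite maximal degrees, and let $\mathcal{C}=\mathrm{LDPC}(n,\Lambda,P)$ be the standard irregular LDPC ensemble. Consider transmission over one of the following channels: (i) the BEC$(\epsilon)$ at any erasure probability $\epsilon$; (ii) the BIAWGNC$(\epsilon)$ at any noise level $\epsilon$; (iii) a BMS$(\epsilon)$ channel family, for every $\epsilon$ in an open interval on which condition H holds. Then for every such $\epsilon$, $$\liminf_{n\to+\infty}\mathbb{E}_{\mathcal{C}}[h_n]\;\geq\;\sup_{d_V} h_{RS}[d_V;\Lambda,P],$$ where the supremum runs over all probability densities $d_V$ of a real random variable $V$ such that the law of $2V$ is symmetric (its density $a$ satisfies $a(x)=e^{x}a(-x)$).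
   Context: Standard ensemble $\mathrm{LDPC}(n,\Lambda,P)$: random Tanner graphs with $n$ variable nodes, a fraction $\Lambda_d$ of which have degree $d$, and check nodes a fraction $P_k$ of which have degree $k$, the edges being matched uniformly at random (configuration model); the code is the set of binary words satisfying all parity checks. A codeword is chosen uniformly and sent through a binary-input memoryless output-symmetric (BMS) channel with transition density $p_{Y|X}(y|x)$ depending on a noise parameter $\epsilon$ (smoothly, so that all derivatives in $\epsilon$ below exist and may be taken under the integral). $h_n=\frac1n H_n(\underline X\mid\underline Y)$ is the conditional entropy per bit (natural logarithms) and $\mathbb{E}_{\mathcal{C}}$ the average over the ensemble. The log-likelihood is $l=\ln\frac{p_{Y|X}(y|0)}{p_{Y|X}(y|1)}$ and $t=\tanh(l/2)$; expectations over $l$ (or $t$) are taken under the distribution $c_L$ (resp. $c_D$) induced when $X=0$ is sent. For BIAWGNC$(\epsilon)$, $c_L$ is the Gaussian density with mean $\epsilon^{-2}$ and variance $2\epsilon^{-2}$. Condition H: with $m_0^{(2p)}=\mathbb{E}[t^{2p}]$, $m_1^{(2p)}=\frac{d}{d\epsilon}\mathbb{E}[t^{2p}]$, $m_2^{(2p)}=\frac{d^2}{d\epsilon^2}\mathbb{E}[t^{2p}]$, the series $\sum_{p\ge0}(p+1)m_0^{(2p)}$, $\sum_{p\ge1}(5/2)^{2p}|m_1^{(2p)}|$, $\sum_{p\ge1}\frac{|m_2^{(2p)}|}{2p(2p-1)}$ converge, and $(\sqrt2-1)(5/2)^2|m_1^{(2)}|>\sum_{p\ge2}(5/2)^{2p}|m_1^{(2p)}|$.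 Replica-symmetric functional: let $V_1,V_2,\dots$ be i.i.d. copies of $V\sim d_V$; let $k$ be a random check degree with edge-perspective law $\mathbb{P}(k)=kP_k/P'(1)$ and set $U=\tanh^{-1}\big[\prod_{i=1}^{k-1}\tanh V_i\big]$; let $U_1,U_2,\dots$ be i.i.d. copies of $U$, $d$ a random variable-node degree with law $\Lambda_d$, and $l\sim c_L$, all independent. Then $$h_{RS}[d_V;\Lambda,P]=\mathbb{E}\Big[\ln\Big(e^{l/2}\prod_{c=1}^{d}(1+\tanh U_c)+e^{-l/2}\prod_{c=1}^{d}(1-\tanh U_c)\Big)\Big]+\frac{\Lambda'(1)}{P'(1)}\mathbb{E}\Big[\ln\Big(1+\prod_{i=1}^{k'}\tanh V_i\Big)\Big]-\Lambda'(1)\mathbb{E}\big[\ln(1+\tanh V\tanh U)\big]-\frac{\Lambda'(1)}{P'(1)}\ln 2,$$ where in the second term $k'$ has the node-perspective law $P_{k'}$, and in the third term $V$ and $U$ are independent.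
   Formalization: The first term of h_RS is corrected by subtracting E[l]/2, i.e. it is E ln(∏(1+tanh U_c)+e^{-l}∏(1−tanh U_c)); without this the bound fails (e.g. uncoded bits over BIAWGNC) and the term is infinite for the BEC. *)

theory Defs
  imports "HOL-Probability.Probability" "HOL-Combinatorics.Permutations"
begin

definition Lp1 :: "nat pmf \<Rightarrow> real" where
  "Lp1 L = (\<Sum>d\<in>set_pmf L. real d * pmf L d)"

definition ncheck :: "nat pmf \<Rightarrow> nat pmf \<Rightarrow> nat \<Rightarrow> nat" where
  "ncheck L P n = nat \<lfloor>real n * Lp1 L / Lp1 P\<rfloor>"

definition admissible :: "nat pmf \<Rightarrow> nat pmf \<Rightarrow> nat \<Rightarrow> bool" where
  "admissible L P n \<longleftrightarrow>
     (\<forall>d. real n * pmf L d \<in> \<nat>) \<and> real n * Lp1 L / Lp1 P \<in> \<nat> \<and>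
     (\<forall>k. real (ncheck L P n) * pmf P k \<in> \<nat>)"

text \<open>Canonical degree sequence: the first n Lambda_0 nodes have degree 0, the next
  n Lambda_1 have degree 1, etc. (the ensemble average does not depend on the labelling).\<close>
definition node_deg :: "nat pmf \<Rightarrow> nat \<Rightarrow> nat \<Rightarrow> nat" where
  "node_deg L n i = (LEAST d. real i < real n * (\<Sum>j\<le>d. pmf L j))"

definition vdeg :: "nat pmf \<Rightarrow> nat pmf \<Rightarrow> nat \<Rightarrow> nat \<Rightarrow> nat" where
  "vdeg L P n = node_deg L n"

definition cdeg :: "nat pmf \<Rightarrow> nat pmf \<Rightarrow> nat \<Rightarrow> nat \<Rightarrow> nat" where
  "cdeg L P n = node_deg P (ncheck L P n)"

definition nedges :: "nat pmf \<Rightarrow> nat pmf \<Rightarrow> nat \<Rightarrow> nat" where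
  "nedges L P n = (\<Sum>i<n. vdeg L P n i)"

text \<open>Owner of a socket: sockets 0..deg(0)-1 belong to node 0, and so on.\<close>
definition sock_owner :: "(nat \<Rightarrow> nat) \<Rightarrow> nat \<Rightarrow> nat" where
  "sock_owner deg s = (LEAST i. s < (\<Sum>j\<le>i. deg j))"

text \<open>Configuration model: variable socket s is matched to check socket pi s, pi a
  permutation of the edge sockets. The code is the set of binary words satisfying
  all parity checks (edges counted with multiplicity).\<close>
definition ldpc_code :: "nat pmf \<Rightarrow> nat pmf \<Rightarrow> nat \<Rightarrow> (nat \<Rightarrow> nat) \<Rightarrow> (nat \<Rightarrow> bool) set" where
  "ldpc_code L P n \<pi> =
     {x \<in> {..<n} \<rightarrow>\<^sub>E (UNIV :: bool set).
        \<forall>a < ncheck L P n.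
          even (card {s. s < nedges L P n \<and> sock_owner (cdeg L P n) (\<pi> s) = a
                          \<and> x (sock_owner (vdeg L P n) s)})}"

text \<open>A channel (for fixed noise) is a base measure mu on the output space together with
  transition densities p x y = p_{Y|X}(y|x) w.r.t. mu; the bit 0 is False, 1 is True.
  For a code C and a uniformly chosen codeword, H(X|Y) = - E[ln p(X|Y)] (natural logs).\<close>
definition cond_entropy :: "'y measure \<Rightarrow> (bool \<Rightarrow> 'y \<Rightarrow> real) \<Rightarrow> nat \<Rightarrow> (nat \<Rightarrow> bool) set \<Rightarrow> real" where
  "cond_entropy \<mu> p n C =
     (1 / real (card C)) * (\<Sum>x\<in>C.
        \<integral>y. (\<Prod>i<n. p (x i) (y i)) *
            - ln ((\<Prod>i<n. p (x i) (y i)) / (\<Sum>x'\<in>C. \<Prod>i<n. p (x' i) (y i)))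
        \<partial>(PiM {..<n} (\<lambda>_. \<mu>)))"

definition avg_entropy :: "nat pmf \<Rightarrow> nat pmf \<Rightarrow> 'y measure \<Rightarrow> (bool \<Rightarrow> 'y \<Rightarrow> real) \<Rightarrow> nat \<Rightarrow> real" where
  "avg_entropy L P \<mu> p n =
     (\<Sum>\<pi>\<in>{\<pi>. \<pi> permutes {..<nedges L P n}}. cond_entropy \<mu> p n (ldpc_code L P n \<pi>) / real n)
       / fact (nedges L P n)"

definition sym_density :: "(real \<Rightarrow> real) \<Rightarrow> bool" where
  "sym_density f \<longleftrightarrow> f \<in> borel_measurable lborel \<and> (\<forall>x. 0 \<le> f x) \<and>
     (\<integral>\<^sup>+ x. ennreal (f x) \<partial>lborel) = 1 \<and>
     (let a = (\<lambda>x. f (x / 2) / 2) in \<forall>x. a x = exp x * a (- x))"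

definition V_law :: "(real \<Rightarrow> real) \<Rightarrow> real measure" where
  "V_law f = density lborel (\<lambda>x. ennreal (f x))"

definition edge_law :: "nat pmf \<Rightarrow> nat measure" where
  "edge_law P = density (count_space UNIV) (\<lambda>k. ennreal (real k * pmf P k / Lp1 P))"

text \<open>Law of tanh U, where U = artanh (prod_{i<k-1} tanh V_i).\<close>
definition tanhU_law :: "nat pmf \<Rightarrow> (real \<Rightarrow> real) \<Rightarrow> real measure" where
  "tanhU_law P f = bind (edge_law P)
     (\<lambda>k. distr (PiM {..<k - 1} (\<lambda>_. V_law f)) borel (\<lambda>v. \<Prod>i<k - 1. tanh (v i)))"

definition hRS :: "nat pmf \<Rightarrow> nat pmf \<Rightarrow> 'y measure \<Rightarrow> (bool \<Rightarrow> 'y \<Rightarrow> real) \<Rightarrow> (real \<Rightarrow> real) \<Rightarrow> real" where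
  "hRS L P \<mu> p f =
     (\<Sum>d\<in>set_pmf L. pmf L d *
        (\<integral>y. p False y *
           (\<integral>ts. ln ((\<Prod>c<d. 1 + ts c) + (p True y / p False y) * (\<Prod>c<d. 1 - ts c))
              \<partial>(PiM {..<d} (\<lambda>_. tanhU_law P f))) \<partial>\<mu>))
   + Lp1 L / Lp1 P * (\<Sum>k\<in>set_pmf P. pmf P k *
        (\<integral>v. ln (1 + (\<Prod>i<k. tanh (v i))) \<partial>(PiM {..<k} (\<lambda>_. V_law f))))
   - Lp1 L * (\<integral>v. (\<integral>t. ln (1 + tanh v * t) \<partial>(tanhU_law P f)) \<partial>(V_law f))
   - Lp1 L / Lp1 P * ln 2"

definition RS_lower_bound :: "nat pmf \<Rightarrow> nat pmf \<Rightarrow> 'y measure \<Rightarrow> (bool \<Rightarrow> 'y \<Rightarrow> real) \<Rightarrow> bool" where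
  "RS_lower_bound L P \<mu> p \<longleftrightarrow>
     Liminf (sequentially \<sqinter> principal {n. admissible L P n}) (\<lambda>n. ereal (avg_entropy L P \<mu> p n))
       \<ge> (SUP f\<in>{f. sym_density f}. ereal (hRS L P \<mu> p f))"

definition BEC_meas :: "bool option measure" where
  "BEC_meas = count_space UNIV"

definition BEC :: "real \<Rightarrow> bool \<Rightarrow> bool option \<Rightarrow> real" where
  "BEC \<epsilon> x y = (case y of None \<Rightarrow> \<epsilon> | Some b \<Rightarrow> (if b = x then 1 - \<epsilon> else 0))"

text \<open>BIAWGNC(eps), described through its log-likelihood output: under X=0 the output
  (= l) is Gaussian with mean eps^-2 and variance 2 eps^-2 (mean -eps^-2 under X=1).\<close>
definition BIAWGN :: "real \<Rightarrow> bool \<Rightarrow> real \<Rightarrow> real" where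
  "BIAWGN \<epsilon> x y = normal_density (if x then - (1 / \<epsilon>\<^sup>2) else 1 / \<epsilon>\<^sup>2) (sqrt (2 / \<epsilon>\<^sup>2)) y"

definition BMS_family :: "'y measure \<Rightarrow> (real \<Rightarrow> bool \<Rightarrow> 'y \<Rightarrow> real) \<Rightarrow> ('y \<Rightarrow> 'y) \<Rightarrow> real \<Rightarrow> real \<Rightarrow> bool" where
  "BMS_family \<mu> p \<sigma> a b \<longleftrightarrow> a < b \<and> sigma_finite_measure \<mu> \<and>
     \<sigma> \<in> \<mu> \<rightarrow>\<^sub>M \<mu> \<and> (\<forall>y\<in>space \<mu>. \<sigma> (\<sigma> y) = y) \<and> distr \<mu> \<mu> \<sigma> = \<mu> \<and>
     (\<forall>e\<in>{a<..<b}. \<forall>x.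
        p e x \<in> borel_measurable \<mu> \<and> (\<forall>y. 0 \<le> p e x y) \<and> (\<integral>\<^sup>+ y. ennreal (p e x y) \<partial>\<mu>) = 1) \<and>
     (\<forall>e\<in>{a<..<b}. \<forall>y\<in>space \<mu>. p e True y = p e False (\<sigma> y))"

text \<open>t = tanh(l/2) = (p(y|0) - p(y|1)) / (p(y|0) + p(y|1)).\<close>
definition tval :: "(bool \<Rightarrow> 'y \<Rightarrow> real) \<Rightarrow> 'y \<Rightarrow> real" where
  "tval p y = (p False y - p True y) / (p False y + p True y)"

definition mom_integrand :: "(real \<Rightarrow> bool \<Rightarrow> 'y \<Rightarrow> real) \<Rightarrow> nat \<Rightarrow> real \<Rightarrow> 'y \<Rightarrow> real" where
  "mom_integrand p q e y = p e False y * tval (p e) y ^ (2 * q)"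

definition m0 :: "'y measure \<Rightarrow> (real \<Rightarrow> bool \<Rightarrow> 'y \<Rightarrow> real) \<Rightarrow> nat \<Rightarrow> real \<Rightarrow> real" where
  "m0 \<mu> p q e = (\<integral>y. mom_integrand p q e y \<partial>\<mu>)"

definition m1 :: "'y measure \<Rightarrow> (real \<Rightarrow> bool \<Rightarrow> 'y \<Rightarrow> real) \<Rightarrow> nat \<Rightarrow> real \<Rightarrow> real" where
  "m1 \<mu> p q e = deriv (m0 \<mu> p q) e"

definition m2 :: "'y measure \<Rightarrow> (real \<Rightarrow> bool \<Rightarrow> 'y \<Rightarrow> real) \<Rightarrow> nat \<Rightarrow> real \<Rightarrow> real" where
  "m2 \<mu> p q e = deriv (m1 \<mu> p q) e"

definition smooth_moments :: "'y measure \<Rightarrow> (real \<Rightarrow> bool \<Rightarrow> 'y \<Rightarrow> real) \<Rightarrow> real \<Rightarrow> real \<Rightarrow> bool" where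
  "smooth_moments \<mu> p a b \<longleftrightarrow> (\<forall>q. \<forall>e\<in>{a<..<b}.
     (\<forall>y\<in>space \<mu>. (\<lambda>e'. mom_integrand p q e' y) differentiable (at e) \<and>
                   (\<lambda>e'. deriv (\<lambda>e''. mom_integrand p q e'' y) e') differentiable (at e)) \<and>
     (m0 \<mu> p q has_real_derivative (\<integral>y. deriv (\<lambda>e'. mom_integrand p q e' y) e \<partial>\<mu>)) (at e) \<and>
     (m1 \<mu> p q has_real_derivative
        (\<integral>y. deriv (\<lambda>e'. deriv (\<lambda>e''. mom_integrand p q e'' y) e') e \<partial>\<mu>)) (at e))"

definition condition_H :: "'y measure \<Rightarrow> (real \<Rightarrow> bool \<Rightarrow> 'y \<Rightarrow> real) \<Rightarrow> real \<Rightarrow> bool" where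
  "condition_H \<mu> p e \<longleftrightarrow>
     summable (\<lambda>q. (real q + 1) * m0 \<mu> p q e) \<and>
     summable (\<lambda>q. (5/2) ^ (2 * (q + 1)) * \<bar>m1 \<mu> p (q + 1) e\<bar>) \<and>
     summable (\<lambda>q. \<bar>m2 \<mu> p (q + 1) e\<bar> / (real (2 * (q + 1)) * real (2 * (q + 1) - 1))) \<and>
     (sqrt 2 - 1) * (5/2)^2 * \<bar>m1 \<mu> p 1 e\<bar> >
       (\<Sum>q. (5/2) ^ (2 * (q + 2)) * \<bar>m1 \<mu> p (q + 2) e\<bar>)"

end

theory Submission
  imports Defs
begin

text \<open>
  By channel symmetry the conditional entropy of a code equals that of a uniform word given the channel
  output and its random syndrome, so only entropies of linear observations of independent bits occur.
  Interpolate by replacing the parity checks, one at a time, by independent noisy observations of their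
  bits, the observation of a bit in a check of degree \<open>k\<close> having the law of \<open>\<Prod>i<k-1. tanh (V i)\<close>.
  Observing a spin \<open>g = \<plusminus>1\<close> with noise magnetisation \<open>t\<close> lowers the entropy by the mean of
  \<open>\<phi> t - \<phi> (t * m)\<close>, where \<open>m\<close> is the posterior mean of \<open>g\<close> and \<open>\<phi> z = \<Sum>p\<ge>1. z^(2p) / (2p(2p-1))\<close>.
  If the bits of a check were independent given the rest, a step would cost exactly the tangent-line
  inequality \<open>x^k - k x q^(k-1) + (k-1) q^k \<ge> 0\<close> for \<open>x, q \<ge> 0\<close>, applied to each even moment.
  Independence is enforced by pinning: a bounded random number of bits, read from a small reserve of free
  sockets, is revealed. Mean squared magnetisations increase with each pin by at least a mean squared
  covariance, so for most numbers of pins the covariances are small, while the pins cost only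
  \<open>O(1)\<close> entropy in total.
  With all checks removed the graph splits into single variable nodes, whose entropies give the
  variable-node term of the replica-symmetric functional.
\<close>

subsection \<open>The entropy function and its series\<close>

text \<open>Entropies and information terms are treated as positively homogeneous functionals of an
  unnormalised posterior weight, so conditioning needs no division and Jensen's inequality becomes
  subadditivity. The tangent point is free: taking for \<open>q p\<close> the moment of order 2p + 2
  of tanh V makes every symmetric trial law a source of a lower bound. The tangent inequality speaks
  of a product of magnetisations, whereas a check reveals the magnetisation of a product; this gap
  is the obstacle that pinning removes. The magnetisations themselves are never computed: the part
  of the tangent that is linear in them is what the noisy observations of the bits contribute, and
  the two cancel up to terms that telescope in the number of pins. Even moments suffice although the
  functional contains ln (1 + t), because under a symmetric law ln (1 + t) and \<open>phi t\<close>
  have the same mean. The constants are chosen in the order \<epsilon>, K, number of pins, size of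
  the reserve, all independent of the block length, which grows last.\<close>

definition phi :: "real \<Rightarrow> real" where
  "phi z = ((1 + z) * ln (1 + z) + (1 - z) * ln (1 - z)) / 2"

text \<open>Equal to 1 / ((2p + 1)(2p + 2)). The difference form makes the sum of all coefficients
  the alternating harmonic series.\<close>

definition phi_coeff :: "nat \<Rightarrow> real" where
  "phi_coeff p = 1 / (2 * real p + 1) - 1 / (2 * real p + 2)"

text \<open>The index is shifted: term p carries the power 2p + 2. The coefficients are kept general
  because a random noise level merely rescales those of \<open>phi\<close> by moments.\<close>

definition even_series :: "(nat \<Rightarrow> real) \<Rightarrow> real \<Rightarrow> real" where
  "even_series a z = (\<Sum>p. a p * (z\<^sup>2) ^ Suc p)"

lemma phi_coeff_nonneg: "0 \<le> phi_coeff p"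
  by (simp add: phi_coeff_def field_simps)

lemma phi_coeff_sums: "phi_coeff sums ln 2"
proof -
  have "phi_coeff = (\<lambda>k. inverse (real_of_nat (2*k+1)) - inverse (real_of_nat (2*k+2)))"
    by (auto simp: phi_coeff_def divide_inverse add.commute)
  then show ?thesis using alternating_harmonic_series_sums' by simp
qed

lemma even_series_term_le:
  fixes z :: real and a :: "nat \<Rightarrow> real"
  assumes "\<bar>z\<bar> \<le> 1" "0 \<le> a p"
  shows "0 \<le> a p * (z\<^sup>2) ^ Suc p" "a p * (z\<^sup>2) ^ Suc p \<le> a p"
proof -
  have "z\<^sup>2 \<le> 1" using assms(1) abs_square_le_1[of z] by blast
  then have "(z\<^sup>2) ^ Suc p \<le> 1" using power_le_one[of "z\<^sup>2" "Suc p"] by simp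
  then show "a p * (z\<^sup>2) ^ Suc p \<le> a p" using assms(2) by (metis mult.right_neutral mult_left_mono)
  show "0 \<le> a p * (z\<^sup>2) ^ Suc p" using assms(2) by simp
qed

lemma even_series_summable:
  fixes z :: real and a :: "nat \<Rightarrow> real"
  assumes "\<bar>z\<bar> \<le> 1" "\<And>p. 0 \<le> a p" "summable a"
  shows "summable (\<lambda>p. a p * (z\<^sup>2) ^ Suc p)"
  using even_series_term_le[of z a] assms
  by (intro summable_comparison_test'[OF assms(3), of 0]) (simp_all del: power_Suc)

lemma even_series_nonneg:
  assumes "\<bar>z\<bar> \<le> 1" "\<And>p. 0 \<le> a p" "summable a"
  shows "0 \<le> even_series a z"
  unfolding even_series_def
  by (intro suminf_nonneg even_series_summable assms even_series_term_le)

lemma even_series_le: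
  assumes "\<bar>z\<bar> \<le> 1" "\<And>p. 0 \<le> a p" "summable a"
  shows "even_series a z \<le> suminf a"
  unfolding even_series_def
  by (intro suminf_le even_series_summable assms even_series_term_le)

text \<open>Split \<open>phi z\<close> into ln (1 - z^2) / 2 and (z / 2) ln ((1 + z) / (1 - z));
  both have classical power series on the open interval. The endpoints are added in
  \<open>phi_eq_even_series\<close>.\<close>

lemma phi_even_series_aux:
  assumes "\<bar>z\<bar> < 1"
  shows "(\<lambda>p. phi_coeff p * (z\<^sup>2) ^ Suc p) sums phi z"
proof -
  have z: "-1 < z" "z < 1" using assms by auto
  have z2: "\<bar>- z\<^sup>2\<bar> < 1" using z by (simp add: abs_square_less_1)
  have "(\<lambda>n. - ((- (- z\<^sup>2)) ^ n) / of_nat n) sums ln (1 + - z\<^sup>2)"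
    by (rule ln_series'[OF z2])
  then have "(\<lambda>n. - ((z\<^sup>2) ^ n) / real n) sums ln (1 - z\<^sup>2)" by simp
  then have "(\<lambda>n. - ((z\<^sup>2) ^ Suc n) / real (Suc n)) sums ln (1 - z\<^sup>2)"
    by (subst sums_Suc_iff) simp
  then have s1: "(\<lambda>n. - ((z\<^sup>2) ^ Suc n) / real (Suc n) / 2) sums (ln (1 - z\<^sup>2) / 2)"
    by (rule sums_divide)
  \<comment> \<open>Chosen so that (x - 1) / (x + 1) = z, the argument of the quadratic logarithm
    series.\<close>
  define x where "x = (1 + z) / (1 - z)"
  have x0: "x > 0" using z by (simp add: x_def)
  have xz: "(x - 1) / (x + 1) = z" using z by (simp add: x_def field_simps)
  have "(\<lambda>n. (2 * z ^ (2*n+1) / of_nat (2*n+1))) sums ln x"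
    using ln_series_quadratic[OF x0] unfolding xz .
  from sums_mult[OF this, of "z/2"]
  have s2: "(\<lambda>n. z/2 * (2 * z ^ (2*n+1) / of_nat (2*n+1))) sums (z/2 * ln x)" .
  have lnx: "ln x = ln (1 + z) - ln (1 - z)" using z by (simp add: x_def ln_div)
  have "ln (1 - z\<^sup>2) = ln ((1 + z) * (1 - z))" by (simp add: power2_eq_square algebra_simps)
  also have "\<dots> = ln (1 + z) + ln (1 - z)" using z by (simp add: ln_mult)
  finally have ln2: "ln (1 - z\<^sup>2) = ln (1 + z) + ln (1 - z)" .
  have "ln (1 - z\<^sup>2) / 2 + z/2 * ln x = phi z"
    unfolding ln2 lnx phi_def by (simp add: field_simps)
  with sums_add[OF s1 s2] have
    "(\<lambda>n. - ((z\<^sup>2) ^ Suc n) / real (Suc n) / 2 + z/2 * (2 * z ^ (2*n+1) / of_nat (2*n+1))) sums phi z"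
    by simp
  moreover have "- ((z\<^sup>2) ^ Suc n) / real (Suc n) / 2 + z/2 * (2 * z ^ (2*n+1) / of_nat (2*n+1))
      = phi_coeff n * (z\<^sup>2) ^ Suc n" for n
  proof -
    have e: "z/2 * (2 * z ^ (2*n+1) / of_nat (2*n+1)) = (z\<^sup>2) ^ Suc n / (2 * real n + 1)"
      by (simp add: power_mult power2_eq_square add.commute)
    show ?thesis unfolding e phi_coeff_def by (simp add: field_simps)
  qed
  ultimately show ?thesis by simp
qed

lemma phi_eq_even_series:
  assumes "\<bar>z\<bar> \<le> 1"
  shows "phi z = even_series phi_coeff z"
proof (cases "\<bar>z\<bar> < 1")
  case True
  then show ?thesis using phi_even_series_aux by (simp add: even_series_def sums_iff)
next
  case False
  then have "z = 1 \<or> z = -1" using assms by linarith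
  then show ?thesis using phi_coeff_sums by (auto simp: phi_def even_series_def sums_iff)
qed

lemma suminf_phi_coeff: "suminf phi_coeff = ln 2" and summable_phi_coeff: "summable phi_coeff"
  using phi_coeff_sums by (auto simp: sums_iff)

lemma phi_bounds: "\<bar>z\<bar> \<le> 1 \<Longrightarrow> 0 \<le> phi z" "\<bar>z\<bar> \<le> 1 \<Longrightarrow> phi z \<le> ln 2"
  using even_series_nonneg[of z phi_coeff] even_series_le[of z phi_coeff]
    phi_coeff_nonneg summable_phi_coeff suminf_phi_coeff phi_eq_even_series by auto

lemma even_series_convex:
  assumes "\<And>p. 0 \<le> a p" "summable a"
  shows "convex_on {-1..1} (even_series a)"
proof (rule convex_onI)
  fix t x y :: real assume t: "0 < t" "t < 1" and xy: "x \<in> {-1..1}" "y \<in> {-1..1}"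
  define z where "z = (1 - t) * x + t * y"
  have z: "z \<in> {-1..1}"
    using convexD[OF convex_real_interval(5)[of "-1" "1::real"], of x y "1-t" t] t xy
    by (simp add: z_def)
  have sm: "summable (\<lambda>p. a p * (u\<^sup>2) ^ Suc p)" if "u \<in> {-1..1}" for u
    using even_series_summable[of u a] assms that by (auto simp: abs_le_iff)
  have le: "a p * (z\<^sup>2) ^ Suc p \<le> (1 - t) * (a p * (x\<^sup>2) ^ Suc p) + t * (a p * (y\<^sup>2) ^ Suc p)" for p
  proof -
    have "convex_on UNIV (\<lambda>u::real. u ^ (2 * Suc p))" by (intro convex_power_even) auto
    from convex_onD[OF this, of t x y] have "z ^ (2 * Suc p) \<le> (1 - t) * x ^ (2 * Suc p) + t * y ^ (2 * Suc p)"
      using t by (simp add: z_def)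
    then have "(z\<^sup>2) ^ Suc p \<le> (1 - t) * (x\<^sup>2) ^ Suc p + t * (y\<^sup>2) ^ Suc p"
      by (simp only: power_mult)
    from mult_left_mono[OF this assms(1)[of p]] show ?thesis by (simp add: algebra_simps)
  qed
  have "even_series a z \<le> (\<Sum>p. (1 - t) * (a p * (x\<^sup>2) ^ Suc p) + t * (a p * (y\<^sup>2) ^ Suc p))"
    unfolding even_series_def
    by (intro suminf_le le sm z summable_add summable_mult xy)
  also have "\<dots> = (1 - t) * even_series a x + t * even_series a y"
    unfolding even_series_def
    using sm[OF xy(1)] sm[OF xy(2)] by (subst suminf_add[symmetric]) (auto simp: suminf_mult simp del: power_Suc intro!: summable_mult)
  finally show "even_series a ((1 - t) *\<^sub>R x + t *\<^sub>R y) \<le> (1 - t) * even_series a x + t * even_series a y"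
    by (simp add: z_def)
qed (rule convex_real_interval)

text \<open>Summable coefficients dominate the terms on the whole closed interval, so the
  convergence is uniform up to the endpoints.\<close>

lemma even_series_continuous:
  assumes "\<And>p. 0 \<le> a p" "summable a"
  shows "continuous_on {-1..1} (even_series a)"
proof -
  have "uniform_limit {-1..1} (\<lambda>n z. \<Sum>p<n. a p * (z\<^sup>2) ^ Suc p) (even_series a) sequentially"
    unfolding even_series_def
    using even_series_term_le[of _ a] assms
    by (intro Weierstrass_m_test[OF _ assms(2)]) (auto simp: abs_le_iff simp del: power_Suc)
  then show ?thesis
    by (rule uniform_limit_theorem[rotated]) (auto intro!: always_eventually continuous_intros)
qed

text \<open>The additive slack is needed because \<open>phi\<close> is not Lipschitz at the endpoints.\<close>
lemma phi_quadratic_modulus: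
  assumes "0 < e"
  obtains K where "0 \<le> K" "\<And>x y. \<bar>x\<bar> \<le> 1 \<Longrightarrow> \<bar>y\<bar> \<le> 1 \<Longrightarrow> phi x - phi y \<le> e + K * (x - y)\<^sup>2"
proof -
  have "continuous_on {-1..1} phi"
    using even_series_continuous[of phi_coeff] phi_coeff_nonneg summable_phi_coeff
    by (subst continuous_on_cong[OF refl phi_eq_even_series]) auto
  then have "uniformly_continuous_on {-1..1} phi"
    by (intro compact_uniformly_continuous) auto
  then obtain d where d: "0 < d" "\<And>x y. x \<in> {-1..1} \<Longrightarrow> y \<in> {-1..1} \<Longrightarrow> dist y x < d \<Longrightarrow> dist (phi y) (phi x) < e"
    using assms unfolding uniformly_continuous_on_def by metis
  show thesis
  \<comment> \<open>At distance at least d the quadratic term alone reaches ln 2, the full range of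
    \<open>phi\<close>; closer points are covered by uniform continuity.\<close>
  proof (rule that[of "ln 2 / d\<^sup>2"])
    show "0 \<le> ln 2 / d\<^sup>2" by simp
    fix x y :: real assume xy: "\<bar>x\<bar> \<le> 1" "\<bar>y\<bar> \<le> 1"
    show "phi x - phi y \<le> e + ln 2 / d\<^sup>2 * (x - y)\<^sup>2"
    proof (cases "\<bar>x - y\<bar> < d")
      case True
      then have "\<bar>phi x - phi y\<bar> < e" using d(2)[of y x] xy by (auto simp: dist_real_def abs_le_iff)
      moreover have "0 \<le> ln 2 / d\<^sup>2 * (x - y)\<^sup>2" by simp
      ultimately show ?thesis by linarith
    next
      case False
      then have "d\<^sup>2 \<le> (x - y)\<^sup>2" using d(1) by (metis abs_le_square_iff abs_of_pos not_less)
      then have "ln 2 / d\<^sup>2 * d\<^sup>2 \<le> ln 2 / d\<^sup>2 * (x - y)\<^sup>2" by (intro mult_left_mono) auto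
      then have "ln 2 \<le> ln 2 / d\<^sup>2 * (x - y)\<^sup>2" using d(1) by simp
      then show ?thesis using phi_bounds(2)[OF xy(1)] phi_bounds(1)[OF xy(2)] assms by linarith
    qed
  qed
qed

text \<open>Multiplying the bound for k by x loses exactly k q^(k-1) (x - q)^2, which drives the
  induction. At k = 0 the natural number \<open>k - 1\<close> is 0 while \<open>real k - 1\<close>
  is -1, and both sides equal 1.\<close>

lemma power_above_tangent:
  fixes x q :: real
  assumes "0 \<le> x" "0 \<le> q"
  shows "real k * x * q ^ (k - 1) - (real k - 1) * q ^ k \<le> x ^ k"
proof (induction k)
  case (Suc k)
  show ?case
  proof (cases k)
    case (Suc j)
    have "0 \<le> real k * q ^ j * (x - q)\<^sup>2" using assms by simp
    then have "real (Suc k) * x * q ^ k - real k * q ^ Suc k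
       \<le> x * (real k * x * q ^ (k - 1) - (real k - 1) * q ^ k)"
      unfolding Suc by (simp add: algebra_simps power2_eq_square)
    also have "\<dots> \<le> x * x ^ k" using Suc.IH assms by (intro mult_left_mono) auto
    finally show ?thesis by simp
  qed simp
qed simp

lemma phi_minus: "phi (- z) = phi z" by (simp add: phi_def)
lemma phi_one: "phi 1 = ln 2" by (simp add: phi_def)
subsection \<open>Noisy observations of spins\<close>

definition nonneg :: "('x \<Rightarrow> real) \<Rightarrow> bool" where
  "nonneg w \<longleftrightarrow> (\<forall>x. 0 \<le> w x)"

definition spin :: "('x \<Rightarrow> real) \<Rightarrow> bool" where
  "spin g \<longleftrightarrow> (\<forall>x. g x = 1 \<or> g x = -1)"

text \<open>The unnormalised posterior after a noisy observation \<open>b = \<plusminus>1\<close> of the spin \<open>g\<close>, the noise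
  flipping the sign with probability \<open>(1 - t) / 2\<close>; \<open>t = 1\<close> reveals \<open>g\<close> exactly.\<close>
definition upd :: "('x \<Rightarrow> real) \<Rightarrow> real \<Rightarrow> real \<Rightarrow> ('x \<Rightarrow> real) \<Rightarrow> 'x \<Rightarrow> real" where
  "upd g t b w = (\<lambda>x. w x * ((1 + b * t * g x) / 2))"

text \<open>The total of each posterior is the joint weight of the outcome, so for a homogeneous
  \<open>f\<close> this sum is the expectation over the outcome.\<close>

definition obs :: "('x \<Rightarrow> real) \<Rightarrow> real \<Rightarrow> (('x \<Rightarrow> real) \<Rightarrow> real) \<Rightarrow> ('x \<Rightarrow> real) \<Rightarrow> real" where
  "obs g t f w = f (upd g t 1 w) + f (upd g t (-1) w)"

primrec reveal :: "('x \<Rightarrow> real) list \<Rightarrow> (('x \<Rightarrow> real) \<Rightarrow> real) \<Rightarrow> ('x \<Rightarrow> real) \<Rightarrow> real" where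
  "reveal [] f = f"
| "reveal (g # gs) f = obs g 1 (reveal gs f)"

text \<open>Homogeneous extension of a convex function of the normalised posterior. Admitting c = 0
  also fixes the value 0 at the zero weight.\<close>

definition sublin :: "(('x \<Rightarrow> real) \<Rightarrow> real) \<Rightarrow> bool" where
  "sublin f \<longleftrightarrow>
     (\<forall>u v. nonneg u \<longrightarrow> nonneg v \<longrightarrow> f (\<lambda>x. u x + v x) \<le> f u + f v) \<and>
     (\<forall>c w. 0 \<le> c \<longrightarrow> nonneg w \<longrightarrow> f (\<lambda>x. c * w x) = c * f w)"

lemma spin_mult: "spin g \<Longrightarrow> spin h \<Longrightarrow> spin (\<lambda>x. g x * h x)"
  unfolding spin_def by (metis mult.left_neutral mult_minus_left minus_minus)

lemma spin_one: "spin (\<lambda>x. 1)" by (simp add: spin_def)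

lemma spin_prod_list: "(\<And>s. s \<in> set ss \<Longrightarrow> spin (\<sigma> s)) \<Longrightarrow> spin (\<lambda>x. \<Prod>s\<leftarrow>ss. \<sigma> s x)"
  by (induction ss) (auto simp: spin_one intro!: spin_mult)

lemma spin_abs_le: "spin g \<Longrightarrow> \<bar>g x\<bar> \<le> 1"
  unfolding spin_def by (metis abs_minus abs_one order_refl)

lemma likelihood_nonneg:
  assumes "\<bar>t\<bar> \<le> 1" "spin g" "b = 1 \<or> b = -1"
  shows "0 \<le> 1 + b * t * g x"
proof -
  have "\<bar>b * t * g x\<bar> \<le> 1 * 1 * 1"
    using assms(1,3) spin_abs_le[OF assms(2), of x]
    unfolding abs_mult by (intro mult_mono) auto
  then show ?thesis by linarith
qed

lemma upd_nonneg:
  assumes "\<bar>t\<bar> \<le> 1" "spin g" "nonneg w"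
  shows "nonneg (upd g t 1 w)" "nonneg (upd g t (-1) w)"
  using likelihood_nonneg[OF assms(1,2), of 1] likelihood_nonneg[OF assms(1,2), of "-1"] assms(3)
  unfolding nonneg_def upd_def by (auto intro!: mult_nonneg_nonneg divide_nonneg_nonneg)

lemma upd_commute: "upd g t b (upd h s c w) = upd h s c (upd g t b w)"
  by (simp add: upd_def mult_ac)

lemma obs_commute: "obs g t (obs h s f) w = obs h s (obs g t f) w"
  by (simp add: obs_def upd_commute[of h s])

lemma reveal_append: "reveal (gs @ hs) f = reveal gs (reveal hs f)"
  by (induction gs) auto

lemma obs_reveal_commute: "obs g t (reveal hs f) w = reveal hs (obs g t f) w"
proof (induction hs arbitrary: w)
  case (Cons h hs)
  have "obs g t (reveal (h # hs) f) w = obs h 1 (obs g t (reveal hs f)) w"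
    by (simp add: obs_commute)
  also have "\<dots> = obs h 1 (reveal hs (obs g t f)) w"
    by (simp only: obs_def[of h] Cons)
  finally show ?case by simp
qed simp

lemma obs_mono:
  assumes "\<bar>t\<bar> \<le> 1" "spin g" "nonneg w" "\<And>u. nonneg u \<Longrightarrow> f u \<le> f' u"
  shows "obs g t f w \<le> obs g t f' w"
  unfolding obs_def using assms upd_nonneg[OF assms(1-3)] by (intro add_mono) auto

lemma obs_cong:
  assumes "\<bar>t\<bar> \<le> 1" "spin g" "nonneg w" "\<And>u. nonneg u \<Longrightarrow> f u = f' u"
  shows "obs g t f w = obs g t f' w"
  unfolding obs_def using assms upd_nonneg[OF assms(1-3)] by auto

lemma reveal_mono:
  assumes "list_all spin gs" "nonneg w" "\<And>u. nonneg u \<Longrightarrow> f u \<le> f' u"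
  shows "reveal gs f w \<le> reveal gs f' w"
  using assms(1,2)
  by (induction gs arbitrary: w) (auto simp: assms(3) intro!: obs_mono)

lemma reveal_cong:
  assumes "list_all spin gs" "nonneg w" "\<And>u. nonneg u \<Longrightarrow> f u = f' u"
  shows "reveal gs f w = reveal gs f' w"
  using assms by (intro antisym reveal_mono) auto

lemma reveal_add: "reveal gs (\<lambda>w. f w + f' w) w = reveal gs f w + reveal gs f' w"
  by (induction gs arbitrary: w) (auto simp: obs_def)

lemma reveal_diff: "reveal gs (\<lambda>w. f w - f' w) w = reveal gs f w - reveal gs f' w"
  by (induction gs arbitrary: w) (auto simp: obs_def)

lemma reveal_cmult: "reveal gs (\<lambda>w. c * f w) w = c * reveal gs f w"
  by (induction gs arbitrary: w) (auto simp: obs_def algebra_simps)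

lemma reveal_divide: "reveal gs (\<lambda>w. f w / c) w = reveal gs f w / c"
  by (induction gs arbitrary: w) (auto simp: obs_def add_divide_distrib)

lemma reveal_sum: "reveal gs (\<lambda>w. \<Sum>i\<in>I. f i w) w = (\<Sum>i\<in>I. reveal gs (f i) w)"
  by (induction gs arbitrary: w) (auto simp: obs_def sum.distrib)

subsection \<open>Sublinear functionals\<close>

lemma sublinD:
  assumes "sublin f" 
  shows "nonneg u \<Longrightarrow> nonneg v \<Longrightarrow> f (\<lambda>x. u x + v x) \<le> f u + f v"
    and "0 \<le> c \<Longrightarrow> nonneg w \<Longrightarrow> f (\<lambda>x. c * w x) = c * f w"
  using assms by (auto simp: sublin_def)

lemma upd_add: "upd g t b (\<lambda>x. u x + v x) = (\<lambda>x. upd g t b u x + upd g t b v x)"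
  by (auto simp: upd_def algebra_simps add_divide_distrib)

lemma upd_scale: "upd g t b (\<lambda>x. c * u x) = (\<lambda>x. c * upd g t b u x)"
  by (auto simp: upd_def)

lemma sublin_obs:
  assumes "sublin f" "\<bar>t\<bar> \<le> 1" "spin g"
  shows "sublin (obs g t f)"
proof -
  have "obs g t f (\<lambda>x. u x + v x) \<le> obs g t f u + obs g t f v" if "nonneg u" "nonneg v" for u v
    using sublinD(1)[OF assms(1), of "upd g t 1 u" "upd g t 1 v"]
      sublinD(1)[OF assms(1), of "upd g t (-1) u" "upd g t (-1) v"]
      upd_nonneg[OF assms(2,3)] that unfolding obs_def upd_add by auto
  moreover have "obs g t f (\<lambda>x. c * w x) = c * obs g t f w" if "0 \<le> c" "nonneg w" for c w
    using sublinD(2)[OF assms(1), of c "upd g t 1 w"]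
      sublinD(2)[OF assms(1), of c "upd g t (-1) w"]
      upd_nonneg[OF assms(2,3)] that unfolding obs_def upd_scale by (auto simp: algebra_simps)
  ultimately show ?thesis by (auto simp: sublin_def)
qed

lemma sublin_reveal: "sublin f \<Longrightarrow> list_all spin gs \<Longrightarrow> sublin (reveal gs f)"
  by (induction gs) (auto intro!: sublin_obs)

text \<open>The two posteriors add up to \<open>w\<close>, so subadditivity says precisely that
  information increases a convex functional on average.\<close>

lemma sublin_le_obs:
  assumes "sublin f" "\<bar>t\<bar> \<le> 1" "spin g" "nonneg w"
  shows "f w \<le> obs g t f w"
proof -
  have "w = (\<lambda>x. upd g t 1 w x + upd g t (-1) w x)"
    by (auto simp: upd_def field_simps)
  then show ?thesis
    using sublinD(1)[OF assms(1) upd_nonneg[OF assms(2-4)]] by (simp add: obs_def)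
qed

lemma sublin_le_reveal:
  assumes "sublin f" "list_all spin gs" "nonneg w"
  shows "f w \<le> reveal gs f w"
  using assms(2,3)
proof (induction gs arbitrary: w)
  case (Cons g gs)
  have "f w \<le> reveal gs f w" using Cons by auto
  also have "\<dots> \<le> obs g 1 (reveal gs f) w"
    using Cons assms(1) by (intro sublin_le_obs sublin_reveal) auto
  finally show ?case by simp
qed simp

text \<open>A noisy observation is a degraded version of the exact one.\<close>
lemma sublin_obs_le_obs_one:
  assumes "sublin f" "\<bar>t\<bar> \<le> 1" "spin g" "nonneg w"
  shows "obs g t f w \<le> obs g 1 f w"
proof -
  let ?p = "upd g 1 1 w" and ?m = "upd g 1 (-1) w"
  have n: "nonneg ?p" "nonneg ?m" using upd_nonneg[of 1 g w] assms by auto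
  have ns: "nonneg (\<lambda>x. c * ?p x)" "nonneg (\<lambda>x. c * ?m x)" if "0 \<le> c" for c
    using n that by (auto simp: nonneg_def)
  have dec: "upd g t b w = (\<lambda>x. (1 + b * t) / 2 * ?p x + (1 - b * t) / 2 * ?m x)" for b
  proof
    fix x show "upd g t b w x = (1 + b * t) / 2 * ?p x + (1 - b * t) / 2 * ?m x"
      using assms(3)[unfolded spin_def, rule_format, of x] by (auto simp: upd_def)
  qed
  have c: "0 \<le> (1 + 1 * t) / 2" "0 \<le> (1 - 1 * t) / 2" "0 \<le> (1 + (-1) * t) / 2" "0 \<le> (1 - (-1) * t) / 2"
    using assms(2) by auto
  have "f (upd g t 1 w) \<le> (1 + 1 * t) / 2 * f ?p + (1 - 1 * t) / 2 * f ?m"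
    unfolding dec
    using sublinD(1)[OF assms(1) ns(1)[OF c(1)] ns(2)[OF c(2)]]
    unfolding sublinD(2)[OF assms(1) c(1) n(1)] sublinD(2)[OF assms(1) c(2) n(2)] .
  moreover have "f (upd g t (-1) w) \<le> (1 + (-1) * t) / 2 * f ?p + (1 - (-1) * t) / 2 * f ?m"
    unfolding dec
    using sublinD(1)[OF assms(1) ns(1)[OF c(3)] ns(2)[OF c(4)]]
    unfolding sublinD(2)[OF assms(1) c(3) n(1)] sublinD(2)[OF assms(1) c(4) n(2)] .
  ultimately show ?thesis unfolding obs_def by (simp add: field_simps)
qed

text \<open>Revealing two spins is finer than revealing their product.\<close>
lemma sublin_obs_mult_le:
  assumes "sublin f" "spin g" "spin h" "nonneg w"
  shows "obs (\<lambda>x. g x * h x) 1 f w \<le> obs g 1 (obs h 1 f) w"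
proof -
  let ?u = "\<lambda>b c. upd h 1 c (upd g 1 b w)"
  have n: "nonneg (?u b c)" if "b = 1 \<or> b = -1" "c = 1 \<or> c = -1" for b c
    using that upd_nonneg[of 1 g w] upd_nonneg[of 1 h] assms by auto
  have dec: "upd (\<lambda>x. g x * h x) 1 b w = (\<lambda>x. ?u 1 b x + ?u (-1) (- b) x)" if "b = 1 \<or> b = -1" for b
  proof
    fix x show "upd (\<lambda>x. g x * h x) 1 b w x = ?u 1 b x + ?u (-1) (- b) x"
      using assms(2,3)[unfolded spin_def, rule_format, of x] that by (auto simp: upd_def)
  qed
  have "f (upd (\<lambda>x. g x * h x) 1 1 w) \<le> f (?u 1 1) + f (?u (-1) (-1))"
    using dec[of 1] sublinD(1)[OF assms(1) n[of 1 1] n[of "-1" "-1"]] by simp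
  moreover have "f (upd (\<lambda>x. g x * h x) 1 (-1) w) \<le> f (?u 1 (-1)) + f (?u (-1) 1)"
    using dec[of "-1"] sublinD(1)[OF assms(1) n[of 1 "-1"] n[of "-1" 1]] by simp
  ultimately show ?thesis by (simp add: obs_def)
qed

lemma sublin_obs_prod_le_reveal:
  assumes "sublin f" "\<And>s. s \<in> set ss \<Longrightarrow> spin (\<sigma> s)" "nonneg w"
  shows "obs (\<lambda>x. \<Prod>s\<leftarrow>ss. \<sigma> s x) 1 f w \<le> reveal (map \<sigma> ss) f w"
  using assms(2,3)
proof (induction ss arbitrary: w)
  case Nil
  \<comment> \<open>The empty product is the constant spin 1: the outcome -1 has weight zero, where
    homogeneity with c = 0 gives the value 0.\<close>
  have "upd (\<lambda>x. 1) 1 1 w = w" "upd (\<lambda>x. 1) 1 (-1) w = (\<lambda>x. 0 * w x)" by (auto simp: upd_def)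
  then show ?case using sublinD(2)[OF assms(1), of 0 w] Nil by (simp add: obs_def)
next
  case (Cons s ss)
  have "obs (\<lambda>x. \<Prod>s\<leftarrow>s # ss. \<sigma> s x) 1 f w \<le> obs (\<sigma> s) 1 (obs (\<lambda>x. \<Prod>s\<leftarrow>ss. \<sigma> s x) 1 f) w"
    using Cons.prems assms(1) sublin_obs_mult_le[of f "\<sigma> s" "\<lambda>x. \<Prod>s\<leftarrow>ss. \<sigma> s x" w]
    by (simp add: spin_prod_list)
  also have "\<dots> \<le> obs (\<sigma> s) 1 (reveal (map \<sigma> ss) f) w"
    using Cons by (intro obs_mono) auto
  finally show ?case by simp
qed

lemma sublin_sum: "(\<And>i. i \<in> I \<Longrightarrow> sublin (f i)) \<Longrightarrow> sublin (\<lambda>w. \<Sum>i\<in>I. f i w)"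
  unfolding sublin_def by (auto simp: sum_distrib_left sum.distrib[symmetric] intro!: sum_mono sum.cong)

lemma sublin_divide: "0 \<le> c \<Longrightarrow> sublin f \<Longrightarrow> sublin (\<lambda>w. f w / c)"
  unfolding sublin_def by (auto simp: add_divide_distrib[symmetric] intro!: divide_right_mono)

subsection \<open>Entropy\<close>

locale weights =
  fixes A :: "'x set"
  assumes finite_A[simp]: "finite A"
begin

definition tot :: "('x \<Rightarrow> real) \<Rightarrow> real" where
  "tot w = (\<Sum>x\<in>A. w x)"

text \<open>Total weight times the Shannon entropy of the normalised weight, hence homogeneous of
  degree one; points of weight 0 contribute 0.\<close>

definition ent :: "('x \<Rightarrow> real) \<Rightarrow> real" where
  "ent w = (\<Sum>x\<in>A. w x * ln (tot w / w x))"

definition mag :: "('x \<Rightarrow> real) \<Rightarrow> ('x \<Rightarrow> real) \<Rightarrow> real" where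
  "mag g w = (\<Sum>x\<in>A. w x * g x) / tot w"

text \<open>The perspective of \<psi>: if \<psi> is convex, a convex function of the posterior mean
  becomes a sublinear functional. On a null weight \<open>mag\<close> is 0 by division by zero, and
  the prefactor removes the value.\<close>

definition persp :: "(real \<Rightarrow> real) \<Rightarrow> ('x \<Rightarrow> real) \<Rightarrow> ('x \<Rightarrow> real) \<Rightarrow> real" where
  "persp \<psi> g w = tot w * \<psi> (mag g w)"

lemma tot_nonneg: "nonneg w \<Longrightarrow> 0 \<le> tot w"
  by (auto simp: tot_def nonneg_def intro!: sum_nonneg)

lemma le_tot: "nonneg w \<Longrightarrow> x \<in> A \<Longrightarrow> w x \<le> tot w"
  unfolding tot_def nonneg_def by (intro member_le_sum) auto

lemma tot_mag: 
  assumes "nonneg w" shows "tot w * mag g w = (\<Sum>x\<in>A. w x * g x)"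
proof (cases "tot w = 0")
  case True
  then have "w x = 0" if "x \<in> A" for x
    using that assms le_tot[OF assms that] by (auto simp: nonneg_def intro: antisym)
  then show ?thesis using True by simp
qed (simp add: mag_def)

lemma abs_mag_le:
  assumes "nonneg w" "spin g" shows "\<bar>mag g w\<bar> \<le> 1"
proof -
  have "\<bar>\<Sum>x\<in>A. w x * g x\<bar> \<le> (\<Sum>x\<in>A. \<bar>w x * g x\<bar>)" by (rule sum_abs)
  also have "\<dots> \<le> tot w" unfolding tot_def abs_mult
    using assms(1) spin_abs_le[OF assms(2)]
    by (intro sum_mono) (auto simp: nonneg_def intro!: mult_left_le)
  finally show ?thesis using tot_nonneg[OF assms(1)]
    by (cases "tot w = 0") (auto simp: mag_def abs_divide field_simps)
qed

lemma tot_upd: 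
  assumes "nonneg w" shows "tot (upd g t b w) = tot w * ((1 + b * t * mag g w) / 2)"
proof -
  have "tot (upd g t b w) = (tot w + b * t * (\<Sum>x\<in>A. w x * g x)) / 2"
    unfolding tot_def upd_def sum_distrib_left sum.distrib[symmetric] sum_divide_distrib
    by (intro sum.cong) (auto simp: algebra_simps)
  then show ?thesis using tot_mag[OF assms, of g] by (simp add: algebra_simps)
qed

lemma obs_tot: "obs g t tot w = tot w"
  unfolding obs_def tot_def upd_def sum.distrib[symmetric]
  by (intro sum.cong) (auto simp: field_simps)

lemma reveal_tot: "reveal gs tot w = tot w"
proof (induction gs arbitrary: w)
  case (Cons g gs)
  have "reveal gs tot = tot" using Cons by auto
  then show ?case by (simp add: obs_tot)
qed simp

definition xlnx :: "real \<Rightarrow> real" where "xlnx u = u * ln u"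

lemma xlnx_mult: "0 \<le> u \<Longrightarrow> 0 \<le> v \<Longrightarrow> xlnx (u * v) = u * xlnx v + v * xlnx u"
  by (cases "u = 0 \<or> v = 0") (auto simp: xlnx_def ln_mult algebra_simps)

lemma ent_eq_xlnx:
  assumes "nonneg w" shows "ent w = xlnx (tot w) - (\<Sum>x\<in>A. xlnx (w x))"
proof -
  have "ent w = (\<Sum>x\<in>A. w x * ln (tot w) - xlnx (w x))"
    unfolding ent_def
  proof (intro sum.cong refl)
    fix x assume x: "x \<in> A"
    show "w x * ln (tot w / w x) = w x * ln (tot w) - xlnx (w x)"
    proof (cases "w x = 0")
      case False
      then have "0 < w x" using assms by (auto simp: nonneg_def less_le)
      moreover then have "0 < tot w" using le_tot[OF assms x] by linarith
      ultimately show ?thesis by (simp add: xlnx_def ln_div algebra_simps)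
    qed (simp add: xlnx_def)
  qed
  then show ?thesis by (simp add: sum_subtractf xlnx_def tot_def sum_distrib_right)
qed

text \<open>This identifies \<open>phi z\<close> as ln 2 minus the Shannon entropy of a spin with
  mean z.\<close>

lemma xlnx_half_sum: 
  assumes "\<bar>z\<bar> \<le> 1" 
  shows "xlnx ((1 + z) / 2) + xlnx ((1 - z) / 2) = phi z - ln 2"
proof -
  have h: "xlnx (v / 2) = xlnx v / 2 - v / 2 * ln 2" if "0 \<le> v" for v
    using that by (cases "v = 0") (auto simp: xlnx_def ln_div algebra_simps)
  have "xlnx ((1 + z) / 2) + xlnx ((1 - z) / 2)
      = xlnx (1 + z) / 2 - (1 + z) / 2 * ln 2 + (xlnx (1 - z) / 2 - (1 - z) / 2 * ln 2)"
    using assms by (subst (1 2) h) auto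
  also have "\<dots> = phi z - ln 2" by (simp add: xlnx_def phi_def field_simps)
  finally show ?thesis .
qed

text \<open>By the product rule for \<open>xlnx\<close>, the totals of the two posteriors produce
  \<open>phi (t * mag g w)\<close>, while each point produces \<open>phi (t * g x)\<close>, which is
  \<open>phi t\<close> since \<open>phi\<close> is even and \<open>g x\<close> is 1 or -1. The
  subtracted amount is the mutual information of the observation.\<close>

lemma obs_ent:
  assumes "\<bar>t\<bar> \<le> 1" "spin g" "nonneg w"
  shows "obs g t ent w = ent w - (tot w * phi t - tot w * phi (t * mag g w))"
proof -
  note n = upd_nonneg[OF assms]
  have l: "0 \<le> (1 + b * t * g x) / 2" if "b = 1 \<or> b = -1" for b x
    using likelihood_nonneg[OF assms(1,2) that] by simp
  have z: "\<bar>t * mag g w\<bar> \<le> 1"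
    unfolding abs_mult using assms(1) abs_mag_le[OF assms(3,2)] by (intro mult_le_one) auto
  have T: "xlnx (tot (upd g t 1 w)) + xlnx (tot (upd g t (-1) w)) = xlnx (tot w) + tot w * (phi (t * mag g w) - ln 2)"
  proof -
    have "xlnx (tot (upd g t b w)) = tot w * xlnx ((1 + b * t * mag g w) / 2) + (1 + b * t * mag g w) / 2 * xlnx (tot w)"
      if "b = 1 \<or> b = -1" for b
      unfolding tot_upd[OF assms(3)] using z that tot_nonneg[OF assms(3)] by (intro xlnx_mult) auto
    note e = this[of 1] this[of "-1"]
    have "xlnx (tot (upd g t 1 w)) + xlnx (tot (upd g t (-1) w))
      = tot w * (xlnx ((1 + t * mag g w) / 2) + xlnx ((1 - t * mag g w) / 2)) + xlnx (tot w)"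
      unfolding e[simplified] by (simp add: algebra_simps add_divide_distrib diff_divide_distrib)
    then show ?thesis using xlnx_half_sum[OF z] by simp
  qed
  have X: "xlnx (upd g t 1 w x) + xlnx (upd g t (-1) w x) = xlnx (w x) + w x * (phi t - ln 2)" for x
  proof -
    have "xlnx (upd g t b w x) = w x * xlnx ((1 + b * t * g x) / 2) + (1 + b * t * g x) / 2 * xlnx (w x)"
      if "b = 1 \<or> b = -1" for b
      unfolding upd_def using l[OF that] assms(3) by (intro xlnx_mult) (auto simp: nonneg_def)
    note e = this[of 1] this[of "-1"]
    have tg: "\<bar>t * g x\<bar> \<le> 1"
      unfolding abs_mult using assms(1) spin_abs_le[OF assms(2)] by (intro mult_le_one) auto
    have "phi (t * g x) = phi t" using assms(2) phi_minus[of t] by (auto simp: spin_def) (metis mult.right_neutral mult_minus_right)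
    have "xlnx (upd g t 1 w x) + xlnx (upd g t (-1) w x)
      = w x * (xlnx ((1 + t * g x) / 2) + xlnx ((1 - t * g x) / 2)) + xlnx (w x)"
      unfolding e[simplified] by (simp add: algebra_simps add_divide_distrib diff_divide_distrib)
    then show ?thesis using xlnx_half_sum[OF tg] \<open>phi (t * g x) = phi t\<close> by simp
  qed
  have "(\<Sum>x\<in>A. xlnx (upd g t 1 w x)) + (\<Sum>x\<in>A. xlnx (upd g t (-1) w x))
      = (\<Sum>x\<in>A. xlnx (w x)) + tot w * (phi t - ln 2)"
    unfolding sum.distrib[symmetric] X unfolding sum.distrib tot_def sum_distrib_right ..
  then show ?thesis
    unfolding obs_def ent_eq_xlnx[OF n(1)] ent_eq_xlnx[OF n(2)] ent_eq_xlnx[OF assms(3)]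
    using T by (simp add: algebra_simps)
qed

lemma ent_nonneg: 
  assumes "nonneg w" shows "0 \<le> ent w"
  unfolding ent_def
proof (intro sum_nonneg)
  fix x assume x: "x \<in> A"
  show "0 \<le> w x * ln (tot w / w x)"
  proof (cases "w x = 0")
    case False
    then have "0 < w x" using assms by (auto simp: nonneg_def less_le)
    then show ?thesis using le_tot[OF assms x] by (intro mult_nonneg_nonneg ln_ge_zero) auto
  qed simp
qed

lemma persp_nonneg:
  assumes "nonneg w" "spin g" "\<And>z. \<bar>z\<bar> \<le> 1 \<Longrightarrow> 0 \<le> \<psi> z"
  shows "0 \<le> persp \<psi> g w"
  unfolding persp_def using tot_nonneg abs_mag_le assms by (intro mult_nonneg_nonneg) auto

lemma persp_le:
  assumes "nonneg w" "spin g" "\<And>z. \<bar>z\<bar> \<le> 1 \<Longrightarrow> \<psi> z \<le> c"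
  shows "persp \<psi> g w \<le> c * tot w"
  unfolding persp_def using tot_nonneg[OF assms(1)] abs_mag_le assms
  by (subst mult.commute) (intro mult_right_mono, auto)

lemma sublin_persp:
  assumes "convex_on {-1..1} \<psi>" "spin g"
  shows "sublin (persp \<psi> g)"
proof -
  have "persp \<psi> g (\<lambda>x. u x + v x) \<le> persp \<psi> g u + persp \<psi> g v" if n: "nonneg u" "nonneg v" for u v
  proof -
    let ?s = "\<lambda>x. u x + v x"
    have ns: "nonneg ?s" using n by (auto simp: nonneg_def)
    have T: "tot ?s = tot u + tot v" by (simp add: tot_def sum.distrib)
    have M: "tot ?s * mag g ?s = tot u * mag g u + tot v * mag g v"
      unfolding tot_mag[OF ns] tot_mag[OF n(1)] tot_mag[OF n(2)] by (simp add: sum.distrib algebra_simps)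
    show ?thesis
    proof (cases "tot ?s = 0")
      case True
      then have "tot u = 0" "tot v = 0" using T tot_nonneg[OF n(1)] tot_nonneg[OF n(2)] by auto
      then show ?thesis using True by (simp add: persp_def)
    next
      case False
      then have p: "0 < tot ?s" using tot_nonneg[OF ns] by linarith
      define c where "c = tot v / tot ?s"
      have c: "0 \<le> c" "c \<le> 1" "tot v = c * tot ?s" "tot u = (1 - c) * tot ?s"
        using p T tot_nonneg[OF n(1)] tot_nonneg[OF n(2)] by (auto simp: c_def field_simps)
      have "tot ?s * mag g ?s = tot ?s * ((1 - c) * mag g u + c * mag g v)"
        unfolding M c(3,4) by (simp add: algebra_simps)
      then have m: "mag g ?s = (1 - c) * mag g u + c * mag g v" using p by simp
      have "\<psi> (mag g ?s) \<le> (1 - c) * \<psi> (mag g u) + c * \<psi> (mag g v)"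
        unfolding m using convex_onD[OF assms(1), of c "mag g u" "mag g v"] c
          abs_mag_le[OF n(1) assms(2)] abs_mag_le[OF n(2) assms(2)] by (auto simp: abs_le_iff)
      from mult_left_mono[OF this, of "tot ?s"] p show ?thesis
        unfolding persp_def c(3,4) by (simp add: algebra_simps)
    qed
  qed
  moreover have "persp \<psi> g (\<lambda>x. c * w x) = c * persp \<psi> g w" if "0 \<le> c" "nonneg w" for c w
  proof (cases "c = 0")
    case False
    have T: "tot (\<lambda>x. c * w x) = c * tot w" by (simp add: tot_def sum_distrib_left)
    have "mag g (\<lambda>x. c * w x) = mag g w" using False 
      unfolding mag_def T by (simp add: mult.assoc sum_distrib_left[symmetric])
    then show ?thesis unfolding persp_def T by simp
  qed (simp add: persp_def tot_def)
  ultimately show ?thesis by (auto simp: sublin_def)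
qed

text \<open>With m the mean of h, revealing h raises the squared mean of g by the squared covariance
  divided by 1 - m^2, hence by at least the squared covariance. This converts growth of
  magnetisations into smallness of correlations.\<close>

lemma covariance_le:
  assumes "spin g" "spin h" "nonneg w"
  shows "tot w * (mag (\<lambda>x. g x * h x) w - mag g w * mag h w)\<^sup>2
     \<le> obs h 1 (persp (\<lambda>z. z\<^sup>2) g) w - persp (\<lambda>z. z\<^sup>2) g w"
proof (cases "tot w = 0")
  case True
  then show ?thesis using tot_upd[OF assms(3)] by (simp add: obs_def persp_def)
next
  case False
  define W where "W = tot w"
  have W: "0 < W" using False tot_nonneg[OF assms(3)] by (simp add: W_def)
  define a where "a = mag g w" 
  define c where "c = mag (\<lambda>x. g x * h x) w"
  define m where "m = mag h w"
  have m1: "\<bar>m\<bar> \<le> 1" unfolding m_def by (rule abs_mag_le[OF assms(3,2)])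
  have S: "(\<Sum>x\<in>A. upd h 1 b w x * g x) = W * (a + b * c) / 2" for b
  proof -
    have "(\<Sum>x\<in>A. upd h 1 b w x * g x) = ((\<Sum>x\<in>A. w x * g x) + b * (\<Sum>x\<in>A. w x * (g x * h x))) / 2"
      unfolding upd_def sum_distrib_left sum.distrib[symmetric] sum_divide_distrib
      by (intro sum.cong) (auto simp: algebra_simps)
    then show ?thesis unfolding tot_mag[OF assms(3), symmetric] a_def c_def W_def by (simp add: algebra_simps)
  qed
  have T: "tot (upd h 1 b w) = W * (1 + b * m) / 2" for b
    unfolding tot_upd[OF assms(3)] W_def m_def by simp
  have P: "persp (\<lambda>z. z\<^sup>2) g (upd h 1 b w) = W / 2 * ((a + b * c)\<^sup>2 / (1 + b * m))" for b
  proof (cases "1 + b * m = 0")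
    case False
    have "mag g (upd h 1 b w) = (a + b * c) / (1 + b * m)"
    proof -
      have "W * (a + b * c) / 2 / (W * (1 + b * m) / 2) = (W / 2 * (a + b * c)) / (W / 2 * (1 + b * m))" by simp
      also have "\<dots> = (a + b * c) / (1 + b * m)" using W by (subst mult_divide_mult_cancel_left) auto
      finally show ?thesis unfolding mag_def S T .
    qed
    then show ?thesis unfolding persp_def T using False
      by (simp add: power_divide power2_eq_square)
  qed (simp add: persp_def T)
  show ?thesis
  proof (cases "\<bar>m\<bar> < 1")
    case True
    then have pos: "0 < 1 + m" "0 < 1 - m" "0 < 1 - m\<^sup>2" by (auto simp: abs_square_less_1)
    have ne: "1 + m \<noteq> 0" "1 - m \<noteq> 0" using pos by auto
    have "((a + c)\<^sup>2 / (1 + m) + (a - c)\<^sup>2 / (1 - m)) / 2 - a\<^sup>2 = (c - a * m)\<^sup>2 / ((1 + m) * (1 - m))"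
      using ne by (simp add: divide_simps) (simp add: power2_eq_square algebra_simps)
    also have "\<dots> = (c - a * m)\<^sup>2 / (1 - m\<^sup>2)" by (simp add: power2_eq_square algebra_simps)
    also have "\<dots> \<ge> (c - a * m)\<^sup>2" 
      using pos(3) by (simp add: le_divide_eq mult_left_le)
    finally have "W * (c - a * m)\<^sup>2 \<le> W * (((a + c)\<^sup>2 / (1 + m) + (a - c)\<^sup>2 / (1 - m)) / 2 - a\<^sup>2)"
      using W by (intro mult_left_mono) auto
    then have "W * (c - a * m)\<^sup>2 \<le> W / 2 * ((a + c)\<^sup>2 / (1 + m)) + W / 2 * ((a - c)\<^sup>2 / (1 - m)) - W * a\<^sup>2"
      by (simp only: right_diff_distrib distrib_left add_divide_distrib times_divide_eq_right times_divide_eq_left)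
        (simp add: mult.commute)
    moreover have "obs h 1 (persp (\<lambda>z. z\<^sup>2) g) w = W / 2 * ((a + c)\<^sup>2 / (1 + m)) + W / 2 * ((a - c)\<^sup>2 / (1 - m))"
      unfolding obs_def P by simp
    moreover have "persp (\<lambda>z. z\<^sup>2) g w = W * a\<^sup>2" by (simp add: persp_def a_def W_def)
    ultimately show ?thesis by (simp add: a_def c_def m_def W_def)
  next
    \<comment> \<open>Here h is almost surely constant: one outcome has weight zero, which forces
      the covariance to vanish, and sublinearity keeps the gain nonnegative.\<close>
    case False
    then have "m = 1 \<or> m = -1" using m1 by linarith
    then obtain b :: real where b: "b = 1 \<or> b = -1" "1 + b * m = 0" by (metis add.right_inverse minus_add_cancel mult.left_neutral mult_minus1 mult_minus1_right add.commute)
    have "tot (upd h 1 b w) = 0" unfolding T b by simp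
    moreover have "nonneg (upd h 1 b w)" using b(1) upd_nonneg[of 1 h w] assms by auto
    ultimately have "(\<Sum>x\<in>A. upd h 1 b w x * g x) = 0" by (metis tot_mag mult_zero_left)
    then have "a + b * c = 0" unfolding S using W by simp
    moreover have "m = - b" using b(2) disjE[OF b(1)] by fastforce
    ultimately have "c - a * m = 0" using b(1) by auto
    then have "tot w * (c - a * m)\<^sup>2 = 0" by simp
    moreover have "convex_on {-1..1::real} (\<lambda>z. z\<^sup>2)"
      using convex_power_even[of 2] by (auto intro: convex_on_subset)
    ultimately show ?thesis
      using sublin_le_obs[OF sublin_persp[OF _ assms(1)], of "\<lambda>z. z\<^sup>2" 1 h w] assms
      unfolding a_def c_def m_def by auto
  qed
qed

end

subsection \<open>Sampling from a pool\<close>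

text \<open>Uniform sampling with replacement. New elements are appended at the end, so the newest
  one is averaged innermost, with the earlier ones fixed.\<close>

primrec iid :: "'e set \<Rightarrow> nat \<Rightarrow> ('e list \<Rightarrow> real) \<Rightarrow> real" where
  "iid E 0 f = f []"
| "iid E (Suc n) f = iid E n (\<lambda>xs. (\<Sum>e\<in>E. f (xs @ [e])) / real (card E))"

definition perm_avg :: "'e set \<Rightarrow> (('e \<Rightarrow> 'e) \<Rightarrow> real) \<Rightarrow> real" where
  "perm_avg E f = (\<Sum>\<tau> | \<tau> permutes E. f \<tau>) / fact (card E)"

lemma iid_mono:
  assumes "\<And>xs. set xs \<subseteq> E \<Longrightarrow> length xs = n \<Longrightarrow> f xs \<le> g xs"
  shows "iid E n f \<le> iid E n g"
  using assms
proof (induction n arbitrary: f g)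
  case (Suc n)
  show ?case unfolding iid.simps
    by (intro Suc.IH divide_right_mono sum_mono Suc.prems) auto
qed simp

lemma iid_cong:
  assumes "\<And>xs. set xs \<subseteq> E \<Longrightarrow> length xs = n \<Longrightarrow> f xs = g xs"
  shows "iid E n f = iid E n g"
  using assms by (intro antisym iid_mono) auto

lemma iid_add: "iid E n (\<lambda>xs. f xs + g xs) = iid E n f + iid E n g"
  by (induction n arbitrary: f g) (auto simp: sum.distrib add_divide_distrib)

lemma iid_diff: "iid E n (\<lambda>xs. f xs - g xs) = iid E n f - iid E n g"
  by (induction n arbitrary: f g) (auto simp: sum_subtractf diff_divide_distrib)

lemma iid_cmult: "iid E n (\<lambda>xs. c * f xs) = c * iid E n f"
  by (induction n arbitrary: f) (auto simp: sum_distrib_left[symmetric] simp flip: times_divide_eq_right)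

lemma iid_sum: "finite I \<Longrightarrow> iid E n (\<lambda>xs. \<Sum>i\<in>I. f i xs) = (\<Sum>i\<in>I. iid E n (f i))"
proof (induction I rule: finite_induct)
  case empty show ?case using iid_cmult[of E n 0 "\<lambda>_. 0"] by simp
qed (simp add: iid_add)

lemma iid_const: "finite E \<Longrightarrow> E \<noteq> {} \<Longrightarrow> iid E n (\<lambda>xs. c) = c"
  by (induction n) auto

lemma iid_append: "iid E (n + k) f = iid E n (\<lambda>xs. iid E k (\<lambda>ys. f (xs @ ys)))"
  by (induction k arbitrary: f) auto

lemma iid_prefix:
  assumes "finite E" "E \<noteq> {}"
  shows "iid E (n + k) (\<lambda>xs. f (take n xs)) = iid E n f"
  unfolding iid_append using assms by (intro iid_cong) (auto simp: iid_const)

lemma iid_prod: "iid E n (\<lambda>xs. \<Prod>s\<leftarrow>xs. h s) = ((\<Sum>e\<in>E. h e) / real (card E)) ^ n"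
proof (induction n)
  case (Suc n)
  have "iid E (Suc n) (\<lambda>xs. \<Prod>s\<leftarrow>xs. h s) = iid E n (\<lambda>xs. (\<Sum>e\<in>E. h e) / real (card E) * (\<Prod>s\<leftarrow>xs. h s))"
    by (simp add: sum_distrib_left[symmetric] mult.commute[of "prod_list _"] sum_distrib_right[symmetric])
  then show ?case unfolding iid_cmult Suc by simp
qed simp

lemma perm_avg_sum: "perm_avg E (\<lambda>t. \<Sum>i\<in>I. f i t) = (\<Sum>i\<in>I. perm_avg E (f i))"
  unfolding perm_avg_def by (subst sum.swap) (simp add: sum_divide_distrib)

lemma perm_avg_const: "finite E \<Longrightarrow> perm_avg E (\<lambda>t. c) = c"
  by (simp add: perm_avg_def card_permutations)

lemma perm_avg_mono:
  "finite E \<Longrightarrow> (\<And>t. t permutes E \<Longrightarrow> f t \<le> g t) \<Longrightarrow> perm_avg E f \<le> perm_avg E g"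
  unfolding perm_avg_def by (intro divide_right_mono sum_mono) auto

lemma perm_avg_cmult: "perm_avg E (\<lambda>t. c * f t) = c * perm_avg E f"
  by (simp add: perm_avg_def sum_distrib_left)

lemma perm_avg_abs_le:
  assumes "finite E" "\<And>t. t permutes E \<Longrightarrow> \<bar>f t\<bar> \<le> B"
  shows "\<bar>perm_avg E f\<bar> \<le> B"
proof -
  have "- B \<le> f t" "f t \<le> B" if "t permutes E" for t
    using assms(2)[OF that] by linarith+
  then have "perm_avg E f \<le> perm_avg E (\<lambda>_. B)" "perm_avg E (\<lambda>_. - B) \<le> perm_avg E f"
    by (auto intro!: perm_avg_mono assms(1))
  then show ?thesis by (simp add: perm_avg_const assms(1) abs_le_iff)
qed

lemma perm_avg_compose:
  assumes "p permutes E"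
  shows "perm_avg E (\<lambda>t. f (t \<circ> p)) = perm_avg E f"
  unfolding perm_avg_def using sum_permutations_compose_right[OF assms, of f] by simp

text \<open>The image of the last query is exchangeable with that of every unused element; replacing it by a
  uniform element costs \<open>2 * B * length qs / card E\<close>.\<close>
lemma perm_avg_iid:
  assumes "finite E" "distinct qs" "set qs \<subseteq> E"
    and "\<And>xs. set xs \<subseteq> E \<Longrightarrow> length xs = length qs \<Longrightarrow> \<bar>f xs\<bar> \<le> B"
  shows "\<bar>perm_avg E (\<lambda>t. f (map t qs)) - iid E (length qs) f\<bar> \<le> 2 * B * (real (length qs))\<^sup>2 / real (card E)"
  using assms(2-4)
proof (induction qs arbitrary: f rule: rev_induct)
  case Nil
  then show ?case by (simp add: perm_avg_const assms(1))
next
  case (snoc q qs)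
  define n where "n = length qs"
  define M where "M = card E"
  define D where "D = E - set qs"
  define F where "F q' = perm_avg E (\<lambda>t. f (map t qs @ [t q']))" for q'
  define f' where "f' xs = (\<Sum>e\<in>E. f (xs @ [e])) / real M" for xs
  have q: "q \<in> D" using snoc.prems by (auto simp: D_def)
  have M: "0 < M" using q assms(1) by (auto simp: M_def D_def card_gt_0_iff)
  have "card (set qs) = length qs" using snoc.prems by (intro distinct_card) auto
  moreover have "card (set qs) \<le> card E" using snoc.prems assms(1) by (intro card_mono) auto
  moreover have "card D = card E - card (set qs)"
    unfolding D_def using snoc.prems by (intro card_Diff_subset) auto
  ultimately have cD: "real (card D) = real M - real n" by (simp add: M_def n_def of_nat_diff)
  have B: "\<bar>F q'\<bar> \<le> B" if "q' \<in> E" for q'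
    unfolding F_def using that snoc.prems
    by (intro perm_avg_abs_le assms(1) snoc.prems(3)) (auto simp: permutes_in_image)
  have FD: "F q' = F q" if "q' \<in> D" for q'
  proof -
    have p: "Transposition.transpose q q' permutes E"
      using q that by (intro permutes_swap_id) (auto simp: D_def)
    have m: "map (t \<circ> Transposition.transpose q q') qs = map t qs" for t :: "'a \<Rightarrow> 'a"
      using q that by (auto simp: D_def Transposition.transpose_def)
    have "F q = perm_avg E (\<lambda>t. f (map (t \<circ> Transposition.transpose q q') qs @ [(t \<circ> Transposition.transpose q q') q]))"
      unfolding F_def by (rule perm_avg_compose[OF p, symmetric])
    then show ?thesis unfolding m by (simp add: F_def)
  qed
  have "perm_avg E (\<lambda>t. f' (map t qs)) = perm_avg E (\<lambda>t. (\<Sum>q'\<in>E. f (map t qs @ [t q'])) / real M)"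
    unfolding perm_avg_def f'_def
  proof (rule arg_cong2[where f="(/)", OF sum.cong[OF refl] refl])
    fix t assume "t \<in> {t. t permutes E}"
    then show "(\<Sum>e\<in>E. f (map t qs @ [e])) / real M = (\<Sum>q'\<in>E. f (map t qs @ [t q'])) / real M"
      using sum.permute[of t E "\<lambda>e. f (map t qs @ [e])"] by (simp add: comp_def)
  qed
  also have "\<dots> = (\<Sum>q'\<in>E. F q') / real M"
    unfolding F_def perm_avg_sum[symmetric] using perm_avg_cmult[of E "1 / real M"] by simp
  finally have "real M * perm_avg E (\<lambda>t. f' (map t qs)) = (\<Sum>q'\<in>E. F q')" using M by simp
  also have "\<dots> = (\<Sum>q'\<in>D. F q') + (\<Sum>q'\<in>set qs. F q')"
    unfolding D_def using snoc.prems assms(1) by (intro sum.subset_diff) auto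
  also have "(\<Sum>q'\<in>D. F q') = (real M - real n) * F q"
    unfolding cD[symmetric] by (simp add: FD)
  finally have e: "real M * (F q - perm_avg E (\<lambda>t. f' (map t qs))) = real n * F q - (\<Sum>q'\<in>set qs. F q')"
    by (simp add: algebra_simps)
  have "\<bar>\<Sum>q'\<in>set qs. F q'\<bar> \<le> real (card (set qs)) * B"
    using B snoc.prems by (intro order_trans[OF sum_abs] sum_bounded_above) auto
  moreover have "\<bar>real n * F q\<bar> \<le> real n * B"
    unfolding abs_mult using B[of q] q by (auto simp: D_def intro!: mult_left_mono)
  moreover have "real (card (set qs)) * B = real n * B"
    using snoc.prems(1) by (simp add: distinct_card n_def)
  ultimately have "\<bar>real M * (F q - perm_avg E (\<lambda>t. f' (map t qs)))\<bar> \<le> 2 * real n * B"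
    unfolding e by linarith
  then have "real M * \<bar>F q - perm_avg E (\<lambda>t. f' (map t qs))\<bar> \<le> 2 * real n * B"
    by (simp add: abs_mult)
  then have 1: "\<bar>F q - perm_avg E (\<lambda>t. f' (map t qs))\<bar> \<le> 2 * real n * B / real M"
    using M by (simp add: field_simps)
  have "\<bar>f' xs\<bar> \<le> B" if "set xs \<subseteq> E" "length xs = length qs" for xs
  proof -
    have "\<bar>\<Sum>e\<in>E. f (xs @ [e])\<bar> \<le> real M * B"
      unfolding M_def using that snoc.prems(3)
      by (intro order_trans[OF sum_abs] sum_bounded_above) auto
    then show ?thesis using M by (simp add: f'_def abs_divide field_simps)
  qed
  then have 2: "\<bar>perm_avg E (\<lambda>t. f' (map t qs)) - iid E (length qs) f'\<bar> \<le> 2 * B * (real n)\<^sup>2 / real M"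
    using snoc.IH[of f'] snoc.prems by (simp add: n_def M_def)
  have B0: "0 \<le> B" using B[of q] q by (auto simp: D_def)
  have 3: "iid E (length (qs @ [q])) f = iid E (length qs) f'"
    unfolding f'_def[abs_def] M_def by simp
  have "2 * real n * B / real M + 2 * B * (real n)\<^sup>2 / real M \<le> 2 * B * (real (Suc n))\<^sup>2 / real M"
  proof -
    have "2 * B * (real n + (real n)\<^sup>2) \<le> 2 * B * (real (Suc n))\<^sup>2"
      using B0 by (intro mult_left_mono) (auto simp: power2_eq_square algebra_simps)
    then show ?thesis unfolding add_divide_distrib[symmetric]
      by (intro divide_right_mono) (auto simp: algebra_simps)
  qed
  then show ?case
    using 1 2 unfolding 3 by (simp add: F_def n_def M_def)
qed

section \<open>Random pins as an operator, and decorrelation of the pool\<close>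

context weights begin

definition pin :: "'e set \<Rightarrow> ('e \<Rightarrow> 'x \<Rightarrow> real) \<Rightarrow> (('x \<Rightarrow> real) \<Rightarrow> real) \<Rightarrow> ('x \<Rightarrow> real) \<Rightarrow> real" where
  "pin E \<sigma> f w = (\<Sum>e\<in>E. obs (\<sigma> e) 1 f w) / real (card E)"

text \<open>The newest pin is innermost and can be absorbed into the functional, so n random pins
  are the n-th power of one linear operator. Exponents add, which is what later telescopes.\<close>

lemma iid_reveal: "iid E n (\<lambda>xs. reveal (map \<sigma> xs) f w) = (pin E \<sigma> ^^ n) f w"
proof (induction n arbitrary: f)
  case (Suc n)
  have "iid E (Suc n) (\<lambda>xs. reveal (map \<sigma> xs) f w) = iid E n (\<lambda>xs. reveal (map \<sigma> xs) (pin E \<sigma> f) w)"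
    by (simp add: reveal_append pin_def[abs_def] reveal_divide reveal_sum)
  then show ?case unfolding Suc by (simp add: funpow_swap1)
qed simp

end

locale pool = weights A for A :: "'x set" +
  fixes E :: "'e set" and \<sigma> :: "'e \<Rightarrow> 'x \<Rightarrow> real"
  assumes E: "finite E" "E \<noteq> {}" and spin: "e \<in> E \<Longrightarrow> spin (\<sigma> e)"
begin

abbreviation R where "R \<equiv> pin E \<sigma>"

lemma list_all_spin: "set xs \<subseteq> E \<Longrightarrow> list_all spin (map \<sigma> xs)"
  using spin by (auto simp: list_all_iff)

lemma pin_pow_mono:
  assumes "nonneg w" "\<And>u. nonneg u \<Longrightarrow> f u \<le> f' u" shows "(R ^^ n) f w \<le> (R ^^ n) f' w"
  unfolding iid_reveal[symmetric] using assms list_all_spin by (intro iid_mono reveal_mono) auto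

lemma pin_pow_add: "(R ^^ n) (\<lambda>u. f u + f' u) w = (R ^^ n) f w + (R ^^ n) f' w"
  unfolding iid_reveal[symmetric] reveal_add iid_add ..
lemma pin_pow_diff: "(R ^^ n) (\<lambda>u. f u - f' u) w = (R ^^ n) f w - (R ^^ n) f' w"
  unfolding iid_reveal[symmetric] reveal_diff iid_diff ..
lemma pin_pow_cmult: "(R ^^ n) (\<lambda>u. c * f u) w = c * (R ^^ n) f w"
  unfolding iid_reveal[symmetric] reveal_cmult iid_cmult ..
lemma pin_pow_sum: "finite I \<Longrightarrow> (R ^^ n) (\<lambda>u. \<Sum>i\<in>I. f i u) w = (\<Sum>i\<in>I. (R ^^ n) (f i) w)"
  unfolding iid_reveal[symmetric] reveal_sum by (rule iid_sum)
lemma pin_pow_tot: "(R ^^ n) tot w = tot w"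
  unfolding iid_reveal[symmetric] reveal_tot by (rule iid_const[OF E])

lemma sublin_le_pin_pow:
  assumes "sublin f" "nonneg w" shows "f w \<le> (R ^^ n) f w"
proof -
  have "iid E n (\<lambda>_. f w) \<le> (R ^^ n) f w"
    unfolding iid_reveal[symmetric] using assms list_all_spin by (intro iid_mono sublin_le_reveal) auto
  then show ?thesis by (simp add: iid_const E)
qed

text \<open>Pinning increases a bounded sublinear functional, hence on average over the number of
  pins a few more pins hardly change it.\<close>
lemma pin_telescope:
  assumes "sublin f" "nonneg w" "\<And>u. nonneg u \<Longrightarrow> 0 \<le> f u" "\<And>u. nonneg u \<Longrightarrow> f u \<le> B * tot u"
  shows "(\<Sum>l<n. (R ^^ (l + i)) f w) \<le> (\<Sum>l<n. (R ^^ l) f w) + real i * B * tot w"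
proof (induction i)
  case (Suc i)
  have "(\<Sum>l<n. (R ^^ (l + Suc i)) f w) - (\<Sum>l<n. (R ^^ (l + i)) f w)
     = (\<Sum>l<n. (R ^^ (Suc l + i)) f w - (R ^^ (l + i)) f w)"
    by (simp only: sum_subtractf) simp
  also have "\<dots> = (R ^^ (n + i)) f w - (R ^^ (0 + i)) f w"
    by (rule sum_lessThan_telescope)
  also have "\<dots> \<le> B * tot w"
  proof -
    have "(R ^^ (n + i)) f w \<le> (R ^^ (n + i)) (\<lambda>u. B * tot u) w"
      by (rule pin_pow_mono) (use assms in auto)
    moreover have "0 * (R ^^ i) f w \<le> (R ^^ i) f w"
      unfolding pin_pow_cmult[symmetric] by (rule pin_pow_mono) (use assms in auto)
    ultimately show ?thesis by (simp add: pin_pow_cmult pin_pow_tot)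
  qed
  finally show ?case using Suc.IH by (simp add: algebra_simps)
qed simp

definition sqmag :: "('x \<Rightarrow> real) \<Rightarrow> real" where
  "sqmag w = (\<Sum>e\<in>E. persp (\<lambda>z. z\<^sup>2) (\<sigma> e) w) / real (card E)"

lemma convex_square: "convex_on {-1..1::real} (\<lambda>z. z\<^sup>2)"
  using convex_power_even[of 2] by (auto intro: convex_on_subset)

lemma sublin_sqmag: "sublin sqmag"
  unfolding sqmag_def using spin by (intro sublin_divide sublin_sum sublin_persp convex_square) auto

lemma avg_le: "(\<And>e. e \<in> E \<Longrightarrow> h e \<le> (c::real)) \<Longrightarrow> (\<Sum>e\<in>E. h e) / real (card E) \<le> c"
  using E sum_bounded_above[of E h c] by (simp add: divide_le_eq card_gt_0_iff mult.commute)

lemma sqmag_bounds: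
  assumes "nonneg w" shows "0 \<le> sqmag w" "sqmag w \<le> 1 * tot w"
  unfolding sqmag_def using spin assms
  by (auto intro!: divide_nonneg_nonneg sum_nonneg persp_nonneg avg_le
      order_trans[OF persp_le[where c = 1]] simp: abs_square_le_1)

definition dependence :: "nat \<Rightarrow> ('x \<Rightarrow> real) \<Rightarrow> real" where
  "dependence k w = iid E k (\<lambda>ss. tot w *
     (mag (\<lambda>x. \<Prod>s\<leftarrow>ss. \<sigma> s x) w - (\<Prod>s\<leftarrow>ss. mag (\<sigma> s) w))\<^sup>2)"

text \<open>Adding one factor makes the new error a covariance c plus a damped old error m d, and (c
  + m d)^2 is at most 2 c^2 + 2 d^2; iteration yields the factor 2^k. The covariance of the new spin
  with the product of the old ones is controlled by the gain in squared magnetisation when that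
  product is revealed, hence when all old spins are revealed, which on average is the gain of k
  pins.\<close>

lemma dependence_le:
  assumes "nonneg w"
  shows "dependence k w \<le> 2 ^ k * (\<Sum>i<k. (R ^^ i) sqmag w - sqmag w)"
proof (induction k)
  case 0
  have "tot w * (mag (\<lambda>x. 1) w - 1)\<^sup>2 = 0"
    by (cases "tot w = 0") (auto simp: mag_def tot_def)
  then show ?case by (auto simp: dependence_def)
next
  case (Suc k)
  let ?p = "\<lambda>ss x. \<Prod>s\<leftarrow>ss. \<sigma> s x" and ?q = "\<lambda>ss. \<Prod>s\<leftarrow>ss. mag (\<sigma> s) w"
  let ?sq = "\<lambda>z::real. z\<^sup>2"
  have T: "0 \<le> tot w" by (rule tot_nonneg[OF assms])
  have step: "tot w * (mag (?p (ss @ [e])) w - ?q (ss @ [e]))\<^sup>2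
     \<le> 2 * (reveal (map \<sigma> ss) (persp ?sq (\<sigma> e)) w - persp ?sq (\<sigma> e) w)
        + 2 * (tot w * (mag (?p ss) w - ?q ss)\<^sup>2)" if "set ss \<subseteq> E" "e \<in> E" for ss e
  proof -
    define c where "c = mag (\<lambda>x. \<sigma> e x * ?p ss x) w - mag (\<sigma> e) w * mag (?p ss) w"
    define d where "d = mag (?p ss) w - ?q ss"
    define m where "m = mag (\<sigma> e) w"
    have sp: "spin (?p ss)" "spin (\<sigma> e)" using that spin by (auto intro!: spin_prod_list)
    have "tot w * c\<^sup>2 \<le> obs (?p ss) 1 (persp ?sq (\<sigma> e)) w - persp ?sq (\<sigma> e) w"
      unfolding c_def by (rule covariance_le[OF sp(2,1) assms])
    also have "obs (?p ss) 1 (persp ?sq (\<sigma> e)) w \<le> reveal (map \<sigma> ss) (persp ?sq (\<sigma> e)) w"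
      using that spin assms sp by (intro sublin_obs_prod_le_reveal sublin_persp convex_square) auto
    finally have 1: "tot w * c\<^sup>2 \<le> reveal (map \<sigma> ss) (persp ?sq (\<sigma> e)) w - persp ?sq (\<sigma> e) w" by simp
    have "m\<^sup>2 \<le> 1" using abs_mag_le[OF assms sp(2)] by (simp add: m_def abs_square_le_1)
    then have md: "(m * d)\<^sup>2 \<le> d\<^sup>2" by (simp add: power_mult_distrib mult_left_le_one_le)
    have "mag (?p (ss @ [e])) w - ?q (ss @ [e]) = c + m * d"
      by (simp add: c_def m_def d_def algebra_simps)
    also have "(c + m * d)\<^sup>2 \<le> 2 * c\<^sup>2 + 2 * (m * d)\<^sup>2"
      using zero_le_power2[of "c - m * d"] by (simp add: power2_eq_square algebra_simps)
    also have "\<dots> \<le> 2 * c\<^sup>2 + 2 * d\<^sup>2" using md by simp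
    finally have "tot w * (mag (?p (ss @ [e])) w - ?q (ss @ [e]))\<^sup>2 \<le> tot w * (2 * c\<^sup>2 + 2 * d\<^sup>2)"
      by (intro mult_left_mono T)
    then show ?thesis using 1 by (simp add: d_def algebra_simps)
  qed
  have "dependence (Suc k) w \<le> iid E k (\<lambda>ss. 2 * (reveal (map \<sigma> ss) sqmag w - sqmag w)
      + 2 * (tot w * (mag (?p ss) w - ?q ss)\<^sup>2))"
    unfolding dependence_def iid.simps
  proof (intro iid_mono)
    fix ss assume ss: "set ss \<subseteq> E"
    have "(\<Sum>e\<in>E. tot w * (mag (?p (ss @ [e])) w - ?q (ss @ [e]))\<^sup>2) / real (card E)
      \<le> (\<Sum>e\<in>E. 2 * (reveal (map \<sigma> ss) (persp ?sq (\<sigma> e)) w - persp ?sq (\<sigma> e) w)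
        + 2 * (tot w * (mag (?p ss) w - ?q ss)\<^sup>2)) / real (card E)"
      using step[OF ss] by (intro divide_right_mono sum_mono) auto
    also have "\<dots> = 2 * (reveal (map \<sigma> ss) sqmag w - sqmag w) + 2 * (tot w * (mag (?p ss) w - ?q ss)\<^sup>2)"
      unfolding sqmag_def reveal_divide reveal_sum sum.distrib sum_distrib_left[symmetric] sum_subtractf
      using E by (simp add: field_simps)
    finally show "(\<Sum>e\<in>E. tot w * (mag (?p (ss @ [e])) w - ?q (ss @ [e]))\<^sup>2) / real (card E)
      \<le> 2 * (reveal (map \<sigma> ss) sqmag w - sqmag w) + 2 * (tot w * (mag (?p ss) w - ?q ss)\<^sup>2)" .
  qed
  also have "\<dots> = 2 * ((R ^^ k) sqmag w - sqmag w) + 2 * dependence k w"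
    unfolding iid_add iid_cmult iid_diff iid_reveal dependence_def iid_const[OF E] ..
  also have "\<dots> \<le> 2 ^ Suc k * ((R ^^ k) sqmag w - sqmag w) + 2 ^ Suc k * (\<Sum>i<k. (R ^^ i) sqmag w - sqmag w)"
  proof (intro add_mono)
    show "2 * ((R ^^ k) sqmag w - sqmag w) \<le> 2 ^ Suc k * ((R ^^ k) sqmag w - sqmag w)"
      using sublin_le_pin_pow[OF sublin_sqmag assms, of k] by (intro mult_right_mono) auto
    show "2 * dependence k w \<le> 2 ^ Suc k * (\<Sum>i<k. (R ^^ i) sqmag w - sqmag w)" using Suc by simp
  qed
  finally show ?case by (simp add: algebra_simps)
qed

end

subsection \<open>The effect of pinning\<close>

text \<open>The mean of \<open>phi (t * z)\<close> when t is a product of j independent variables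
  whose moment of order 2p + 2 is \<open>q p\<close>; \<open>integral_phi_prod_law\<close> realises
  this with tanh V.\<close>

definition phi_mom :: "(nat \<Rightarrow> real) \<Rightarrow> nat \<Rightarrow> real \<Rightarrow> real" where
  "phi_mom q j = even_series (\<lambda>p. phi_coeff p * q p ^ j)"

text \<open>The net value of a check of degree k: the first term is the full information of k noisy
  observations of known bits, the second the constant part of the tangent at q, and ln 2 the largest
  entropy an exact check can remove.\<close>

definition check_const :: "(nat \<Rightarrow> real) \<Rightarrow> nat \<Rightarrow> real" where
  "check_const q k = real k * phi_mom q (k - 1) 1 - (real k - 1) * phi_mom q k 1 - ln 2"

locale moments =
  fixes q :: "nat \<Rightarrow> real"
  assumes q: "0 \<le> q p" "q p \<le> 1"
begin

lemma phi_mom_coeff: "0 \<le> phi_coeff p * q p ^ j" "summable (\<lambda>p. phi_coeff p * q p ^ j)"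
proof -
  have le: "0 \<le> phi_coeff p * q p ^ j" "phi_coeff p * q p ^ j \<le> phi_coeff p" for p
    using phi_coeff_nonneg[of p] q power_le_one[of "q p" j] by (auto intro: mult_left_le)
  show "0 \<le> phi_coeff p * q p ^ j" by (rule le)
  show "summable (\<lambda>p. phi_coeff p * q p ^ j)"
    by (rule summable_comparison_test'[OF summable_phi_coeff, of 0]) (use le in simp)
qed

lemma phi_mom_bounds:
  assumes "\<bar>z\<bar> \<le> 1" shows "0 \<le> phi_mom q j z" "phi_mom q j z \<le> ln 2"
proof -
  show "0 \<le> phi_mom q j z" unfolding phi_mom_def by (intro even_series_nonneg assms phi_mom_coeff)
  have "phi_mom q j z \<le> (\<Sum>p. phi_coeff p * q p ^ j)"
    unfolding phi_mom_def by (intro even_series_le assms phi_mom_coeff)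
  also have "\<dots> \<le> suminf phi_coeff"
    using phi_coeff_nonneg q power_le_one[of "q _" j]
    by (intro suminf_le phi_mom_coeff summable_phi_coeff) (auto intro: mult_left_le)
  finally show "phi_mom q j z \<le> ln 2" by (simp add: suminf_phi_coeff)
qed

lemma convex_phi_mom: "convex_on {-1..1} (phi_mom q j)"
  unfolding phi_mom_def by (intro even_series_convex phi_mom_coeff)

end

locale pool_moments = pool A E \<sigma> + moments q
  for A :: "'x set" and E :: "'e set" and \<sigma> :: "'e \<Rightarrow> 'x \<Rightarrow> real" and q :: "nat \<Rightarrow> real"
begin

definition pool_info :: "nat \<Rightarrow> ('x \<Rightarrow> real) \<Rightarrow> real" where
  "pool_info k w = (\<Sum>e\<in>E. persp (phi_mom q (k - 1)) (\<sigma> e) w) / real (card E)"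

definition check_info :: "nat \<Rightarrow> ('x \<Rightarrow> real) \<Rightarrow> real" where
  "check_info k w = iid E k (\<lambda>ss. persp phi (\<lambda>x. \<Prod>s\<leftarrow>ss. \<sigma> s x) w)"

lemma sublin_pool_info: "sublin (pool_info k)"
  unfolding pool_info_def using spin by (intro sublin_divide sublin_sum sublin_persp convex_phi_mom) auto

lemma pool_info_bounds:
  assumes "nonneg w" shows "0 \<le> pool_info k w" "pool_info k w \<le> ln 2 * tot w"
  unfolding pool_info_def using spin assms phi_mom_bounds
  by (auto intro!: divide_nonneg_nonneg sum_nonneg persp_nonneg avg_le persp_le)

text \<open>Expand \<open>phi\<close> into even powers. Averaging over independent positions turns
  each power of the product into \<open>x p ^ k\<close>, with \<open>x p\<close> the mean of the
  same power of \<open>m\<close>, and as all coefficients are nonnegative the tangent inequality at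
  \<open>q p\<close> applies term by term.\<close>

lemma phi_product_avg:
  assumes "\<And>e. e \<in> E \<Longrightarrow> \<bar>m e\<bar> \<le> 1"
  shows "real k * ((\<Sum>e\<in>E. phi_mom q (k - 1) (m e)) / real (card E)) - (real k - 1) * phi_mom q k 1
    \<le> iid E k (\<lambda>ss. phi (\<Prod>s\<leftarrow>ss. m s))"
proof -
  define x where "x p = (\<Sum>e\<in>E. ((m e)\<^sup>2) ^ Suc p) / real (card E)" for p
  have x0: "0 \<le> x p" for p unfolding x_def by (intro divide_nonneg_nonneg sum_nonneg) auto
  have x1: "x p \<le> 1" for p
    unfolding x_def using even_series_term_le(2)[of _ "\<lambda>_. 1" p] assms by (intro avg_le) simp
  have sums1: "(\<lambda>p. phi_coeff p * q p ^ (k - 1) * x p) sums ((\<Sum>e\<in>E. phi_mom q (k - 1) (m e)) / real (card E))"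
  proof -
    have "(\<lambda>p. \<Sum>e\<in>E. phi_coeff p * q p ^ (k - 1) * ((m e)\<^sup>2) ^ Suc p) sums (\<Sum>e\<in>E. phi_mom q (k - 1) (m e))"
      unfolding phi_mom_def even_series_def
      using even_series_summable[OF assms phi_mom_coeff(1) phi_mom_coeff(2)]
      by (intro sums_sum) (simp add: summable_sums)
    from sums_divide[OF this, of "real (card E)"] show ?thesis
      by (simp add: x_def sum_distrib_left sum_divide_distrib mult.assoc)
  qed
  have sums2: "(\<lambda>p. phi_coeff p * q p ^ k) sums phi_mom q k 1"
    unfolding phi_mom_def even_series_def using phi_mom_coeff(2)[of k] by (simp add: summable_sums)
  \<comment> \<open>Partial sums suffice because the discarded terms of \<open>phi\<close> are
    nonnegative; only finite sums are then exchanged with the average.\<close>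
  have fin: "(\<Sum>p<n. phi_coeff p * x p ^ k) \<le> iid E k (\<lambda>ss. phi (\<Prod>s\<leftarrow>ss. m s))" for n
  proof -
    have "(\<Sum>p<n. phi_coeff p * x p ^ k) = iid E k (\<lambda>ss. \<Sum>p<n. phi_coeff p * (\<Prod>s\<leftarrow>ss. ((m s)\<^sup>2) ^ Suc p))"
      unfolding iid_sum[OF finite_lessThan] iid_cmult iid_prod x_def ..
    also have "\<dots> \<le> iid E k (\<lambda>ss. phi (\<Prod>s\<leftarrow>ss. m s))"
    proof (rule iid_mono)
      fix ss assume ss: "set ss \<subseteq> E"
      define z where "z = (\<Prod>s\<leftarrow>ss. m s)"
      have z: "\<bar>z\<bar> \<le> 1" using ss assms unfolding z_def
        by (induction ss) (auto simp: abs_mult intro!: mult_le_one)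
      have "(\<Prod>s\<leftarrow>ss. ((m s)\<^sup>2) ^ Suc p) = (z\<^sup>2) ^ Suc p" for p
        unfolding z_def by (induction ss) (auto simp: power_mult_distrib)
      then have "(\<Sum>p<n. phi_coeff p * (\<Prod>s\<leftarrow>ss. ((m s)\<^sup>2) ^ Suc p)) = (\<Sum>p<n. phi_coeff p * (z\<^sup>2) ^ Suc p)"
        by simp
      also have "\<dots> \<le> phi z"
        unfolding phi_eq_even_series[OF z] even_series_def
        using z phi_coeff_nonneg summable_phi_coeff even_series_term_le(1)[OF z phi_coeff_nonneg]
        by (intro sum_le_suminf even_series_summable) auto
      finally show "(\<Sum>p<n. phi_coeff p * (\<Prod>s\<leftarrow>ss. ((m s)\<^sup>2) ^ Suc p)) \<le> phi (\<Prod>s\<leftarrow>ss. m s)"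
        by (simp add: z_def)
    qed
    finally show ?thesis .
  qed
  have "(\<lambda>p. real k * (phi_coeff p * q p ^ (k - 1) * x p) - (real k - 1) * (phi_coeff p * q p ^ k))
     sums (real k * ((\<Sum>e\<in>E. phi_mom q (k - 1) (m e)) / real (card E)) - (real k - 1) * phi_mom q k 1)"
    by (intro sums_diff sums_mult sums1 sums2)
  then have "(\<lambda>n. \<Sum>p<n. real k * (phi_coeff p * q p ^ (k - 1) * x p) - (real k - 1) * (phi_coeff p * q p ^ k))
     \<longlonglongrightarrow> (real k * ((\<Sum>e\<in>E. phi_mom q (k - 1) (m e)) / real (card E)) - (real k - 1) * phi_mom q k 1)"
    by (simp add: sums_def)
  then show ?thesis
  proof (rule LIMSEQ_le_const2, intro exI allI impI)
    fix n :: nat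
    have "real k * (phi_coeff p * q p ^ (k - 1) * x p) - (real k - 1) * (phi_coeff p * q p ^ k) \<le> phi_coeff p * x p ^ k" for p
      using mult_left_mono[OF power_above_tangent[OF x0 q(1), of k p p] phi_coeff_nonneg[of p]]
      by (simp add: algebra_simps)
    then have "(\<Sum>p<n. real k * (phi_coeff p * q p ^ (k - 1) * x p) - (real k - 1) * (phi_coeff p * q p ^ k))
       \<le> (\<Sum>p<n. phi_coeff p * x p ^ k)" by (intro sum_mono) auto
    also note fin
    finally show "(\<Sum>p<n. real k * (phi_coeff p * q p ^ (k - 1) * x p) - (real k - 1) * (phi_coeff p * q p ^ k))
       \<le> iid E k (\<lambda>ss. phi (\<Prod>s\<leftarrow>ss. m s))" .
  qed
qed

text \<open>The tangent bound concerns products of magnetisations, a check the magnetisation of a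
  product. The quadratic modulus of \<open>phi\<close> exchanges one for the other at the price of
  \<epsilon> and K times \<open>dependence\<close>.\<close>

lemma check_info_ge:
  assumes w: "nonneg w" and K: "0 \<le> K" "\<And>x y. \<bar>x\<bar> \<le> 1 \<Longrightarrow> \<bar>y\<bar> \<le> 1 \<Longrightarrow> phi x - phi y \<le> \<epsilon> + K * (x - y)\<^sup>2"
  shows "real k * pool_info k w - (real k - 1) * phi_mom q k 1 * tot w - \<epsilon> * tot w - K * dependence k w
    \<le> check_info k w"
proof -
  let ?m = "\<lambda>s. mag (\<sigma> s) w" and ?p = "\<lambda>ss x. \<Prod>s\<leftarrow>ss. \<sigma> s x"
  have T: "0 \<le> tot w" by (rule tot_nonneg[OF w])
  have m: "\<bar>?m e\<bar> \<le> 1" if "e \<in> E" for e using abs_mag_le[OF w spin[OF that]] .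
  have "real k * pool_info k w - (real k - 1) * phi_mom q k 1 * tot w
     = tot w * (real k * ((\<Sum>e\<in>E. phi_mom q (k - 1) (?m e)) / real (card E)) - (real k - 1) * phi_mom q k 1)"
    unfolding pool_info_def persp_def sum_distrib_left[symmetric] by (simp add: algebra_simps)
  also have "\<dots> \<le> tot w * iid E k (\<lambda>ss. phi (\<Prod>s\<leftarrow>ss. ?m s))"
    by (intro mult_left_mono phi_product_avg m T)
  finally have 1: "real k * pool_info k w - (real k - 1) * phi_mom q k 1 * tot w
     \<le> tot w * iid E k (\<lambda>ss. phi (\<Prod>s\<leftarrow>ss. ?m s))" .
  have "iid E k (\<lambda>ss. tot w * phi (\<Prod>s\<leftarrow>ss. ?m s) - persp phi (?p ss) w)
    \<le> iid E k (\<lambda>ss. \<epsilon> * tot w + K * (tot w * (mag (?p ss) w - (\<Prod>s\<leftarrow>ss. ?m s))\<^sup>2))"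
  proof (rule iid_mono)
    fix ss assume ss: "set ss \<subseteq> E"
    have z: "\<bar>\<Prod>s\<leftarrow>ss. ?m s\<bar> \<le> 1" using ss m
      by (induction ss) (auto simp: abs_mult intro!: mult_le_one)
    have y: "\<bar>mag (?p ss) w\<bar> \<le> 1" using ss spin by (intro abs_mag_le w spin_prod_list) auto
    from mult_left_mono[OF K(2)[OF z y] T]
    show "tot w * phi (\<Prod>s\<leftarrow>ss. ?m s) - persp phi (?p ss) w
      \<le> \<epsilon> * tot w + K * (tot w * (mag (?p ss) w - (\<Prod>s\<leftarrow>ss. ?m s))\<^sup>2)"
      by (simp add: persp_def algebra_simps power2_commute)
  qed
  then have "tot w * iid E k (\<lambda>ss. phi (\<Prod>s\<leftarrow>ss. ?m s)) - check_info k w \<le> \<epsilon> * tot w + K * dependence k w"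
    unfolding iid_diff iid_cmult iid_add check_info_def dependence_def iid_const[OF E] by simp
  with 1 show ?thesis by linarith
qed

text \<open>Summing over the number \<open>l < n\<close> of pins makes all error terms telescope.\<close>
lemma pinned_step:
  assumes w: "nonneg w" and K: "0 \<le> K" "\<And>x y. \<bar>x\<bar> \<le> 1 \<Longrightarrow> \<bar>y\<bar> \<le> 1 \<Longrightarrow> phi x - phi y \<le> \<epsilon> + K * (x - y)\<^sup>2"
  shows "tot w * (real n * (check_const q k - \<epsilon>) - (real k)\<^sup>2 * ln 2 - K * 2 ^ k * (real k)\<^sup>2)
    \<le> (\<Sum>l<n. (R ^^ l) (\<lambda>u. check_info k u - ln 2 * tot u
         + (\<Sum>i<k. phi_mom q (k - 1) 1 * tot u - (R ^^ i) (pool_info k) u)) w)"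
proof -
  let ?Y = "pool_info k"
  have T: "0 \<le> tot w" by (rule tot_nonneg[OF w])
  have A: "(\<Sum>l<n. (R ^^ (l + i)) ?Y w) \<le> (\<Sum>l<n. (R ^^ l) ?Y w) + real k * ln 2 * tot w" if "i < k" for i
  proof -
    have "(\<Sum>l<n. (R ^^ (l + i)) ?Y w) \<le> (\<Sum>l<n. (R ^^ l) ?Y w) + real i * ln 2 * tot w"
      using pool_info_bounds by (intro pin_telescope sublin_pool_info w) auto
    moreover have "real i * ln 2 * tot w \<le> real k * ln 2 * tot w"
      using that T by (intro mult_right_mono) auto
    ultimately show ?thesis by linarith
  qed
  have pow: "(R ^^ l) ((R ^^ i) f) w = (R ^^ (l + i)) f w" for l i f
    by (simp add: funpow_add)
  have "(\<Sum>i<k. \<Sum>l<n. (R ^^ (l + i)) ?Y w) \<le> real k * ((\<Sum>l<n. (R ^^ l) ?Y w) + real k * ln 2 * tot w)"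
    using sum_bounded_above[of "{..<k}" "\<lambda>i. \<Sum>l<n. (R ^^ (l + i)) ?Y w"] A by simp
  then have A': "(\<Sum>l<n. \<Sum>i<k. (R ^^ (l + i)) ?Y w) \<le> real k * (\<Sum>l<n. (R ^^ l) ?Y w) + (real k)\<^sup>2 * ln 2 * tot w"
    by (subst sum.swap) (simp add: algebra_simps power2_eq_square)
  have B: "(\<Sum>l<n. (R ^^ (l + i)) sqmag w) \<le> (\<Sum>l<n. (R ^^ l) sqmag w) + real k * tot w" if "i < k" for i
  proof -
    have "(\<Sum>l<n. (R ^^ (l + i)) sqmag w) \<le> (\<Sum>l<n. (R ^^ l) sqmag w) + real i * 1 * tot w"
      using sqmag_bounds by (intro pin_telescope sublin_sqmag w) auto
    moreover have "real i * 1 * tot w \<le> real k * tot w"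
      using that T by (intro mult_right_mono) auto
    ultimately show ?thesis by linarith
  qed
  have "(\<Sum>l<n. (R ^^ l) (dependence k) w)
      \<le> (\<Sum>l<n. (R ^^ l) (\<lambda>u. 2 ^ k * (\<Sum>i<k. (R ^^ i) sqmag u - sqmag u)) w)"
    by (intro sum_mono pin_pow_mono w dependence_le)
  also have "\<dots> = 2 ^ k * (\<Sum>i<k. \<Sum>l<n. (R ^^ (l + i)) sqmag w - (R ^^ l) sqmag w)"
    unfolding pin_pow_cmult pin_pow_sum[OF finite_lessThan] pin_pow_diff pow
    by (subst sum.swap) (simp add: sum_distrib_left)
  also have "\<dots> \<le> 2 ^ k * (real k * (real k * tot w))"
  proof -
    have "(\<Sum>i<k. \<Sum>l<n. (R ^^ (l + i)) sqmag w - (R ^^ l) sqmag w) \<le> real (card {..<k}) * (real k * tot w)"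
      using B by (intro sum_bounded_above) (auto simp: sum_subtractf algebra_simps)
    then show ?thesis by (intro mult_left_mono) auto
  qed
  finally have D: "K * (\<Sum>l<n. (R ^^ l) (dependence k) w) \<le> K * (2 ^ k * (real k)\<^sup>2 * tot w)"
    using K(1) by (intro mult_left_mono) (auto simp: power2_eq_square algebra_simps)
  have C: "real k * (\<Sum>l<n. (R ^^ l) ?Y w) - real n * ((real k - 1) * phi_mom q k 1 * tot w + \<epsilon> * tot w)
      - K * (\<Sum>l<n. (R ^^ l) (dependence k) w) \<le> (\<Sum>l<n. (R ^^ l) (check_info k) w)"
  proof -
    have "(\<Sum>l<n. (R ^^ l) (\<lambda>u. real k * ?Y u - (real k - 1) * phi_mom q k 1 * tot u - \<epsilon> * tot u - K * dependence k u) w)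
      \<le> (\<Sum>l<n. (R ^^ l) (check_info k) w)"
      by (intro sum_mono pin_pow_mono w check_info_ge K)
    then show ?thesis
      unfolding pin_pow_diff pin_pow_cmult pin_pow_tot sum_subtractf sum_distrib_left[symmetric]
      by (simp add: algebra_simps)
  qed
  have "(\<Sum>l<n. (R ^^ l) (\<lambda>u. check_info k u - ln 2 * tot u
         + (\<Sum>i<k. phi_mom q (k - 1) 1 * tot u - (R ^^ i) ?Y u)) w)
    = (\<Sum>l<n. (R ^^ l) (check_info k) w) - real n * (ln 2 * tot w)
       + real n * (real k * (phi_mom q (k - 1) 1 * tot w)) - (\<Sum>l<n. \<Sum>i<k. (R ^^ (l + i)) ?Y w)"
    unfolding pin_pow_add pin_pow_diff pin_pow_cmult pin_pow_tot pin_pow_sum[OF finite_lessThan] pow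
    by (simp add: sum.distrib sum_subtractf)
  \<comment> \<open>The sum of \<open>pool_info\<close> enters k times through C and is subtracted k
    times, with up to k - 1 extra pins, through the noisy observations; A' bounds the mismatch by
    k^2 ln 2 times the total weight.\<close>
  then show ?thesis
    using A' C D by (simp add: check_const_def algebra_simps)
qed

end

subsection \<open>Observations with random noise level\<close>

definition noise_law :: "real measure \<Rightarrow> bool" where
  "noise_law \<rho> \<longleftrightarrow> prob_space \<rho> \<and> sets \<rho> = sets borel \<and> (AE t in \<rho>. \<bar>t\<bar> \<le> 1)"

definition noisy :: "('x \<Rightarrow> real) \<Rightarrow> real measure \<Rightarrow> (('x \<Rightarrow> real) \<Rightarrow> real) \<Rightarrow> ('x \<Rightarrow> real) \<Rightarrow> real" where
  "noisy g \<rho> f w = (\<integral>t. obs g t f w \<partial>\<rho>)"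

primrec noisys :: "(('x \<Rightarrow> real) \<times> real measure) list \<Rightarrow> (('x \<Rightarrow> real) \<Rightarrow> real) \<Rightarrow> ('x \<Rightarrow> real) \<Rightarrow> real" where
  "noisys [] f = f"
| "noisys (u # us) f = noisy (fst u) (snd u) (noisys us f)"

definition valid_obs :: "(('x \<Rightarrow> real) \<times> real measure) list \<Rightarrow> bool" where
  "valid_obs us \<longleftrightarrow> (\<forall>u\<in>set us. spin (fst u) \<and> noise_law (snd u))"

lemma noisys_append: "noisys (us @ vs) f = noisys us (noisys vs f)"
  by (induction us) auto

lemma phi_measurable[measurable]: "phi \<in> borel_measurable borel"
  unfolding phi_def by measurable

lemma phi_mom_measurable[measurable]: "phi_mom q j \<in> borel_measurable borel"
  unfolding phi_mom_def even_series_def by measurable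

abbreviation wspace :: "('x \<Rightarrow> real) measure" where "wspace \<equiv> PiM UNIV (\<lambda>_. borel)"

lemma upd_measurable:
  "(\<lambda>p. upd g (snd p) b (fst p)) \<in> measurable (wspace \<Otimes>\<^sub>M borel) wspace"
  unfolding upd_def by (intro measurable_abs_UNIV) measurable

lemma upd_measurable1: "upd g t b \<in> measurable wspace wspace"
  unfolding upd_def[abs_def] by (intro measurable_abs_UNIV) measurable

context weights begin

text \<open>The bound by the total weight survives observations because \<open>obs\<close> preserves
  \<open>tot\<close>; together with measurability it makes every integral over a noise level
  converge.\<close>

definition good :: "(('x \<Rightarrow> real) \<Rightarrow> real) \<Rightarrow> bool" where
  "good f \<longleftrightarrow> f \<in> borel_measurable wspace \<and> (\<exists>C. \<forall>w. nonneg w \<longrightarrow> \<bar>f w\<bar> \<le> C * tot w)"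

lemma goodI: "f \<in> borel_measurable wspace \<Longrightarrow> (\<And>w. nonneg w \<Longrightarrow> \<bar>f w\<bar> \<le> C * tot w) \<Longrightarrow> good f"
  by (auto simp: good_def)

lemma goodE:
  assumes "good f" obtains C where "0 \<le> C" "\<And>w. nonneg w \<Longrightarrow> \<bar>f w\<bar> \<le> C * tot w"
proof -
  obtain C where C: "\<And>w. nonneg w \<Longrightarrow> \<bar>f w\<bar> \<le> C * tot w" using assms by (auto simp: good_def)
  have "\<bar>f w\<bar> \<le> \<bar>C\<bar> * tot w" if "nonneg w" for w
    using C[OF that] mult_right_mono[OF abs_ge_self[of C] tot_nonneg[OF that]] by linarith
  then show thesis by (intro that[of "\<bar>C\<bar>"]) auto
qed

lemma good_measurable: "good f \<Longrightarrow> f \<in> borel_measurable wspace" by (simp add: good_def)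

lemma tot_measurable[measurable]: "tot \<in> borel_measurable wspace"
  unfolding tot_def[abs_def] by measurable

lemma mag_measurable[measurable]: "mag g \<in> borel_measurable wspace"
  unfolding mag_def[abs_def] by measurable

lemma good_tot: "good tot"
  by (rule goodI[where C = 1]) (use tot_nonneg in auto)

lemma good_add: assumes "good f" "good f'" shows "good (\<lambda>w. f w + f' w)"
proof -
  obtain C C' where "\<And>w. nonneg w \<Longrightarrow> \<bar>f w\<bar> \<le> C * tot w" "\<And>w. nonneg w \<Longrightarrow> \<bar>f' w\<bar> \<le> C' * tot w"
    using assms by (auto simp: good_def)
  then have "\<bar>f w + f' w\<bar> \<le> (C + C') * tot w" if "nonneg w" for w
    using add_mono[of "\<bar>f w\<bar>" "C * tot w" "\<bar>f' w\<bar>" "C' * tot w"] that abs_triangle_ineq[of "f w" "f' w"]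
    by (simp only: distrib_right) (meson order_trans)
  then show ?thesis using assms by (intro goodI[where C = "C + C'"]) (auto simp: good_def)
qed

lemma good_cmult: assumes "good f" shows "good (\<lambda>w. c * f w)"
proof -
  obtain C where C: "\<And>w. nonneg w \<Longrightarrow> \<bar>f w\<bar> \<le> C * tot w"
    using assms by (auto simp: good_def)
  then have "\<bar>c * f w\<bar> \<le> (\<bar>c\<bar> * C) * tot w" if "nonneg w" for w
    using mult_left_mono[OF C[OF that] abs_ge_zero[of c]] by (simp add: abs_mult mult.assoc)
  then show ?thesis using assms by (intro goodI[where C = "\<bar>c\<bar> * C"]) (auto simp: good_def)
qed

lemma good_diff: "good f \<Longrightarrow> good f' \<Longrightarrow> good (\<lambda>w. f w - f' w)"
  using good_add[of f "\<lambda>w. -1 * f' w"] good_cmult[of f' "-1"] by simp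

lemma good_zero: "good (\<lambda>w. 0)"
  by (rule goodI[where C = 0]) auto

lemma good_sum: "(\<And>i. i \<in> I \<Longrightarrow> good (f i)) \<Longrightarrow> good (\<lambda>w. \<Sum>i\<in>I. f i w)"
  by (induction I rule: infinite_finite_induct) (auto intro!: good_zero good_add)

lemma good_persp:
  assumes "\<psi> \<in> borel_measurable borel" "\<And>z. \<bar>z\<bar> \<le> 1 \<Longrightarrow> \<bar>\<psi> z\<bar> \<le> C" "spin g"
  shows "good (persp \<psi> g)"
proof (rule goodI[where C = C])
  show "persp \<psi> g \<in> borel_measurable wspace"
    unfolding persp_def[abs_def] using assms(1) by measurable
  show "\<bar>persp \<psi> g w\<bar> \<le> C * tot w" if "nonneg w" for w
    using mult_left_mono[OF assms(2)[OF abs_mag_le[OF that assms(3)]] tot_nonneg[OF that]] tot_nonneg[OF that]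
    unfolding persp_def abs_mult by (simp add: mult.commute)
qed

lemma ent_le: assumes "nonneg w" shows "ent w \<le> real (card A) * tot w"
proof -
  have "w x * ln (tot w / w x) \<le> tot w" if x: "x \<in> A" for x
  proof (cases "w x = 0")
    case True
    then show ?thesis using tot_nonneg[OF assms] by simp
  next
    case False
    then have p: "0 < w x" using assms by (auto simp: nonneg_def less_le)
    moreover then have q: "0 < tot w" using le_tot[OF assms x] by linarith
    ultimately have "ln (tot w / w x) \<le> tot w / w x - 1" by (intro ln_le_minus_one) auto
    then have "w x * ln (tot w / w x) \<le> w x * (tot w / w x - 1)" using p by (intro mult_left_mono) auto
    also have "\<dots> \<le> tot w" using p by (simp add: right_diff_distrib)
    finally show ?thesis .
  qed
  then show ?thesis
    unfolding ent_def using sum_bounded_above[of A "\<lambda>x. w x * ln (tot w / w x)" "tot w"] by simp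
qed

lemma good_ent: "good ent"
proof (rule goodI[where C = "real (card A)"])
  show "ent \<in> borel_measurable wspace" unfolding ent_def[abs_def] by measurable
qed (use ent_le ent_nonneg in auto)

lemma obs_bound:
  assumes "\<And>w. nonneg w \<Longrightarrow> \<bar>f w\<bar> \<le> C * tot w" "\<bar>t\<bar> \<le> 1" "spin g" "nonneg w"
  shows "\<bar>obs g t f w\<bar> \<le> C * tot w"
proof -
  have "\<bar>obs g t f w\<bar> \<le> obs g t (\<lambda>w. C * tot w) w"
    unfolding obs_def using assms(1)[OF upd_nonneg(1)[OF assms(2-4)]] assms(1)[OF upd_nonneg(2)[OF assms(2-4)]]
    by linarith
  also have "\<dots> = C * obs g t tot w" by (simp add: obs_def algebra_simps)
  finally show ?thesis by (simp add: obs_tot)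
qed

lemma good_obs: 
  assumes "good f" "\<bar>t\<bar> \<le> 1" "spin g" shows "good (obs g t f)"
proof -
  obtain C where C: "\<And>w. nonneg w \<Longrightarrow> \<bar>f w\<bar> \<le> C * tot w" using assms by (auto simp: good_def)
  note [measurable] = good_measurable[OF assms(1)] upd_measurable1
  show ?thesis
  proof (rule goodI[where C = C])
    show "obs g t f \<in> borel_measurable wspace" unfolding obs_def[abs_def] by measurable
  qed (rule obs_bound[OF C assms(2,3)])
qed

lemma good_reveal: "good f \<Longrightarrow> list_all spin gs \<Longrightarrow> good (reveal gs f)"
  by (induction gs) (auto intro!: good_obs)

lemma obs_joint_measurable:
  assumes "good f" "sets \<rho> = sets borel"
  shows "(\<lambda>(w, t). obs g t f w) \<in> borel_measurable (wspace \<Otimes>\<^sub>M \<rho>)"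
proof -
  note [measurable] = good_measurable[OF assms(1)] upd_measurable
  note [measurable_cong] = assms(2)
  have "(\<lambda>p. f (upd g (snd p) 1 (fst p)) + f (upd g (snd p) (-1) (fst p))) \<in> borel_measurable (wspace \<Otimes>\<^sub>M \<rho>)"
    by measurable
  then show ?thesis by (simp add: obs_def case_prod_beta)
qed

lemma obs_noise_measurable:
  assumes "good f" "sets \<rho> = sets borel"
  shows "(\<lambda>t. obs g t f w) \<in> borel_measurable \<rho>"
  using measurable_compose[OF measurable_Pair1' obs_joint_measurable[OF assms], of w] by (simp add: space_PiM)

lemma obs_integrable:
  assumes "good f" "noise_law \<rho>" "spin g" "nonneg w"
  shows "integrable \<rho> (\<lambda>t. obs g t f w)"
proof -
  interpret prob_space \<rho> using assms(2) by (simp add: noise_law_def)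
  obtain C where C: "\<And>w. nonneg w \<Longrightarrow> \<bar>f w\<bar> \<le> C * tot w" using assms by (auto simp: good_def)
  show ?thesis
  proof (rule integrable_const_bound[where B = "C * tot w"])
    have "AE t in \<rho>. \<bar>t\<bar> \<le> 1" using assms(2) by (simp add: noise_law_def)
    then show "AE t in \<rho>. norm (obs g t f w) \<le> C * tot w"
      by eventually_elim (use obs_bound[OF C _ assms(3,4)] in simp)
    show "(\<lambda>t. obs g t f w) \<in> borel_measurable \<rho>"
      using assms by (intro obs_noise_measurable) (auto simp: noise_law_def)
  qed
qed

lemma noisy_mono:
  assumes "good f" "good f'" "noise_law \<rho>" "spin g" "nonneg w" "\<And>u. nonneg u \<Longrightarrow> f u \<le> f' u"
  shows "noisy g \<rho> f w \<le> noisy g \<rho> f' w"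
  unfolding noisy_def
proof (rule integral_mono_AE)
  have "AE t in \<rho>. \<bar>t\<bar> \<le> 1" using assms(3) by (simp add: noise_law_def)
  then show "AE t in \<rho>. obs g t f w \<le> obs g t f' w"
    by eventually_elim (use obs_mono[OF _ assms(4,5,6)] in simp)
qed (use obs_integrable assms in auto)

lemma noisy_cong:
  assumes "noise_law \<rho>" "spin g" "nonneg w" "\<And>u. nonneg u \<Longrightarrow> f u = f' u" "good f" "good f'"
  shows "noisy g \<rho> f w = noisy g \<rho> f' w"
  using assms by (intro antisym noisy_mono) auto

lemma noisy_add:
  assumes "good f" "good f'" "noise_law \<rho>" "spin g" "nonneg w"
  shows "noisy g \<rho> (\<lambda>w. f w + f' w) w = noisy g \<rho> f w + noisy g \<rho> f' w"
  unfolding noisy_def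
  by (subst Bochner_Integration.integral_add[symmetric]) (use obs_integrable assms in \<open>auto simp: obs_def add_ac\<close>)

lemma noisy_cmult: "noisy g \<rho> (\<lambda>w. c * f w) w = c * noisy g \<rho> f w"
  unfolding noisy_def obs_def by (simp add: distrib_left[symmetric])

lemma noisy_tot: "noise_law \<rho> \<Longrightarrow> noisy g \<rho> tot w = tot w"
  unfolding noisy_def obs_tot noise_law_def by (simp add: prob_space.prob_space)

lemma good_noisy:
  assumes "good f" "noise_law \<rho>" "spin g" shows "good (noisy g \<rho> f)"
proof -
  interpret prob_space \<rho> using assms(2) by (simp add: noise_law_def)
  obtain C where C: "\<And>w. nonneg w \<Longrightarrow> \<bar>f w\<bar> \<le> C * tot w" using assms by (auto simp: good_def)
  have gC: "good (\<lambda>w. c * tot w)" for c by (intro good_cmult good_tot)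
  show ?thesis
  proof (rule goodI[where C = C])
    show "noisy g \<rho> f \<in> borel_measurable wspace"
      unfolding noisy_def[abs_def]
      using assms by (intro borel_measurable_lebesgue_integral obs_joint_measurable) (auto simp: noise_law_def)
    fix w :: "'x \<Rightarrow> real" assume w: "nonneg w"
    have "noisy g \<rho> f w \<le> noisy g \<rho> (\<lambda>w. C * tot w) w"
      by (rule noisy_mono[OF assms(1) gC assms(2,3) w]) (metis C abs_le_D1)
    moreover have "noisy g \<rho> (\<lambda>w. - C * tot w) w \<le> noisy g \<rho> f w"
      by (rule noisy_mono[OF gC assms(1) assms(2,3) w]) (use C in \<open>simp add: abs_le_iff minus_le_iff\<close>)
    ultimately show "\<bar>noisy g \<rho> f w\<bar> \<le> C * tot w"
      unfolding noisy_cmult noisy_tot[OF assms(2)] by simp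
  qed
qed

lemma noisy_obs_commute:
  assumes "good f" "noise_law \<rho>" "spin g" "spin h" "\<bar>s\<bar> \<le> 1" "nonneg w"
  shows "noisy g \<rho> (obs h s f) w = obs h s (noisy g \<rho> f) w"
proof -
  have "noisy g \<rho> (obs h s f) w = (\<integral>t. obs g t f (upd h s 1 w) + obs g t f (upd h s (-1) w) \<partial>\<rho>)"
    unfolding noisy_def obs_commute[of g _ h] by (simp add: obs_def[of h])
  also have "\<dots> = obs h s (noisy g \<rho> f) w"
    unfolding obs_def[of h] noisy_def using assms upd_nonneg[OF assms(5,4,6)]
    by (intro Bochner_Integration.integral_add obs_integrable) auto
  finally show ?thesis .
qed

lemma noisy_reveal_commute:
  assumes "good f" "noise_law \<rho>" "spin g" "list_all spin hs" "nonneg w"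
  shows "noisy g \<rho> (reveal hs f) w = reveal hs (noisy g \<rho> f) w"
  using assms(4,5)
proof (induction hs arbitrary: w)
  case (Cons h hs)
  then have "noisy g \<rho> (reveal (h # hs) f) w = obs h 1 (noisy g \<rho> (reveal hs f)) w"
    using assms by (auto intro!: noisy_obs_commute good_reveal)
  also have "\<dots> = obs h 1 (reveal hs (noisy g \<rho> f)) w"
    using Cons by (intro obs_cong) auto
  finally show ?case by simp
qed simp

lemma good_noisys: "good f \<Longrightarrow> valid_obs us \<Longrightarrow> good (noisys us f)"
  by (induction us) (auto simp: valid_obs_def intro!: good_noisy)

lemma noisys_mono:
  assumes "valid_obs us" "good f" "good f'" "nonneg w" "\<And>u. nonneg u \<Longrightarrow> f u \<le> f' u"
  shows "noisys us f w \<le> noisys us f' w"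
  using assms(1,4)
proof (induction us arbitrary: w)
  case (Cons u us)
  then have "valid_obs us" by (simp add: valid_obs_def)
  then show ?case using Cons assms(2,3)
    by (auto simp: valid_obs_def[of "u # us"] intro!: noisy_mono good_noisys)
qed (use assms(5) in simp)

lemma noisys_cong:
  assumes "valid_obs us" "good f" "good f'" "nonneg w" "\<And>u. nonneg u \<Longrightarrow> f u = f' u"
  shows "noisys us f w = noisys us f' w"
  using assms by (intro antisym noisys_mono) auto

lemma noisys_cmult: "noisys us (\<lambda>w. c * f w) w = c * noisys us f w"
proof (induction us arbitrary: w)
  case (Cons u us)
  have "noisys us (\<lambda>w. c * f w) = (\<lambda>w. c * noisys us f w)" using Cons by auto
  then show ?case by (simp add: noisy_cmult)
qed simp

lemma noisys_add:
  assumes "valid_obs us" "good f" "good f'" "nonneg w"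
  shows "noisys us (\<lambda>w. f w + f' w) w = noisys us f w + noisys us f' w"
  using assms(1,4)
proof (induction us arbitrary: w)
  case (Cons u us)
  then have v: "valid_obs us" "spin (fst u)" "noise_law (snd u)" by (auto simp: valid_obs_def)
  have "noisys (u # us) (\<lambda>w. f w + f' w) w = noisy (fst u) (snd u) (\<lambda>w. noisys us f w + noisys us f' w) w"
    unfolding noisys.simps using v Cons assms(2,3)
    by (intro noisy_cong good_add good_noisys) auto
  then show ?case using v Cons assms(2,3) by (simp add: noisy_add good_noisys)
qed simp

lemma noisys_diff:
  assumes "valid_obs us" "good f" "good f'" "nonneg w"
  shows "noisys us (\<lambda>w. f w - f' w) w = noisys us f w - noisys us f' w"
  using noisys_add[OF assms(1,2) good_cmult[OF assms(3), of "-1"] assms(4)] noisys_cmult[of us "-1" f' w]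
  by simp

lemma noisys_sum:
  assumes "valid_obs us" "\<And>i. i \<in> I \<Longrightarrow> good (f i)" "nonneg w"
  shows "noisys us (\<lambda>w. \<Sum>i\<in>I. f i w) w = (\<Sum>i\<in>I. noisys us (f i) w)"
  using assms(2)
proof (induction I rule: infinite_finite_induct)
  case (insert i I)
  then show ?case using noisys_add[OF assms(1) _ _ assms(3), of "f i" "\<lambda>w. \<Sum>i\<in>I. f i w"]
    by (simp add: good_sum)
qed (use noisys_cmult[of us 0 "\<lambda>_. 0" w] in simp_all)

lemma noisys_tot: "valid_obs us \<Longrightarrow> noisys us tot w = tot w"
proof (induction us arbitrary: w)
  case (Cons u us)
  then have "noisys us tot = tot" by (auto simp: valid_obs_def)
  then show ?case using Cons.prems by (simp add: noisy_tot valid_obs_def)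
qed simp

lemma noisys_reveal_commute:
  assumes "good f" "valid_obs us" "list_all spin hs" "nonneg w"
  shows "noisys us (reveal hs f) w = reveal hs (noisys us f) w"
  using assms(2,4)
proof (induction us arbitrary: w)
  case (Cons u us)
  then have v: "valid_obs us" "spin (fst u)" "noise_law (snd u)" by (auto simp: valid_obs_def)
  have "noisys (u # us) (reveal hs f) w = noisy (fst u) (snd u) (reveal hs (noisys us f)) w"
    unfolding noisys.simps using v Cons assms
    by (intro noisy_cong good_reveal good_noisys) auto
  then show ?case using v Cons assms by (simp add: noisy_reveal_commute good_noisys)
qed simp

text \<open>Each noisy observation degrades an exact one and a sublinear functional grows with
  information; the comparison passes through the integrals one observation at a time.\<close>

lemma noisys_le_reveal:
  assumes "good f" "sublin f" "valid_obs us" "nonneg w"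
  shows "noisys us f w \<le> reveal (map fst us) f w"
  using assms(3,4)
proof (induction us arbitrary: w)
  case (Cons u us)
  then have v: "valid_obs us" "spin (fst u)" "noise_law (snd u)" by (auto simp: valid_obs_def)
  then have l: "list_all spin (map fst us)" by (auto simp: valid_obs_def list_all_iff)
  interpret prob_space "snd u" using v by (simp add: noise_law_def)
  let ?r = "reveal (map fst us) f"
  have "noisys (u # us) f w \<le> noisy (fst u) (snd u) ?r w"
    using v Cons assms l by (auto intro!: noisy_mono good_noisys good_reveal)
  also have "\<dots> \<le> (\<integral>t. obs (fst u) 1 ?r w \<partial>snd u)"
    unfolding noisy_def
  proof (rule integral_mono_AE)
    have "AE t in snd u. \<bar>t\<bar> \<le> 1" using v by (simp add: noise_law_def)
    then show "AE t in snd u. obs (fst u) t ?r w \<le> obs (fst u) 1 ?r w"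
      by eventually_elim (use sublin_obs_le_obs_one[OF sublin_reveal[OF assms(2) l] _ v(2) Cons.prems(2)] in simp)
  qed (use v l assms Cons in \<open>auto intro!: obs_integrable good_reveal\<close>)
  finally show ?case by (simp add: prob_space)
qed simp

lemma noisy_ent:
  assumes \<rho>: "noise_law \<rho>" and g: "spin g" and w: "nonneg w"
    and \<psi>: "\<And>z. \<bar>z\<bar> \<le> 1 \<Longrightarrow> (\<integral>t. phi (t * z) \<partial>\<rho>) = \<psi> z"
  shows "noisy g \<rho> ent w = ent w - (\<psi> 1 * tot w - persp \<psi> g w)"
proof -
  interpret prob_space \<rho> using \<rho> by (simp add: noise_law_def)
  note [measurable_cong] = \<rho>[unfolded noise_law_def, THEN conjunct2, THEN conjunct1]
  have ae: "AE t in \<rho>. \<bar>t\<bar> \<le> 1" using \<rho> by (simp add: noise_law_def)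
  have int: "integrable \<rho> (\<lambda>t. phi (t * z))" if "\<bar>z\<bar> \<le> 1" for z
  proof (rule integrable_const_bound[where B = "ln 2"])
    show "AE t in \<rho>. norm (phi (t * z)) \<le> ln 2" using ae
    proof eventually_elim
      fix t :: real assume "\<bar>t\<bar> \<le> 1"
      then have "\<bar>t * z\<bar> \<le> 1" unfolding abs_mult using that by (intro mult_le_one) auto
      then show "norm (phi (t * z)) \<le> ln 2" using phi_bounds[of "t * z"] by simp
    qed
  qed measurable
  have m: "\<bar>mag g w\<bar> \<le> 1" by (rule abs_mag_le[OF w g])
  have "noisy g \<rho> ent w = (\<integral>t. ent w - (tot w * phi (t * 1) - tot w * phi (t * mag g w)) \<partial>\<rho>)"
    unfolding noisy_def
  proof (rule integral_cong_AE)
    show "AE t in \<rho>. obs g t ent w = ent w - (tot w * phi (t * 1) - tot w * phi (t * mag g w))"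
      using ae by eventually_elim (use obs_ent[OF _ g w] in simp)
    show "(\<lambda>t. obs g t ent w) \<in> borel_measurable \<rho>"
      by (rule obs_noise_measurable[OF good_ent]) (use \<rho> in \<open>simp add: noise_law_def\<close>)
  qed measurable
  also have "\<dots> = ent w - (tot w * \<psi> 1 - tot w * \<psi> (mag g w))"
    using int[of 1] int[OF m] by (simp add: prob_space \<psi>[OF m] \<psi>[of 1, simplified])
  finally show ?thesis by (simp add: persp_def algebra_simps)
qed

text \<open>Chain rule: the i-th observation removes \<open>\<psi> 1 * tot w\<close> minus the mean
  of \<open>persp \<psi>\<close> after the earlier noisy observations. That functional is sublinear,
  so making the earlier observations exact only enlarges it, and noise is replaced by pins.\<close>

lemma noisys_ent_le:
  assumes \<rho>: "noise_law \<rho>" and \<sigma>: "\<And>s. s \<in> set ss \<Longrightarrow> spin (\<sigma> s)" and w: "nonneg w"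
    and \<psi>: "\<And>z. \<bar>z\<bar> \<le> 1 \<Longrightarrow> (\<integral>t. phi (t * z) \<partial>\<rho>) = \<psi> z"
    and m: "\<psi> \<in> borel_measurable borel" "convex_on {-1..1} \<psi>" "\<And>z. \<bar>z\<bar> \<le> 1 \<Longrightarrow> \<bar>\<psi> z\<bar> \<le> C"
  shows "noisys (map (\<lambda>s. (\<sigma> s, \<rho>)) ss) ent w
    \<le> ent w - (\<Sum>i<length ss. \<psi> 1 * tot w - reveal (map \<sigma> (take i ss)) (persp \<psi> (\<sigma> (ss ! i))) w)"
  using \<sigma>
proof (induction ss rule: rev_induct)
  case (snoc s ss)
  let ?us = "map (\<lambda>s. (\<sigma> s, \<rho>)) ss"
  have v: "valid_obs ?us" using snoc.prems \<rho> by (auto simp: valid_obs_def)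
  have s: "spin (\<sigma> s)" using snoc.prems by simp
  have gp: "good (persp \<psi> (\<sigma> s))" using m(1,3) s by (intro good_persp)
  have "noisys (map (\<lambda>s. (\<sigma> s, \<rho>)) (ss @ [s])) ent w = noisys ?us (noisy (\<sigma> s) \<rho> ent) w"
    by (simp add: noisys_append)
  also have "\<dots> = noisys ?us (\<lambda>w. ent w - (\<psi> 1 * tot w - persp \<psi> (\<sigma> s) w)) w"
    by (intro noisys_cong v w good_noisy good_ent good_diff good_cmult good_tot gp \<rho> s noisy_ent \<psi>)
  also have "\<dots> = noisys ?us ent w - (\<psi> 1 * tot w - noisys ?us (persp \<psi> (\<sigma> s)) w)"
    using v w gp by (simp add: noisys_diff noisys_cmult noisys_tot good_ent good_diff good_cmult good_tot)
  also have "\<dots> \<le> noisys ?us ent w - (\<psi> 1 * tot w - reveal (map fst ?us) (persp \<psi> (\<sigma> s)) w)"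
    using noisys_le_reveal[OF gp sublin_persp[OF m(2) s] v w] by simp
  also have "map fst ?us = map \<sigma> ss" by simp
  finally have "noisys (map (\<lambda>s. (\<sigma> s, \<rho>)) (ss @ [s])) ent w
    \<le> noisys ?us ent w - (\<psi> 1 * tot w - reveal (map \<sigma> ss) (persp \<psi> (\<sigma> s)) w)" .
  also have "\<dots> \<le> ent w - (\<Sum>i<length ss. \<psi> 1 * tot w - reveal (map \<sigma> (take i ss)) (persp \<psi> (\<sigma> (ss ! i))) w)
     - (\<psi> 1 * tot w - reveal (map \<sigma> ss) (persp \<psi> (\<sigma> s)) w)"
    using snoc by simp
  also have "\<dots> = ent w - (\<Sum>i<length (ss @ [s]). \<psi> 1 * tot w
     - reveal (map \<sigma> (take i (ss @ [s]))) (persp \<psi> (\<sigma> ((ss @ [s]) ! i))) w)"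
    by (simp add: nth_append)
  finally show ?case .
qed simp

text \<open>The removed amount is a difference of \<open>phi\<close> at t and at t * m. It is
  nonnegative since \<open>phi\<close> increases with the absolute value, and at most ln 2, the
  maximum of \<open>phi\<close>.\<close>

lemma obs_ent_bounds:
  assumes "\<bar>t\<bar> \<le> 1" "spin g" "nonneg w"
  shows "obs g t ent w \<le> ent w" "ent w - ln 2 * tot w \<le> obs g t ent w"
proof -
  have T: "0 \<le> tot w" by (rule tot_nonneg[OF assms(3)])
  define m where "m = mag g w"
  have m: "\<bar>m\<bar> \<le> 1" unfolding m_def by (rule abs_mag_le[OF assms(3,2)])
  have tm: "\<bar>t * m\<bar> \<le> \<bar>t\<bar>" unfolding abs_mult using m by (simp add: mult_left_le)
  have "phi (t * m) \<le> phi t"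
  proof -
    have "((t * m)\<^sup>2) \<le> t\<^sup>2" using tm by (simp add: abs_le_square_iff)
    then have "even_series phi_coeff (t * m) \<le> even_series phi_coeff t"
      unfolding even_series_def using assms(1) tm phi_coeff_nonneg summable_phi_coeff
      by (intro suminf_le even_series_summable mult_left_mono power_mono[OF \<open>(t * m)\<^sup>2 \<le> t\<^sup>2\<close>]) auto
    then show ?thesis using assms(1) tm by (simp add: phi_eq_even_series)
  qed
  then have "tot w * phi (t * m) \<le> tot w * phi t" using T by (rule mult_left_mono)
  then show "obs g t ent w \<le> ent w" unfolding obs_ent[OF assms] m_def by simp
  have "tot w * (phi t - phi (t * m)) \<le> tot w * ln 2"
    using phi_bounds(2)[OF assms(1)] phi_bounds(1)[of "t * m"] tm assms(1)
    by (intro mult_left_mono T) linarith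
  then show "ent w - ln 2 * tot w \<le> obs g t ent w" unfolding obs_ent[OF assms] m_def
    by (simp add: algebra_simps)
qed

lemma noisy_ent_le_ent:
  assumes "noise_law \<rho>" "spin g" "nonneg w"
  shows "noisy g \<rho> ent w \<le> ent w"
proof -
  interpret prob_space \<rho> using assms by (simp add: noise_law_def)
  have "noisy g \<rho> ent w \<le> (\<integral>t. ent w \<partial>\<rho>)" unfolding noisy_def
  proof (rule integral_mono_AE)
    have "AE t in \<rho>. \<bar>t\<bar> \<le> 1" using assms by (simp add: noise_law_def)
    then show "AE t in \<rho>. obs g t ent w \<le> ent w"
      by eventually_elim (use obs_ent_bounds assms in auto)
  qed (use assms obs_integrable good_ent in auto)
  then show ?thesis by (simp add: prob_space)
qed

lemma noisys_ent_le_ent: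
  assumes "valid_obs us" "nonneg w"
  shows "noisys us ent w \<le> ent w"
  using assms
proof (induction us rule: rev_induct)
  case (snoc u us)
  then have v: "valid_obs us" "spin (fst u)" "noise_law (snd u)" by (auto simp: valid_obs_def)
  have "noisys (us @ [u]) ent w \<le> noisys us ent w"
    unfolding noisys_append using v snoc.prems noisy_ent_le_ent
    by (auto intro!: noisys_mono good_noisy good_ent)
  then show ?case using snoc v by simp
qed simp

lemma reveal_ent_ge:
  assumes "list_all spin gs" "nonneg w"
  shows "ent w - real (length gs) * ln 2 * tot w \<le> reveal gs ent w"
  using assms
proof (induction gs rule: rev_induct)
  case (snoc g gs)
  have "reveal gs (\<lambda>w. ent w - ln 2 * tot w) w \<le> reveal gs (obs g 1 ent) w"
    using snoc.prems obs_ent_bounds by (intro reveal_mono) auto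
  then have "reveal gs ent w - ln 2 * tot w \<le> reveal (gs @ [g]) ent w"
    by (simp add: reveal_append reveal_diff reveal_cmult reveal_tot)
  then show ?case using snoc by (simp add: algebra_simps)
qed simp

lemma reveal_ent_le:
  assumes "list_all spin gs" "nonneg w"
  shows "reveal gs ent w \<le> ent w"
  using assms
proof (induction gs rule: rev_induct)
  case (snoc g gs)
  have "reveal gs (obs g 1 ent) w \<le> reveal gs ent w"
    using snoc.prems obs_ent_bounds by (intro reveal_mono) auto
  then show ?case using snoc by (simp add: reveal_append)
qed simp

end

subsection \<open>Interpolation\<close>

context weights begin

lemma iid_reveal_commute:
  "iid E k (\<lambda>ss. reveal gs (f ss) w) = reveal gs (\<lambda>u. iid E k (\<lambda>ss. f ss u)) w"
  by (induction k arbitrary: f) (simp_all flip: reveal_divide reveal_sum)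

text \<open>A lower bound for the entropy difference between one parity check and the independent noisy
  observations of its bits, in a form whose average over the positions can be computed.\<close>
definition check_gain ::
  "('e \<Rightarrow> 'x \<Rightarrow> real) \<Rightarrow> (real \<Rightarrow> real) \<Rightarrow> 'e list \<Rightarrow> ('x \<Rightarrow> real) \<Rightarrow> real" where
  "check_gain \<sigma> \<psi> ss u = persp phi (\<lambda>x. \<Prod>s\<leftarrow>ss. \<sigma> s x) u - ln 2 * tot u
     + (\<Sum>i<length ss. \<psi> 1 * tot u - reveal (map \<sigma> (take i ss)) (persp \<psi> (\<sigma> (ss ! i))) u)"

text \<open>The exact observations in G commute with both kinds of observation. They are moved
  outside, and the two entropies are compared pointwise underneath.\<close>

lemma check_vs_noisy:
  assumes \<rho>: "noise_law \<rho>" and \<sigma>: "\<And>s. s \<in> set ss \<Longrightarrow> spin (\<sigma> s)" and G: "list_all spin G" and w: "nonneg w"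
    and \<psi>: "\<And>z. \<bar>z\<bar> \<le> 1 \<Longrightarrow> (\<integral>t. phi (t * z) \<partial>\<rho>) = \<psi> z"
    and m: "\<psi> \<in> borel_measurable borel" "convex_on {-1..1} \<psi>" "\<And>z. \<bar>z\<bar> \<le> 1 \<Longrightarrow> \<bar>\<psi> z\<bar> \<le> C"
  shows "reveal G (check_gain \<sigma> \<psi> ss) w
    \<le> obs (\<lambda>x. \<Prod>s\<leftarrow>ss. \<sigma> s x) 1 (reveal G ent) w - noisys (map (\<lambda>s. (\<sigma> s, \<rho>)) ss) (reveal G ent) w"
proof -
  let ?us = "map (\<lambda>s. (\<sigma> s, \<rho>)) ss" and ?p = "\<lambda>x. \<Prod>s\<leftarrow>ss. \<sigma> s x"
  have v: "valid_obs ?us" using \<sigma> \<rho> by (auto simp: valid_obs_def)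
  have "obs ?p 1 (reveal G ent) w - noisys ?us (reveal G ent) w
      = reveal G (\<lambda>u. obs ?p 1 ent u - noisys ?us ent u) w"
    by (simp add: obs_reveal_commute noisys_reveal_commute[OF good_ent v G w] reveal_diff)
  also have "\<dots> \<ge> reveal G (check_gain \<sigma> \<psi> ss) w"
  proof (rule reveal_mono[OF G w])
    fix u :: "'x \<Rightarrow> real" assume u: "nonneg u"
    have "obs ?p 1 ent u = ent u - (tot u * phi 1 - tot u * phi (1 * mag ?p u))"
      by (rule obs_ent[OF _ spin_prod_list[OF \<sigma>] u]) auto
    moreover have "noisys ?us ent u \<le> ent u - (\<Sum>i<length ss. \<psi> 1 * tot u - reveal (map \<sigma> (take i ss)) (persp \<psi> (\<sigma> (ss ! i))) u)"
      by (rule noisys_ent_le[OF \<rho> _ u \<psi> m]) (rule \<sigma>)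
    ultimately show "check_gain \<sigma> \<psi> ss u \<le> obs ?p 1 ent u - noisys ?us ent u"
      unfolding check_gain_def persp_def[of phi]
      by (simp add: phi_one mult.commute)
  qed
  finally show ?thesis .
qed

lemma abs_check_gain_le:
  assumes \<sigma>: "\<And>s. s \<in> set ss \<Longrightarrow> spin (\<sigma> s)" and u: "nonneg u"
    and \<psi>: "\<And>z. \<bar>z\<bar> \<le> 1 \<Longrightarrow> 0 \<le> \<psi> z" "\<And>z. \<bar>z\<bar> \<le> 1 \<Longrightarrow> \<psi> z \<le> ln 2"
  shows "\<bar>check_gain \<sigma> \<psi> ss u\<bar> \<le> (real (length ss) + 1) * ln 2 * tot u"
proof -
  have T: "0 \<le> tot u" by (rule tot_nonneg[OF u])
  have 1: "0 \<le> persp phi (\<lambda>x. \<Prod>s\<leftarrow>ss. \<sigma> s x) u" "persp phi (\<lambda>x. \<Prod>s\<leftarrow>ss. \<sigma> s x) u \<le> ln 2 * tot u"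
    by (intro persp_nonneg persp_le u spin_prod_list \<sigma> phi_bounds; assumption)+
  have 2: "\<bar>\<psi> 1 * tot u - reveal (map \<sigma> (take i ss)) (persp \<psi> (\<sigma> (ss ! i))) u\<bar> \<le> ln 2 * tot u"
    if "i < length ss" for i
  proof -
    have l: "list_all spin (map \<sigma> (take i ss))" using \<sigma> by (auto simp: list_all_iff dest: in_set_takeD)
    have s: "spin (\<sigma> (ss ! i))" using \<sigma> that by auto
    have "reveal (map \<sigma> (take i ss)) (persp \<psi> (\<sigma> (ss ! i))) u \<le> reveal (map \<sigma> (take i ss)) (\<lambda>u. ln 2 * tot u) u"
      using \<psi> by (intro reveal_mono l u persp_le s) auto
    moreover have "reveal (map \<sigma> (take i ss)) (\<lambda>u. 0 * tot u) u \<le> reveal (map \<sigma> (take i ss)) (persp \<psi> (\<sigma> (ss ! i))) u"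
      using \<psi> by (intro reveal_mono l u) (auto intro!: persp_nonneg s)
    moreover have "0 \<le> \<psi> 1 * tot u" "\<psi> 1 * tot u \<le> ln 2 * tot u"
      using \<psi>[of 1] T by (auto intro!: mult_right_mono)
    ultimately show ?thesis unfolding reveal_cmult reveal_tot by linarith
  qed
  have "\<bar>\<Sum>i<length ss. \<psi> 1 * tot u - reveal (map \<sigma> (take i ss)) (persp \<psi> (\<sigma> (ss ! i))) u\<bar>
     \<le> real (card {..<length ss}) * (ln 2 * tot u)"
    using 2 by (intro order_trans[OF sum_abs] sum_bounded_above) auto
  then show ?thesis using 1 T unfolding check_gain_def by (simp add: algebra_simps)
qed

lemma reveal_abs_le:
  assumes "list_all spin gs" "nonneg w" "\<And>u. nonneg u \<Longrightarrow> \<bar>f u\<bar> \<le> C * tot u"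
  shows "\<bar>reveal gs f w\<bar> \<le> C * tot w"
proof -
  have "reveal gs f w \<le> reveal gs (\<lambda>u. C * tot u) w" "reveal gs (\<lambda>u. - C * tot u) w \<le> reveal gs f w"
    using assms(3) by (auto intro!: reveal_mono assms(1,2) simp: abs_le_iff minus_le_iff)
  then show ?thesis unfolding reveal_cmult reveal_tot by simp
qed

end

context pool_moments begin

text \<open>The i-th term involves only the first i + 1 positions: the first i act as i pins and the
  last averages to \<open>pool_info\<close>. The bits of the check itself thus serve as further
  pins.\<close>

lemma iid_check_gain:
  assumes w: "nonneg w"
  shows "iid E k (\<lambda>ss. check_gain \<sigma> (phi_mom q (k - 1)) ss w)
   = check_info k w - ln 2 * tot w + (\<Sum>i<k. phi_mom q (k - 1) 1 * tot w - (R ^^ i) (pool_info k) w)"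
proof -
  let ?\<psi> = "phi_mom q (k - 1)"
  have *: "iid E k (\<lambda>ss. reveal (map \<sigma> (take i ss)) (persp ?\<psi> (\<sigma> (ss ! i))) w) = (R ^^ i) (pool_info k) w"
    if "i < k" for i
  proof -
    let ?f = "\<lambda>ss. reveal (map \<sigma> (take i ss)) (persp ?\<psi> (\<sigma> (ss ! i))) w"
    have "iid E k ?f = iid E (Suc i + (k - Suc i)) (\<lambda>ss. ?f (take (Suc i) ss))"
    proof -
      have "take i (take (Suc i) ss) = take i ss" "take (Suc i) ss ! i = ss ! i" for ss :: "'e list" by auto
      then have "(\<lambda>ss. ?f (take (Suc i) ss)) = ?f" by (simp only:)
      then show ?thesis using that by simp
    qed
    also have "\<dots> = iid E (Suc i) ?f" by (rule iid_prefix[OF E])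
    also have "\<dots> = iid E i (\<lambda>ss. reveal (map \<sigma> ss) (pool_info k) w)"
      unfolding iid.simps pool_info_def[abs_def] reveal_divide reveal_sum
      by (intro iid_cong) (simp add: nth_append)
    finally show ?thesis unfolding iid_reveal .
  qed
  have "iid E k (\<lambda>ss. check_gain \<sigma> ?\<psi> ss w) = iid E k (\<lambda>ss. persp phi (\<lambda>x. \<Prod>s\<leftarrow>ss. \<sigma> s x) w - ln 2 * tot w
     + (\<Sum>i<k. ?\<psi> 1 * tot w - reveal (map \<sigma> (take i ss)) (persp ?\<psi> (\<sigma> (ss ! i))) w))"
    unfolding check_gain_def by (intro iid_cong) simp
  also have "\<dots> = check_info k w - ln 2 * tot w + (\<Sum>i<k. ?\<psi> 1 * tot w - (R ^^ i) (pool_info k) w)"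
    unfolding iid_add iid_diff iid_sum[OF finite_lessThan] iid_const[OF E] check_info_def using * by simp
  finally show ?thesis .
qed

text \<open>Under a uniform permutation of the pool, pins and check sockets together are a sample
  without replacement. \<open>perm_avg_iid\<close> trades it for independent draws, to which
  \<open>pinned_step\<close> applies below the observations G; M enters only as a lower bound on the
  pool size in the sampling error.\<close>

lemma pool_step:
  assumes w: "nonneg w" and G: "list_all spin G"
    and K: "0 \<le> K" "\<And>x y. \<bar>x\<bar> \<le> 1 \<Longrightarrow> \<bar>y\<bar> \<le> 1 \<Longrightarrow> phi x - phi y \<le> \<epsilon> + K * (x - y)\<^sup>2"
    and ps: "\<And>l. l < n \<Longrightarrow> length (ps l) = l" "\<And>l. l < n \<Longrightarrow> distinct (ps l @ ss)" "\<And>l. l < n \<Longrightarrow> set (ps l @ ss) \<subseteq> E"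
    and ss: "length ss = k" and M: "0 < M" "M \<le> card E"
  shows "tot w * (real n * (check_const q k - \<epsilon>) - (real k)\<^sup>2 * ln 2 - K * 2 ^ k * (real k)\<^sup>2
       - real n * (2 * (real k + 1) * ln 2 * (real n + real k)\<^sup>2 / real M))
    \<le> (\<Sum>l<n. perm_avg E (\<lambda>\<tau>. reveal (G @ map \<sigma> (map \<tau> (ps l))) (check_gain \<sigma> (phi_mom q (k - 1)) (map \<tau> ss)) w))"
proof -
  let ?\<psi> = "phi_mom q (k - 1)"
  let ?B = "(real k + 1) * ln 2 * tot w"
  let ?X = "\<lambda>u. check_info k u - ln 2 * tot u + (\<Sum>i<k. ?\<psi> 1 * tot u - (R ^^ i) (pool_info k) u)"
  define c where "c = real n * (check_const q k - \<epsilon>) - (real k)\<^sup>2 * ln 2 - K * 2 ^ k * (real k)\<^sup>2"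
  have T: "0 \<le> tot w" by (rule tot_nonneg[OF w])
  have each: "reveal G ((R ^^ l) ?X) w - tot w * (2 * (real k + 1) * ln 2 * (real n + real k)\<^sup>2 / real M)
     \<le> perm_avg E (\<lambda>\<tau>. reveal (G @ map \<sigma> (map \<tau> (ps l))) (check_gain \<sigma> ?\<psi> (map \<tau> ss)) w)"
    if l: "l < n" for l
  proof -
    \<comment> \<open>Pins and check positions are put into one list, the first l entries being the
      pins, so that both are resampled together.\<close>
    define f where "f xs = reveal (G @ map \<sigma> (take l xs)) (check_gain \<sigma> ?\<psi> (drop l xs)) w" for xs
    have fb: "\<bar>f xs\<bar> \<le> ?B" if xs: "set xs \<subseteq> E" "length xs = length (ps l @ ss)" for xs
    proof -
      have "\<bar>f xs\<bar> \<le> (real (length (drop l xs)) + 1) * ln 2 * tot w"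
        unfolding f_def
      proof (rule reveal_abs_le[OF _ w])
        show "list_all spin (G @ map \<sigma> (take l xs))"
          using G xs spin by (auto simp: list_all_iff dest: in_set_takeD)
        show "\<bar>check_gain \<sigma> ?\<psi> (drop l xs) u\<bar> \<le> (real (length (drop l xs)) + 1) * ln 2 * tot u" if "nonneg u" for u
          using xs spin phi_mom_bounds that by (intro abs_check_gain_le) (auto dest: in_set_dropD)
      qed
      then show ?thesis using xs ps(1)[OF l] ss by simp
    qed
    have "\<bar>perm_avg E (\<lambda>\<tau>. f (map \<tau> (ps l @ ss))) - iid E (length (ps l @ ss)) f\<bar>
        \<le> 2 * ?B * (real (length (ps l @ ss)))\<^sup>2 / real (card E)"
      by (rule perm_avg_iid[OF E(1) ps(2,3)[OF l] fb])
    also have "\<dots> = 2 * ?B * (real l + real k)\<^sup>2 / real (card E)" using ps(1)[OF l] ss by simp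
    also have "\<dots> \<le> 2 * ?B * (real n + real k)\<^sup>2 / real M"
      using M l T by (intro frac_le mult_left_mono power_mono) auto
    finally have 1: "\<bar>perm_avg E (\<lambda>\<tau>. f (map \<tau> (ps l @ ss))) - iid E (l + k) f\<bar>
       \<le> tot w * (2 * (real k + 1) * ln 2 * (real n + real k)\<^sup>2 / real M)"
      using ps(1)[OF l] ss by (simp add: algebra_simps)
    have "iid E (l + k) f = iid E l (\<lambda>xs. iid E k (\<lambda>ys. reveal (G @ map \<sigma> xs) (check_gain \<sigma> ?\<psi> ys) w))"
      unfolding iid_append by (intro iid_cong) (simp add: f_def)
    also have "\<dots> = iid E l (\<lambda>xs. reveal G (reveal (map \<sigma> xs) ?X) w)"
      unfolding iid_reveal_commute reveal_append
      by (intro iid_cong reveal_cong[OF G w] reveal_cong list_all_spin iid_check_gain)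
    also have "\<dots> = reveal G ((R ^^ l) ?X) w" unfolding iid_reveal_commute iid_reveal ..
    finally have 2: "iid E (l + k) f = reveal G ((R ^^ l) ?X) w" .
    have "f (map \<tau> (ps l @ ss)) = reveal (G @ map \<sigma> (map \<tau> (ps l))) (check_gain \<sigma> ?\<psi> (map \<tau> ss)) w" for \<tau>
      using ps(1)[OF l] by (simp add: f_def)
    then show ?thesis using 1 2 by simp
  qed
  have "reveal G (\<lambda>u. c * tot u) w \<le> reveal G (\<lambda>u. \<Sum>l<n. (R ^^ l) ?X u) w"
    using pinned_step[OF _ K, of _ n k] by (intro reveal_mono[OF G w]) (simp add: c_def mult.commute)
  then have "c * tot w \<le> (\<Sum>l<n. reveal G ((R ^^ l) ?X) w)"
    by (simp add: reveal_cmult reveal_tot reveal_sum)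
  moreover have "(\<Sum>l<n. reveal G ((R ^^ l) ?X) w - tot w * (2 * (real k + 1) * ln 2 * (real n + real k)\<^sup>2 / real M))
    \<le> (\<Sum>l<n. perm_avg E (\<lambda>\<tau>. reveal (G @ map \<sigma> (map \<tau> (ps l))) (check_gain \<sigma> ?\<psi> (map \<tau> ss)) w))"
    by (intro sum_mono each) simp
  ultimately show ?thesis unfolding c_def by (simp add: sum_subtractf algebra_simps)
qed

end

text \<open>Check \<open>a\<close> owns the check sockets \<open>Kb a ..< Kb (Suc a)\<close>; \<open>sp s\<close> is the spin of the variable
  node owning the variable socket \<open>s\<close>, and a matching sends check sockets to variable sockets.\<close>
locale matching = weights A + moments q
  for A :: "'x set" and q :: "nat \<Rightarrow> real" +
  fixes N m :: nat and Kb :: "nat \<Rightarrow> nat" and sp :: "nat \<Rightarrow> 'x \<Rightarrow> real"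
    and lw :: "nat \<Rightarrow> real measure" and dg :: "nat \<Rightarrow> nat" and kmax :: nat
  assumes sp: "spin (sp s)"
    and Kb0: "Kb 0 = 0" and Kb_mono: "Kb a \<le> Kb (Suc a)" and Kbm: "Kb m = N"
    and kmax: "Kb (Suc a) - Kb a \<le> kmax"
    and dg: "Kb a \<le> e \<Longrightarrow> e < Kb (Suc a) \<Longrightarrow> dg e = Kb (Suc a) - Kb a"
    and lw: "noise_law (lw k)" "\<bar>z\<bar> \<le> 1 \<Longrightarrow> (\<integral>t. phi (t * z) \<partial>lw k) = phi_mom q (k - 1) z"
begin

definition kd :: "nat \<Rightarrow> nat" where "kd a = Kb (Suc a) - Kb a"

definition chk :: "(nat \<Rightarrow> nat) \<Rightarrow> nat \<Rightarrow> 'x \<Rightarrow> real" where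
  "chk \<rho> a = (\<lambda>x. \<Prod>e\<leftarrow>[Kb a..<Kb (Suc a)]. sp (\<rho> e) x)"

definition nobs :: "(nat \<Rightarrow> nat) \<Rightarrow> nat \<Rightarrow> nat \<Rightarrow> (('x \<Rightarrow> real) \<times> real measure) list" where
  "nobs \<rho> i j = map (\<lambda>e. (sp (\<rho> e), lw (dg e))) [i..<j]"

definition real_ent :: "(nat \<Rightarrow> nat) \<Rightarrow> ('x \<Rightarrow> real) \<Rightarrow> real" where
  "real_ent \<rho> w = reveal (map (chk \<rho>) [0..<m]) ent w"

definition tree_ent :: "(nat \<Rightarrow> nat) \<Rightarrow> ('x \<Rightarrow> real) \<Rightarrow> real" where
  "tree_ent \<rho> w = noisys (nobs \<rho> 0 N) ent w"

text \<open>State a of the interpolation: checks below a have been replaced, those from a up to m'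
  are intact, and l pins are read from the reserve, which consists of the last M check
  sockets.\<close>

definition mixed_ent :: "nat \<Rightarrow> nat \<Rightarrow> nat \<Rightarrow> (nat \<Rightarrow> nat) \<Rightarrow> nat \<Rightarrow> ('x \<Rightarrow> real) \<Rightarrow> real" where
  "mixed_ent m' M l \<rho> a w = noisys (nobs \<rho> 0 (Kb a))
     (reveal (map (chk \<rho>) [a..<m']) (reveal (map (\<lambda>e. sp (\<rho> e)) [N - M..<N - M + l]) ent)) w"

lemma spin_chk: "spin (chk \<rho> a)"
  unfolding chk_def by (rule spin_prod_list) (rule sp)

lemma list_all_spin_chk: "list_all spin (map (chk \<rho>) as)"
  using spin_chk by (auto simp: list_all_iff)

lemma list_all_spin_sp: "list_all spin (map (\<lambda>e. sp (\<rho> e)) es)"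
  using sp by (auto simp: list_all_iff)

lemma valid_nobs: "valid_obs (nobs \<rho> i j)"
  using sp lw by (auto simp: valid_obs_def nobs_def)

lemma Kb_le: "a \<le> b \<Longrightarrow> Kb a \<le> Kb b"
  using Kb_mono by (rule lift_Suc_mono_le)

lemma nobs_append: "i \<le> j \<Longrightarrow> j \<le> k \<Longrightarrow> nobs \<rho> i k = nobs \<rho> i j @ nobs \<rho> j k"
  unfolding nobs_def map_append[symmetric] using upt_add_eq_append[of i j "k - j"] by simp

text \<open>Composition with a permutation of the pool is a bijection of the matchings, so a uniform
  matching may be resampled inside the pool.\<close>

lemma perm_avg_over_pool:
  assumes "E \<subseteq> {..<N}"
  shows "(\<Sum>\<rho> | \<rho> permutes {..<N}. f \<rho>) = (\<Sum>\<rho> | \<rho> permutes {..<N}. perm_avg E (\<lambda>\<tau>. f (\<rho> \<circ> \<tau>)))"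
proof -
  have fE: "finite E" using assms finite_subset by blast
  have "(\<Sum>\<rho> | \<rho> permutes {..<N}. perm_avg E (\<lambda>\<tau>. f (\<rho> \<circ> \<tau>)))
     = perm_avg E (\<lambda>\<tau>. \<Sum>\<rho> | \<rho> permutes {..<N}. f (\<rho> \<circ> \<tau>))"
    by (simp add: perm_avg_sum)
  also have "\<dots> = perm_avg E (\<lambda>\<tau>. \<Sum>\<rho> | \<rho> permutes {..<N}. f \<rho>)"
    unfolding perm_avg_def
  proof (rule arg_cong2[where f = "(/)", OF sum.cong[OF refl] refl])
    fix \<tau> assume "\<tau> \<in> {\<tau>. \<tau> permutes E}"
    then have "\<tau> permutes {..<N}" using assms permutes_subset by blast
    then show "(\<Sum>\<rho> | \<rho> permutes {..<N}. f (\<rho> \<circ> \<tau>)) = (\<Sum>\<rho> | \<rho> permutes {..<N}. f \<rho>)"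
      using sum_permutations_compose_right[of \<tau> "{..<N}" f] by simp
  qed
  finally show ?thesis using perm_avg_const[OF fE] by simp
qed

text \<open>Only the sockets of check a and the reserve are resampled. The earlier noisy
  observations and the later checks stay fixed, so the two states differ by one pool step, taken
  under the integrals of the earlier observations.\<close>

lemma mixed_step:
  assumes w: "nonneg w" and a: "a < m'" "m' \<le> m" and room: "Kb m' + M \<le> N" and M: "0 < M" "n \<le> M"
    and K: "0 \<le> K" "\<And>x y. \<bar>x\<bar> \<le> 1 \<Longrightarrow> \<bar>y\<bar> \<le> 1 \<Longrightarrow> phi x - phi y \<le> \<epsilon> + K * (x - y)\<^sup>2"
    and c: "c \<le> real n * (check_const q (kd a) - \<epsilon>) - (real (kd a))\<^sup>2 * ln 2 - K * 2 ^ kd a * (real (kd a))\<^sup>2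
       - real n * (2 * (real (kd a) + 1) * ln 2 * (real n + real (kd a))\<^sup>2 / real M)"
  shows "fact N * (c * tot w) \<le> (\<Sum>\<rho> | \<rho> permutes {..<N}.
     \<Sum>l<n. mixed_ent m' M l \<rho> a w - mixed_ent m' M l \<rho> (Suc a) w)"
proof -
  define ss where "ss = [Kb a..<Kb (Suc a)]"
  define ps where "ps l = [N - M..<N - M + l]" for l
  define E where "E = set ss \<union> {N - M..<N}"
  have Ka: "Kb (Suc a) \<le> Kb m'" using a by (intro Kb_le) auto
  have E: "finite E" "E \<noteq> {}" "E \<subseteq> {..<N}"
    using M room Ka Kb_mono[of a] by (auto simp: E_def ss_def)
  have cE: "M \<le> card E"
  proof -
    have "card {N - M..<N} = M" using room by simp
    then show ?thesis using card_mono[OF E(1), of "{N - M..<N}"] by (simp add: E_def)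
  qed
  have len: "length ss = kd a" by (simp add: ss_def kd_def)
  have psE: "length (ps l) = l" "distinct (ps l @ ss)" "set (ps l @ ss) \<subseteq> E" if "l < n" for l
    using that M room Ka by (auto simp: ps_def E_def ss_def)
  let ?\<psi> = "phi_mom q (kd a - 1)"
  let ?perms = "{\<rho>. \<rho> permutes {..<N}}"
  have nb: "nobs \<rho> (Kb a) (Kb (Suc a)) = map (\<lambda>s. (sp (\<rho> s), lw (kd a))) ss" for \<rho>
    using dg[of a] by (auto simp: nobs_def ss_def kd_def)
  define G where "G \<rho> = map (chk \<rho>) [Suc a..<m']" for \<rho>
  define D where "D \<rho> l u = obs (chk \<rho> a) 1 (reveal (G \<rho> @ map (\<lambda>e. sp (\<rho> e)) (ps l)) ent) u
     - noisys (nobs \<rho> (Kb a) (Kb (Suc a))) (reveal (G \<rho> @ map (\<lambda>e. sp (\<rho> e)) (ps l)) ent) u" for \<rho> l u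
  have lG: "list_all spin (G \<rho>)" for \<rho> unfolding G_def by (rule list_all_spin_chk)
  have lGp: "list_all spin (G \<rho> @ map (\<lambda>e. sp (\<rho> e)) es)" for \<rho> es
    using lG list_all_spin_sp by simp
  have gD: "good (D \<rho> l)" for \<rho> l
    unfolding D_def[abs_def]
    by (intro good_diff good_obs good_noisys good_reveal good_ent lGp valid_nobs spin_chk) auto
  have diff: "mixed_ent m' M l \<rho> a w - mixed_ent m' M l \<rho> (Suc a) w = noisys (nobs \<rho> 0 (Kb a)) (D \<rho> l) w" for l \<rho>
  proof -
    have "[a..<m'] = a # [Suc a..<m']" using a by (simp add: upt_conv_Cons)
    then have 1: "mixed_ent m' M l \<rho> a w = noisys (nobs \<rho> 0 (Kb a)) (obs (chk \<rho> a) 1 (reveal (G \<rho> @ map (\<lambda>e. sp (\<rho> e)) (ps l)) ent)) w"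
      by (simp add: mixed_ent_def G_def ps_def reveal_append)
    have 2: "mixed_ent m' M l \<rho> (Suc a) w = noisys (nobs \<rho> 0 (Kb a)) (noisys (nobs \<rho> (Kb a) (Kb (Suc a))) (reveal (G \<rho> @ map (\<lambda>e. sp (\<rho> e)) (ps l)) ent)) w"
      using nobs_append[of 0 "Kb a" "Kb (Suc a)" \<rho>] Kb_mono[of a]
      by (simp add: mixed_ent_def G_def ps_def reveal_append noisys_append)
    show ?thesis unfolding 1 2 D_def[abs_def]
      by (intro noisys_diff[symmetric] valid_nobs w good_obs good_noisys good_reveal good_ent lGp spin_chk) auto
  qed
  \<comment> \<open>E avoids the sockets below \<open>Kb a\<close> and those of the later checks;
    \<open>room\<close> keeps the reserve disjoint from them.\<close>
  have fix\<tau>: "nobs (\<rho> \<circ> \<tau>) 0 (Kb a) = nobs \<rho> 0 (Kb a)" "G (\<rho> \<circ> \<tau>) = G \<rho>" if \<tau>: "\<tau> permutes E" for \<rho> \<tau>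
  proof -
    have KN: "Kb m' \<le> N - M" using room by simp
    have "Kb a \<le> N - M" using KN Ka Kb_mono[of a] by linarith
    then have "e \<notin> E" if "e < Kb a" for e using that by (auto simp: E_def ss_def)
    then have "\<tau> e = e" if "e < Kb a" for e using that permutes_not_in[OF \<tau>] by auto
    then show "nobs (\<rho> \<circ> \<tau>) 0 (Kb a) = nobs \<rho> 0 (Kb a)" by (auto simp: nobs_def)
    have "chk (\<rho> \<circ> \<tau>) b = chk \<rho> b" if b: "Suc a \<le> b" "b < m'" for b
    proof -
      have "Kb (Suc b) \<le> Kb m'" "Kb (Suc a) \<le> Kb b" using b by (auto intro!: Kb_le)
      then have "e \<notin> E" if "e \<in> {Kb b..<Kb (Suc b)}" for e using that KN by (auto simp: E_def ss_def)
      then have "\<tau> e = e" if "e \<in> {Kb b..<Kb (Suc b)}" for e using that permutes_not_in[OF \<tau>] by auto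
      then have "map (\<lambda>e. sp ((\<rho> \<circ> \<tau>) e) x) [Kb b..<Kb (Suc b)] = map (\<lambda>e. sp (\<rho> e) x) [Kb b..<Kb (Suc b)]" for x
        by auto
      then show ?thesis unfolding chk_def by metis
    qed
    then show "G (\<rho> \<circ> \<tau>) = G \<rho>" by (auto simp: G_def)
  qed
  have main: "c * tot w \<le> perm_avg E (\<lambda>\<tau>. \<Sum>l<n. mixed_ent m' M l (\<rho> \<circ> \<tau>) a w - mixed_ent m' M l (\<rho> \<circ> \<tau>) (Suc a) w)" for \<rho>
  proof -
    interpret P: pool_moments A E "\<lambda>e. sp (\<rho> e)" q
      by unfold_locales (use E sp in auto)
    have pt: "c * tot u \<le> perm_avg E (\<lambda>\<tau>. \<Sum>l<n. D (\<rho> \<circ> \<tau>) l u)" if u: "nonneg u" for u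
    proof -
      have "c * tot u \<le> tot u * (real n * (check_const q (kd a) - \<epsilon>) - (real (kd a))\<^sup>2 * ln 2 - K * 2 ^ kd a * (real (kd a))\<^sup>2
       - real n * (2 * (real (kd a) + 1) * ln 2 * (real n + real (kd a))\<^sup>2 / real M))"
        unfolding mult.commute[of c] using tot_nonneg[OF u] c by (intro mult_left_mono)
      also have "\<dots> \<le> (\<Sum>l<n. perm_avg E (\<lambda>\<tau>. reveal (G \<rho> @ map (\<lambda>e. sp (\<rho> e)) (map \<tau> (ps l)))
           (check_gain (\<lambda>e. sp (\<rho> e)) ?\<psi> (map \<tau> ss)) u))"
        by (rule P.pool_step[OF u lG K psE len M(1) cE])
      also have "\<dots> \<le> (\<Sum>l<n. perm_avg E (\<lambda>\<tau>. D (\<rho> \<circ> \<tau>) l u))"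
      proof (intro sum_mono perm_avg_mono E(1))
        fix l \<tau> assume \<tau>: "\<tau> permutes E"
        have "reveal (G \<rho> @ map (\<lambda>e. sp (\<rho> e)) (map \<tau> (ps l))) (check_gain (\<lambda>e. sp (\<rho> e)) ?\<psi> (map \<tau> ss)) u
          \<le> obs (\<lambda>x. \<Prod>s\<leftarrow>map \<tau> ss. sp (\<rho> s) x) 1 (reveal (G \<rho> @ map (\<lambda>e. sp (\<rho> e)) (map \<tau> (ps l))) ent) u
           - noisys (map (\<lambda>s. (sp (\<rho> s), lw (kd a))) (map \<tau> ss)) (reveal (G \<rho> @ map (\<lambda>e. sp (\<rho> e)) (map \<tau> (ps l))) ent) u"
          using phi_mom_bounds
          by (intro check_vs_noisy[where C = "ln 2"] lw sp lGp u phi_mom_measurable convex_phi_mom) auto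
        also have "\<dots> = D (\<rho> \<circ> \<tau>) l u"
          unfolding D_def fix\<tau>(2)[OF \<tau>] nb chk_def ss_def[symmetric] by (simp add: comp_def)
        finally show "reveal (G \<rho> @ map (\<lambda>e. sp (\<rho> e)) (map \<tau> (ps l))) (check_gain (\<lambda>e. sp (\<rho> e)) ?\<psi> (map \<tau> ss)) u
          \<le> D (\<rho> \<circ> \<tau>) l u" .
      qed
      finally show ?thesis by (simp add: perm_avg_sum)
    qed
    let ?T = "{\<tau>. \<tau> permutes E}"
    have gA: "good (\<lambda>u. perm_avg E (\<lambda>\<tau>. \<Sum>l<n. D (\<rho> \<circ> \<tau>) l u))"
      unfolding perm_avg_def divide_inverse mult.commute[of _ "inverse _"]
      by (intro good_cmult good_sum gD)
    have "c * tot w = noisys (nobs \<rho> 0 (Kb a)) (\<lambda>u. c * tot u) w"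
      using valid_nobs by (simp add: noisys_cmult noisys_tot)
    also have "\<dots> \<le> noisys (nobs \<rho> 0 (Kb a)) (\<lambda>u. perm_avg E (\<lambda>\<tau>. \<Sum>l<n. D (\<rho> \<circ> \<tau>) l u)) w"
      by (intro noisys_mono valid_nobs good_cmult good_tot gA w pt)
    also have "\<dots> = inverse (fact (card E)) * noisys (nobs \<rho> 0 (Kb a)) (\<lambda>u. \<Sum>\<tau>\<in>?T. \<Sum>l<n. D (\<rho> \<circ> \<tau>) l u) w"
      unfolding perm_avg_def divide_inverse mult.commute[of _ "inverse _"] noisys_cmult ..
    also have "\<dots> = perm_avg E (\<lambda>\<tau>. \<Sum>l<n. noisys (nobs \<rho> 0 (Kb a)) (D (\<rho> \<circ> \<tau>) l) w)"
      by (simp add: noisys_sum[OF valid_nobs good_sum w] noisys_sum[OF valid_nobs _ w] gD perm_avg_def divide_inverse)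
    also have "\<dots> = perm_avg E (\<lambda>\<tau>. \<Sum>l<n. mixed_ent m' M l (\<rho> \<circ> \<tau>) a w - mixed_ent m' M l (\<rho> \<circ> \<tau>) (Suc a) w)"
      unfolding diff perm_avg_def using fix\<tau>(1) by simp
    finally show ?thesis .
  qed
  define h where "h \<rho> = (\<Sum>l<n. mixed_ent m' M l \<rho> a w - mixed_ent m' M l \<rho> (Suc a) w)" for \<rho>
  have "fact N * (c * tot w) = (\<Sum>\<rho>\<in>?perms. c * tot w)" by (simp add: card_permutations)
  also have "\<dots> \<le> (\<Sum>\<rho>\<in>?perms. perm_avg E (\<lambda>\<tau>. h (\<rho> \<circ> \<tau>)))"
    unfolding h_def by (intro sum_mono main)
  also have "\<dots> = (\<Sum>\<rho>\<in>?perms. h \<rho>)"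
    using perm_avg_over_pool[OF E(3), of h] by simp
  finally have "fact N * (c * tot w) \<le> (\<Sum>\<rho>\<in>?perms. h \<rho>)" .
  then show ?thesis unfolding h_def .
qed

lemma check_const_le: "check_const q k \<le> real k * ln 2"
proof (cases "k = 0")
  case True
  have "phi_mom q 0 1 = ln 2"
    using phi_eq_even_series[of 1] by (simp add: phi_mom_def phi_one)
  then show ?thesis using True by (simp add: check_const_def)
next
  case False
  have "real k * phi_mom q (k - 1) 1 \<le> real k * ln 2"
    using phi_mom_bounds(2)[of 1 "k - 1"] by (intro mult_left_mono) auto
  moreover have "0 \<le> (real k - 1) * phi_mom q k 1"
    using phi_mom_bounds(1)[of 1 k] False by (intro mult_nonneg_nonneg) auto
  moreover have "0 \<le> ln (2::real)" by simp
  ultimately show ?thesis unfolding check_const_def by linarith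
qed

text \<open>The cost is charged to sockets instead of checks: a check of degree 0 is constant and
  free, so the number of such checks does not matter when checks are dropped.\<close>

lemma obs_chk_ent_ge:
  assumes "nonneg w" shows "ent w - real (kd a) * ln 2 * tot w \<le> obs (chk \<rho> a) 1 ent w"
proof (cases "kd a = 0")
  case True
  then have "chk \<rho> a = (\<lambda>x. 1)" by (auto simp: chk_def kd_def)
  then have "obs (chk \<rho> a) 1 ent w = ent w"
    by (simp add: obs_def upd_def ent_def)
  then show ?thesis using True by simp
next
  case False
  have "1 * (ln 2 * tot w) \<le> real (kd a) * (ln 2 * tot w)"
    using False tot_nonneg[OF assms] by (intro mult_right_mono) auto
  then have "ln 2 * tot w \<le> real (kd a) * ln 2 * tot w" by (simp only: mult.assoc mult_1)
  moreover have "ent w - ln 2 * tot w \<le> obs (chk \<rho> a) 1 ent w"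
    by (rule obs_ent_bounds(2)[OF _ spin_chk assms]) simp
  ultimately show ?thesis by linarith
qed

lemma reveal_chk_ent_ge:
  assumes "a \<le> b" "nonneg w"
  shows "ent w - (real (Kb b) - real (Kb a)) * ln 2 * tot w \<le> reveal (map (chk \<rho>) [a..<b]) ent w"
  using assms(1)
proof (induction b rule: dec_induct)
  case (step b)
  have "reveal (map (chk \<rho>) [a..<b]) (\<lambda>w. ent w - real (kd b) * ln 2 * tot w) w
     \<le> reveal (map (chk \<rho>) [a..<b]) (obs (chk \<rho> b) 1 ent) w"
    by (intro reveal_mono list_all_spin_chk assms obs_chk_ent_ge)
  then have "reveal (map (chk \<rho>) [a..<b]) ent w - real (kd b) * ln 2 * tot w
     \<le> reveal (map (chk \<rho>) [a..<b]) (obs (chk \<rho> b) 1 ent) w"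
    unfolding reveal_diff reveal_cmult reveal_tot .
  moreover have "real (kd b) = real (Kb (Suc b)) - real (Kb b)"
    unfolding kd_def using Kb_mono[of b] by simp
  ultimately show ?case using step by (simp add: reveal_append algebra_simps)
qed simp

text \<open>The checks using the last \<open>M\<close> sockets are dropped, which frees these sockets for the pins.\<close>
lemma interpolation:
  assumes w: "nonneg w" and n: "0 < n" "n \<le> M"
    and K: "0 \<le> K" "\<And>x y. \<bar>x\<bar> \<le> 1 \<Longrightarrow> \<bar>y\<bar> \<le> 1 \<Longrightarrow> phi x - phi y \<le> \<epsilon> + K * (x - y)\<^sup>2"
    and \<eta>: "0 \<le> \<eta>" "\<And>k c. k \<le> kmax \<Longrightarrow> real n * (c - \<eta>) \<le> real n * (c - \<epsilon>) - (real k)\<^sup>2 * ln 2 - K * 2 ^ k * (real k)\<^sup>2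
       - real n * (2 * (real k + 1) * ln 2 * (real n + real k)\<^sup>2 / real M)"
  shows "(\<Sum>\<rho> | \<rho> permutes {..<N}. tree_ent \<rho> w)
      + fact N * (tot w * ((\<Sum>a<m. check_const q (kd a)) - \<eta> * real m - (2 * (real M + real kmax) + real n) * ln 2))
    \<le> (\<Sum>\<rho> | \<rho> permutes {..<N}. real_ent \<rho> w)"
proof -
  \<comment> \<open>The first check whose sockets reach into the reserve, or m if there is
    none.\<close>
  define m' where "m' = (LEAST a. a = m \<or> N < Kb (Suc a) + M)"
  have P: "m' = m \<or> N < Kb (Suc m') + M" unfolding m'_def by (rule LeastI[of _ m]) simp
  have le: "m' \<le> m" unfolding m'_def by (rule Least_le) simp
  have below: "Kb (Suc a) + M \<le> N" if "a < m'" for a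
    using not_less_Least[of a "\<lambda>a. a = m \<or> N < Kb (Suc a) + M"] that by (auto simp: m'_def)
  have KN: "Kb m' \<le> N" using Kb_le[OF le] Kbm by simp
  have tail: "real N - real (Kb m') \<le> real M + real kmax"
    using P kmax[of m'] Kb_mono[of m'] Kbm by (auto simp: of_nat_diff)
  have room: "Kb m' + M \<le> N" if "a < m'" for a
    using below[of "m' - 1"] that by (cases m') auto
  define X where "X = real M + real kmax"
  have X: "0 \<le> X" by (simp add: X_def)
  let ?S = "\<lambda>f. \<Sum>\<rho> | \<rho> permutes {..<N}. f \<rho>"
  have T: "0 \<le> tot w" by (rule tot_nonneg[OF w])
  \<comment> \<open>The pins only lower the entropy. Putting back the dropped checks lowers it by at
    most ln 2 per socket, and they have at most X sockets.\<close>
  have top: "mixed_ent m' M l \<rho> 0 w \<le> real_ent \<rho> w + X * ln 2 * tot w" for l \<rho>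
  proof -
    have "mixed_ent m' M l \<rho> 0 w \<le> reveal (map (chk \<rho>) [0..<m']) ent w"
      unfolding mixed_ent_def Kb0 using w
      by (simp add: nobs_def) (intro reveal_mono list_all_spin_chk reveal_ent_le list_all_spin_sp)
    also have "\<dots> \<le> reveal (map (chk \<rho>) [0..<m']) (\<lambda>u. reveal (map (chk \<rho>) [m'..<m]) ent u + X * ln 2 * tot u) w"
    proof (intro reveal_mono list_all_spin_chk w)
      fix u :: "'x \<Rightarrow> real" assume u: "nonneg u"
      have "(real (Kb m) - real (Kb m')) * ln 2 * tot u \<le> X * ln 2 * tot u"
        using tail Kbm tot_nonneg[OF u] by (intro mult_right_mono) (auto simp: X_def)
      then show "ent u \<le> reveal (map (chk \<rho>) [m'..<m]) ent u + X * ln 2 * tot u"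
        using reveal_chk_ent_ge[OF le u, of \<rho>] by linarith
    qed
    also have "\<dots> = reveal (map (chk \<rho>) ([0..<m'] @ [m'..<m])) ent w + X * ln 2 * tot w"
      by (simp only: reveal_add reveal_cmult reveal_tot reveal_append map_append)
    also have "[0..<m'] @ [m'..<m] = [0..<m]" using upt_add_eq_append[of 0 m' "m - m'"] le by simp
    finally show ?thesis by (simp add: real_ent_def)
  qed
  \<comment> \<open>The noisy observations at the sockets from \<open>Kb m'\<close> on only lower
    the entropy, and fewer than n pins cost at most n ln 2.\<close>
  have bottom: "tree_ent \<rho> w \<le> mixed_ent m' M l \<rho> m' w + real n * ln 2 * tot w" if l: "l < n" for l \<rho>
  proof -
    let ?U = "nobs \<rho> 0 (Kb m')" and ?p = "map (\<lambda>e. sp (\<rho> e)) [N - M..<N - M + l]"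
    have "tree_ent \<rho> w = noisys ?U (noisys (nobs \<rho> (Kb m') N) ent) w"
      unfolding tree_ent_def using nobs_append[of 0 "Kb m'" N \<rho>] KN by (simp add: noisys_append)
    also have "\<dots> \<le> noisys ?U (\<lambda>u. reveal ?p ent u + real n * ln 2 * tot u) w"
    proof (intro noisys_mono valid_nobs w good_noisys good_ent good_add good_reveal good_cmult good_tot list_all_spin_sp)
      fix u :: "'x \<Rightarrow> real" assume u: "nonneg u"
      have "real l * ln 2 * tot u \<le> real n * ln 2 * tot u"
        using l tot_nonneg[OF u] by (intro mult_right_mono) auto
      moreover have "ent u - real l * ln 2 * tot u \<le> reveal ?p ent u"
        using reveal_ent_ge[OF list_all_spin_sp u, of \<rho> "[N - M..<N - M + l]"] by simp
      ultimately show "noisys (nobs \<rho> (Kb m') N) ent u \<le> reveal ?p ent u + real n * ln 2 * tot u"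
        using noisys_ent_le_ent[OF valid_nobs u, of \<rho> "Kb m'" N] by linarith
    qed
    also have "\<dots> = mixed_ent m' M l \<rho> m' w + real n * ln 2 * tot w"
      using valid_nobs by (simp add: noisys_add[OF valid_nobs good_reveal[OF good_ent list_all_spin_sp] good_cmult[OF good_tot] w]
          noisys_cmult noisys_tot mixed_ent_def)
    finally show ?thesis .
  qed
  have steps: "fact N * (tot w * (real n * (\<Sum>a<m'. check_const q (kd a) - \<eta>)))
     \<le> ?S (\<lambda>\<rho>. \<Sum>l<n. mixed_ent m' M l \<rho> 0 w - mixed_ent m' M l \<rho> m' w)"
  proof -
    have "(\<Sum>a<m'. fact N * (real n * (check_const q (kd a) - \<eta>) * tot w))
      \<le> (\<Sum>a<m'. ?S (\<lambda>\<rho>. \<Sum>l<n. mixed_ent m' M l \<rho> a w - mixed_ent m' M l \<rho> (Suc a) w))"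
    proof (intro sum_mono)
      fix a assume a: "a \<in> {..<m'}"
      have "0 < M" using n by simp
      moreover have "kd a \<le> kmax" using kmax by (simp add: kd_def)
      ultimately show "fact N * (real n * (check_const q (kd a) - \<eta>) * tot w)
         \<le> ?S (\<lambda>\<rho>. \<Sum>l<n. mixed_ent m' M l \<rho> a w - mixed_ent m' M l \<rho> (Suc a) w)"
        using a room by (intro mixed_step[OF w _ le _ _ n(2) K \<eta>(2)]) auto
    qed
    also have "\<dots> = ?S (\<lambda>\<rho>. \<Sum>l<n. \<Sum>a<m'. mixed_ent m' M l \<rho> a w - mixed_ent m' M l \<rho> (Suc a) w)"
      by (subst sum.swap) (intro sum.cong refl sum.swap)
    also have "\<dots> = ?S (\<lambda>\<rho>. \<Sum>l<n. mixed_ent m' M l \<rho> 0 w - mixed_ent m' M l \<rho> m' w)"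
      by (intro sum.cong refl) (rule sum_lessThan_telescope'[of "\<lambda>a. mixed_ent m' M _ _ a w"])
    finally show ?thesis
      by (simp add: sum_distrib_left mult_ac)
  qed
  have each: "(\<Sum>l<n. mixed_ent m' M l \<rho> 0 w - mixed_ent m' M l \<rho> m' w)
     \<le> real n * (real_ent \<rho> w - tree_ent \<rho> w + (X + real n) * ln 2 * tot w)" for \<rho>
  proof -
    have "(\<Sum>l<n. mixed_ent m' M l \<rho> 0 w - mixed_ent m' M l \<rho> m' w)
      \<le> real (card {..<n}) * (real_ent \<rho> w - tree_ent \<rho> w + (X + real n) * ln 2 * tot w)"
    proof (intro sum_bounded_above)
      fix l assume "l \<in> {..<n}"
      then show "mixed_ent m' M l \<rho> 0 w - mixed_ent m' M l \<rho> m' w \<le> real_ent \<rho> w - tree_ent \<rho> w + (X + real n) * ln 2 * tot w"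
        using top[of l \<rho>] bottom[of l \<rho>] by (simp add: algebra_simps)
    qed
    then show ?thesis by simp
  qed
  have "fact N * (tot w * (real n * (\<Sum>a<m'. check_const q (kd a) - \<eta>)))
     \<le> ?S (\<lambda>\<rho>. real n * (real_ent \<rho> w - tree_ent \<rho> w + (X + real n) * ln 2 * tot w))"
    using steps sum_mono[of "{\<rho>. \<rho> permutes {..<N}}", OF each] by (rule order_trans)
  also have "\<dots> = real n * (?S (\<lambda>\<rho>. real_ent \<rho> w) - ?S (\<lambda>\<rho>. tree_ent \<rho> w) + fact N * ((X + real n) * ln 2 * tot w))"
    by (simp add: sum_distrib_left[symmetric] sum.distrib sum_subtractf card_permutations)
  finally have "real n * (fact N * (tot w * (\<Sum>a<m'. check_const q (kd a) - \<eta>)))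
     \<le> real n * (?S (\<lambda>\<rho>. real_ent \<rho> w) - ?S (\<lambda>\<rho>. tree_ent \<rho> w) + fact N * ((X + real n) * ln 2 * tot w))"
    by (simp add: mult_ac)
  then have A: "fact N * (tot w * (\<Sum>a<m'. check_const q (kd a) - \<eta>))
     \<le> ?S (\<lambda>\<rho>. real_ent \<rho> w) - ?S (\<lambda>\<rho>. tree_ent \<rho> w) + fact N * ((X + real n) * ln 2 * tot w)"
    using n by simp
  \<comment> \<open>The dropped checks are also missing from the sum of constants.
    \<open>check_const_le\<close> charges them X ln 2 once more, whence the factor 2 in the
    conclusion.\<close>
  have B: "(\<Sum>a<m. check_const q (kd a)) - \<eta> * real m - X * ln 2 \<le> (\<Sum>a<m'. check_const q (kd a) - \<eta>)"
  proof -
    have "(\<Sum>a<m. check_const q (kd a)) = (\<Sum>a<m'. check_const q (kd a)) + (\<Sum>a=m'..<m. check_const q (kd a))"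
      using sum.atLeastLessThan_concat[of 0 m' m "\<lambda>a. check_const q (kd a)"] le by (simp add: lessThan_atLeast0)
    moreover have "(\<Sum>a=m'..<m. check_const q (kd a)) \<le> X * ln 2"
    proof -
      have "(\<Sum>a=m'..<m. check_const q (kd a)) \<le> (\<Sum>a=m'..<m. real (kd a)) * ln 2"
        unfolding sum_distrib_right by (intro sum_mono check_const_le)
      also have "(\<Sum>a=m'..<m. real (kd a)) = real (Kb m) - real (Kb m')"
        using le
      proof (induction m rule: dec_induct)
        case (step b)
        then show ?case using Kb_mono[of b] by (simp add: kd_def of_nat_diff)
      qed simp
      also have "(real (Kb m) - real (Kb m')) * ln 2 \<le> X * ln 2"
        using tail Kbm by (intro mult_right_mono) (auto simp: X_def)
      finally show ?thesis .
    qed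
    moreover have "\<eta> * real m' \<le> \<eta> * real m" using le \<eta>(1) by (intro mult_left_mono) auto
    moreover have "(\<Sum>a<m'. check_const q (kd a) - \<eta>) = (\<Sum>a<m'. check_const q (kd a)) - \<eta> * real m'"
      by (simp add: sum_subtractf)
    ultimately show ?thesis by linarith
  qed
  have "fact N * (tot w * ((\<Sum>a<m. check_const q (kd a)) - \<eta> * real m - X * ln 2))
    \<le> fact N * (tot w * (\<Sum>a<m'. check_const q (kd a) - \<eta>))"
    by (intro mult_left_mono B T) auto
  with A show ?thesis by (simp add: X_def algebra_simps)
qed

end

text \<open>Three errors receive \<eta> / 3 each: \<epsilon> is fixed first and determines K; then n
  absorbs the telescoped terms, which do not grow with n; then M absorbs the sampling error, which
  depends on n.\<close>

lemma choose_constants: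
  fixes \<eta> :: real and kmax :: nat
  assumes "0 < \<eta>"
  obtains n M :: nat and K \<epsilon> :: real where "0 < n" "n \<le> M" "0 \<le> K"
    "\<And>x y. \<bar>x\<bar> \<le> 1 \<Longrightarrow> \<bar>y\<bar> \<le> 1 \<Longrightarrow> phi x - phi y \<le> \<epsilon> + K * (x - y)\<^sup>2"
    "\<And>k c. k \<le> kmax \<Longrightarrow> real n * (c - \<eta>) \<le> real n * (c - \<epsilon>) - (real k)\<^sup>2 * ln 2 - K * 2 ^ k * (real k)\<^sup>2
       - real n * (2 * (real k + 1) * ln 2 * (real n + real k)\<^sup>2 / real M)"
proof -
  obtain K where K: "0 \<le> K" "\<And>x y. \<bar>x\<bar> \<le> 1 \<Longrightarrow> \<bar>y\<bar> \<le> 1 \<Longrightarrow> phi x - phi y \<le> \<eta> / 3 + K * (x - y)\<^sup>2"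
    using phi_quadratic_modulus[of "\<eta> / 3"] assms by auto
  define X where "X = (real kmax)\<^sup>2 * ln 2 + K * 2 ^ kmax * (real kmax)\<^sup>2"
  define n where "n = Suc (nat \<lceil>3 * X / \<eta>\<rceil>)"
  define Z where "Z = 2 * (real kmax + 1) * ln 2 * (real n + real kmax)\<^sup>2"
  define M where "M = n + nat \<lceil>3 * Z / \<eta>\<rceil>"
  have "3 * X / \<eta> \<le> real n" unfolding n_def by linarith
  then have n: "X \<le> real n * \<eta> / 3" using assms by (simp add: field_simps)
  have "3 * Z / \<eta> \<le> real M" unfolding M_def by linarith
  moreover have M0: "0 < real M" by (simp add: M_def n_def)
  ultimately have M: "Z / real M \<le> \<eta> / 3" using assms by (simp add: field_simps)
  show thesis
  proof (rule that[of n M K "\<eta> / 3"])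
    fix k :: nat and c :: real assume k: "k \<le> kmax"
    have "(real k)\<^sup>2 * ln 2 + K * 2 ^ k * (real k)\<^sup>2 \<le> X"
      unfolding X_def using k K(1) by (intro add_mono mult_mono power_mono power_increasing) auto
    moreover have "2 * (real k + 1) * ln 2 * (real n + real k)\<^sup>2 \<le> Z"
      unfolding Z_def using k by (intro mult_mono power_mono) auto
    then have "2 * (real k + 1) * ln 2 * (real n + real k)\<^sup>2 / real M \<le> \<eta> / 3"
      using divide_right_mono[of _ Z "real M"] M by (meson M0 less_imp_le order_trans)
    then have "real n * (2 * (real k + 1) * ln 2 * (real n + real k)\<^sup>2 / real M) \<le> real n * (\<eta> / 3)"
      by (intro mult_left_mono) auto
    ultimately show "real n * (c - \<eta>) \<le> real n * (c - \<eta> / 3) - (real k)\<^sup>2 * ln 2 - K * 2 ^ k * (real k)\<^sup>2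
       - real n * (2 * (real k + 1) * ln 2 * (real n + real k)\<^sup>2 / real M)"
      using n by (simp add: algebra_simps)
  qed (use K in \<open>auto simp: M_def n_def\<close>)
qed

subsection \<open>Symmetric laws\<close>

text \<open>In the variable t = tanh (x / 2) the relation a(x) = e^x a(-x) says that (1 - t) times
  the law of t is invariant under reflection. Stating it through integrals covers atoms and laws
  without density.\<close>

definition noise_sym :: "real measure \<Rightarrow> bool" where
  "noise_sym \<rho> \<longleftrightarrow> (\<forall>h::real \<Rightarrow> ennreal. h \<in> borel_measurable borel \<longrightarrow>
     (\<integral>\<^sup>+t. h (- t) * ennreal (1 - t) \<partial>\<rho>) = (\<integral>\<^sup>+t. h t * ennreal (1 - t) \<partial>\<rho>))"

lemma noise_symD:
  assumes "noise_sym \<rho>" "h \<in> borel_measurable borel"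
  shows "(\<integral>\<^sup>+t. h (- t) * ennreal (1 - t) \<partial>\<rho>) = (\<integral>\<^sup>+t. h t * ennreal (1 - t) \<partial>\<rho>)"
  using assms by (auto simp: noise_sym_def)

definition strict_noise :: "real measure \<Rightarrow> bool" where
  "strict_noise \<rho> \<longleftrightarrow> noise_law \<rho> \<and> noise_sym \<rho> \<and> (AE t in \<rho>. -1 < t)"

lemma tanh_measurable[measurable]: "(tanh :: real \<Rightarrow> real) \<in> borel_measurable borel"
  by (intro borel_measurable_continuous_onI continuous_intros) auto

locale sym_law = prob_space V for V :: "real measure" +
  assumes sets_V: "sets V = sets borel"
    and sym_V: "h \<in> borel_measurable borel \<Longrightarrow>
      (\<integral>\<^sup>+v. h (- tanh v) * ennreal (1 - tanh v) \<partial>V) = (\<integral>\<^sup>+v. h (tanh v) * ennreal (1 - tanh v) \<partial>V)"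
begin

lemmas [measurable_cong] = sets_V
lemmas prob_V = prob_space_axioms

definition prod_law :: "nat \<Rightarrow> real measure" where
  "prod_law j = distr (PiM {..<j} (\<lambda>_. V)) borel (\<lambda>v. \<Prod>i<j. tanh (v i))"

definition vmom :: "nat \<Rightarrow> real" where
  "vmom p = (\<integral>v. ((tanh v)\<^sup>2) ^ Suc p \<partial>V)"

sublocale pp: product_prob_space "\<lambda>_::nat. V" by unfold_locales

lemma sets_prod_law[measurable_cong]: "sets (prod_law j) = sets borel"
  by (simp add: prod_law_def)

lemma prod_tanh_measurable[measurable]:
  "(\<lambda>v. \<Prod>i<j. tanh (v i)) \<in> borel_measurable (PiM {..<j} (\<lambda>_. V))"
  by measurable

lemma prob_space_prod_law: "prob_space (prod_law j)"
  unfolding prod_law_def by (intro prob_space.prob_space_distr prob_space_PiM) (auto intro: prob_V)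

lemma prod_tanh_bounds:
  fixes j :: nat and v :: "nat \<Rightarrow> real"
  shows "\<bar>\<Prod>i<j. tanh (v i)\<bar> \<le> (1::real)" "-1 < (\<Prod>i<j. tanh (v i) :: real)"
proof -
  have t: "\<bar>tanh x\<bar> < 1" for x :: real using tanh_real_bounds[of x] by (auto simp: abs_less_iff)
  have 1: "\<bar>\<Prod>i<j. tanh (v i)\<bar> \<le> (1::real)" for j
    unfolding abs_prod using t by (intro prod_le_1) (auto intro: less_imp_le)
  show "\<bar>\<Prod>i<j. tanh (v i)\<bar> \<le> (1::real)" by (rule 1)
  show "-1 < (\<Prod>i<j. tanh (v i))"
  proof (cases j)
    case (Suc k)
    have "\<bar>\<Prod>i<j. tanh (v i)\<bar> \<le> 1 * \<bar>tanh (v k)\<bar>"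
      unfolding Suc prod.lessThan_Suc abs_mult by (intro mult_right_mono 1) auto
    also have "\<dots> < 1" using t by simp
    finally show ?thesis by linarith
  qed simp
qed

lemma noise_law_prod: "noise_law (prod_law j)"
  unfolding noise_law_def using prob_space_prod_law prod_tanh_bounds(1)
  unfolding prod_law_def by (subst AE_distr_iff) auto

lemma AE_prod_law_gt: "AE t in prod_law j. -1 < t"
  unfolding prod_law_def by (subst AE_distr_iff) (use prod_tanh_bounds(2) in auto)

lemma vmom_bounds: "0 \<le> vmom p" "vmom p \<le> 1"
proof -
  have b: "0 \<le> ((tanh v)\<^sup>2) ^ Suc p" "((tanh v)\<^sup>2) ^ Suc p \<le> 1" for v :: real
    using even_series_term_le[of "tanh v" "\<lambda>_. 1" p] tanh_real_bounds[of v] by (auto simp: abs_le_iff)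
  show "0 \<le> vmom p" unfolding vmom_def by (intro Bochner_Integration.integral_nonneg) (use b in auto)
  have "vmom p \<le> (\<integral>v. 1 \<partial>V)" unfolding vmom_def
  proof (rule integral_mono)
    show "integrable V (\<lambda>v. ((tanh v)\<^sup>2) ^ Suc p)"
      by (rule integrable_const_bound[where B = 1]) (use b in \<open>auto simp: abs_le_iff simp del: power_Suc\<close>, measurable)
  qed (use b in auto)
  then show "vmom p \<le> 1" by (simp add: prob_space)
qed

text \<open>The even series is integrated term by term, dominated by the coefficients of
  \<open>phi\<close>; by independence each moment of the product is the j-th power of a single
  moment. This ties actual noise laws to \<open>phi_mom\<close>.\<close>

lemma integral_phi_prod_law:
  assumes z: "\<bar>z\<bar> \<le> 1"
  shows "(\<integral>t. phi (t * z) \<partial>prod_law j) = phi_mom vmom j z"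
proof -
  let ?M = "PiM {..<j} (\<lambda>_. V)"
  interpret M: prob_space ?M by (intro prob_space_PiM) (rule prob_V)
  let ?f = "\<lambda>p v. (phi_coeff p * (z\<^sup>2) ^ Suc p) * (\<Prod>i<j. ((tanh (v i))\<^sup>2) ^ Suc p)"
  have b: "0 \<le> ((tanh v)\<^sup>2) ^ Suc p" "((tanh v)\<^sup>2) ^ Suc p \<le> 1" for v :: real and p
    using even_series_term_le[of "tanh v" "\<lambda>_. 1" p] tanh_real_bounds[of v] by (auto simp: abs_le_iff)
  have pb: "0 \<le> (\<Prod>i<j. ((tanh (v i))\<^sup>2) ^ Suc p)" "(\<Prod>i<j. ((tanh (v i))\<^sup>2) ^ Suc p) \<le> (1::real)" for v p
    using b by (auto intro!: prod_nonneg prod_le_1 simp del: power_Suc)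
  have c: "0 \<le> phi_coeff p * (z\<^sup>2) ^ Suc p" "phi_coeff p * (z\<^sup>2) ^ Suc p \<le> phi_coeff p" for p
    using even_series_term_le[OF z, of phi_coeff p] phi_coeff_nonneg by auto
  have fb: "0 \<le> ?f p v" "?f p v \<le> phi_coeff p" for p v
  proof -
    show "0 \<le> ?f p v" using c(1) pb(1) by (rule mult_nonneg_nonneg)
    have "?f p v \<le> phi_coeff p * (z\<^sup>2) ^ Suc p" using pb(2) c(1) by (rule mult_left_le)
    then show "?f p v \<le> phi_coeff p" using c(2) by (rule order_trans)
  qed
  have int: "integrable ?M (?f p)" for p
    by (rule M.integrable_const_bound[where B = "phi_coeff p"])
       (use fb in \<open>auto simp: abs_le_iff simp del: power_Suc intro: order_trans\<close>, measurable)
  have phi_eq: "phi ((\<Prod>i<j. tanh (v i)) * z) = (\<Sum>p. ?f p v)" for v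
  proof -
    define y where "y = (\<Prod>i<j. tanh (v i)) * z"
    have y: "\<bar>y\<bar> \<le> 1" unfolding y_def abs_mult using prod_tanh_bounds(1) z by (intro mult_le_one) auto
    have "phi_coeff p * (y\<^sup>2) ^ Suc p = ?f p v" for p
      unfolding y_def power_mult_distrib prod_power_distrib by (simp only: mult_ac)
    then show ?thesis unfolding y_def[symmetric] phi_eq_even_series[OF y] even_series_def by (simp only:)
  qed
  have "(\<integral>t. phi (t * z) \<partial>prod_law j) = (\<integral>v. phi ((\<Prod>i<j. tanh (v i)) * z) \<partial>?M)"
    unfolding prod_law_def by (subst integral_distr) measurable
  also have "\<dots> = (\<integral>v. (\<Sum>p. ?f p v) \<partial>?M)" by (simp only: phi_eq)
  also have "\<dots> = (\<Sum>p. \<integral>v. ?f p v \<partial>?M)"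
  proof (rule integral_suminf[OF int])
    have s: "summable (\<lambda>p. norm (?f p v))" for v
      by (rule summable_comparison_test'[OF summable_phi_coeff, of 0]) (use fb in \<open>simp del: power_Suc\<close>)
    then show "AE v in ?M. summable (\<lambda>p. norm (?f p v))" by simp
    show "summable (\<lambda>p. \<integral>v. norm (?f p v) \<partial>?M)"
    proof (rule summable_comparison_test'[OF summable_phi_coeff, of 0])
      fix p
      have "(\<integral>v. norm (?f p v) \<partial>?M) \<le> (\<integral>v. phi_coeff p \<partial>?M)"
        by (intro integral_mono integrable_norm int) (use fb in \<open>auto simp: abs_le_iff simp del: power_Suc intro: order_trans\<close>)
      then show "norm (\<integral>v. norm (?f p v) \<partial>?M) \<le> phi_coeff p"
        by (simp add: M.prob_space)
    qed
  qed
  also have "\<dots> = (\<Sum>p. phi_coeff p * (z\<^sup>2) ^ Suc p * vmom p ^ j)"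
  proof (intro arg_cong[where f = suminf] ext)
    fix p
    have "(\<integral>v. (\<Prod>i<j. ((tanh (v i))\<^sup>2) ^ Suc p) \<partial>?M) = (\<Prod>i<j. \<integral>v. ((tanh v)\<^sup>2) ^ Suc p \<partial>V)"
    proof (rule pp.product_integral_prod)
      show "integrable V (\<lambda>v. ((tanh v)\<^sup>2) ^ Suc p)"
        by (rule integrable_const_bound[where B = 1]) (use b in \<open>auto simp: abs_le_iff simp del: power_Suc\<close>, measurable)
    qed simp
    then show "(\<integral>v. ?f p v \<partial>?M) = phi_coeff p * (z\<^sup>2) ^ Suc p * vmom p ^ j"
      by (simp add: vmom_def del: power_Suc)
  qed
  also have "\<dots> = phi_mom vmom j z"
    unfolding phi_mom_def even_series_def by (simp only: mult_ac)
  finally show ?thesis .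
qed

sublocale mom: moments vmom by unfold_locales (rule vmom_bounds)+

lemma nn_integral_prod_law_Suc:
  assumes [measurable]: "g \<in> borel_measurable borel"
  shows "(\<integral>\<^sup>+t. g t \<partial>prod_law (Suc j)) = (\<integral>\<^sup>+t. \<integral>\<^sup>+v. g (t * tanh v) \<partial>V \<partial>prod_law j)"
proof -
  have "(\<integral>\<^sup>+t. g t \<partial>prod_law (Suc j)) = (\<integral>\<^sup>+v. g (\<Prod>i<Suc j. tanh (v i)) \<partial>PiM {..<Suc j} (\<lambda>_. V))"
    unfolding prod_law_def by (rule nn_integral_distr) measurable
  also have "\<dots> = (\<integral>\<^sup>+v. g (\<Prod>i<Suc j. tanh (v i)) \<partial>PiM (insert j {..<j}) (\<lambda>_. V))"
    by (simp only: lessThan_Suc)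
  also have "\<dots> = (\<integral>\<^sup>+x. \<integral>\<^sup>+v. g (\<Prod>i<Suc j. tanh ((x(j := v)) i)) \<partial>V \<partial>PiM {..<j} (\<lambda>_. V))"
  proof (rule pp.product_nn_integral_insert)
    show "(\<lambda>v. g (\<Prod>i<Suc j. tanh (v i))) \<in> borel_measurable (PiM (insert j {..<j}) (\<lambda>_. V))"
      unfolding lessThan_Suc[symmetric] by measurable
  qed auto
  also have "\<dots> = (\<integral>\<^sup>+x. \<integral>\<^sup>+v. g ((\<Prod>i<j. tanh (x i)) * tanh v) \<partial>V \<partial>PiM {..<j} (\<lambda>_. V))"
    by simp
  also have "\<dots> = (\<integral>\<^sup>+t. \<integral>\<^sup>+v. g (t * tanh v) \<partial>V \<partial>prod_law j)"
    unfolding prod_law_def by (subst nn_integral_distr) measurable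
  finally show ?thesis .
qed

text \<open>Symmetry passes to products because
  \<open>2 (1 - s t) = (1 + s) (1 - t) + (1 - s) (1 + t)\<close>.\<close>
lemma noise_sym_prod_law: "noise_sym (prod_law j)"
proof (induction j)
  case 0
  have [simp]: "prod_law 0 = distr (PiM {} (\<lambda>_::nat. V)) borel (\<lambda>v. 1)" by (simp add: prod_law_def)
  show ?case by (auto simp: noise_sym_def nn_integral_distr)
next
  case (Suc j)
  let ?\<rho> = "prod_law j"
  interpret \<rho>: prob_space ?\<rho> by (rule prob_space_prod_law)
  interpret pr: pair_sigma_finite ?\<rho> V by unfold_locales
  have ae: "AE t in ?\<rho>. \<bar>t\<bar> \<le> 1" using noise_law_prod by (simp add: noise_law_def)
  have split: "ennreal (1 - t * tanh v) = ennreal (1 / 2) * (ennreal (1 + t) * ennreal (1 - tanh v) + ennreal (1 - t) * ennreal (1 + tanh v))"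
    if "\<bar>t\<bar> \<le> 1" for t v :: real
  proof -
    have "0 \<le> 1 + t" "0 \<le> 1 - t" "0 \<le> 1 + tanh v" "0 \<le> 1 - tanh v"
      using that tanh_real_bounds[of v] by auto
    note nn = this
    have pos: "0 \<le> (1 + t) * (1 - tanh v)" "0 \<le> (1 - t) * (1 + tanh v)"
      using nn by simp_all
    have "1 - t * tanh v = 1 / 2 * ((1 + t) * (1 - tanh v) + (1 - t) * (1 + tanh v))"
      by (simp add: algebra_simps)
    also have "ennreal \<dots> = ennreal (1 / 2) * ennreal ((1 + t) * (1 - tanh v) + (1 - t) * (1 + tanh v))"
      by (rule ennreal_mult) (use add_nonneg_nonneg[OF pos] in auto)
    also have "ennreal ((1 + t) * (1 - tanh v) + (1 - t) * (1 + tanh v))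
       = ennreal ((1 + t) * (1 - tanh v)) + ennreal ((1 - t) * (1 + tanh v))"
      using pos by (rule ennreal_plus)
    also have "ennreal ((1 + t) * (1 - tanh v)) = ennreal (1 + t) * ennreal (1 - tanh v)"
      using nn by (intro ennreal_mult)
    also have "ennreal ((1 - t) * (1 + tanh v)) = ennreal (1 - t) * ennreal (1 + tanh v)"
      using nn by (intro ennreal_mult)
    finally show ?thesis .
  qed
  show ?case unfolding noise_sym_def
  proof (intro allI impI)
    fix h :: "real \<Rightarrow> ennreal" assume h[measurable]: "h \<in> borel_measurable borel"
    have rep: "(\<integral>\<^sup>+t. g t * ennreal (1 - t) \<partial>prod_law (Suc j))
      = ennreal (1 / 2) * ((\<integral>\<^sup>+t. ennreal (1 + t) * (\<integral>\<^sup>+v. g (t * tanh v) * ennreal (1 - tanh v) \<partial>V) \<partial>?\<rho>)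
        + (\<integral>\<^sup>+v. ennreal (1 + tanh v) * (\<integral>\<^sup>+t. g (t * tanh v) * ennreal (1 - t) \<partial>?\<rho>) \<partial>V))"
      if g[measurable]: "g \<in> borel_measurable borel" for g
    proof -
      have "(\<integral>\<^sup>+t. g t * ennreal (1 - t) \<partial>prod_law (Suc j))
         = (\<integral>\<^sup>+t. \<integral>\<^sup>+v. g (t * tanh v) * ennreal (1 - t * tanh v) \<partial>V \<partial>?\<rho>)"
        by (rule nn_integral_prod_law_Suc) measurable
      also have "\<dots> = (\<integral>\<^sup>+t. \<integral>\<^sup>+v. ennreal (1 / 2) * (ennreal (1 + t) * (g (t * tanh v) * ennreal (1 - tanh v))
           + ennreal (1 + tanh v) * (g (t * tanh v) * ennreal (1 - t))) \<partial>V \<partial>?\<rho>)"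
      proof (rule nn_integral_cong_AE)
        show "AE t in ?\<rho>. (\<integral>\<^sup>+v. g (t * tanh v) * ennreal (1 - t * tanh v) \<partial>V)
          = (\<integral>\<^sup>+v. ennreal (1 / 2) * (ennreal (1 + t) * (g (t * tanh v) * ennreal (1 - tanh v))
           + ennreal (1 + tanh v) * (g (t * tanh v) * ennreal (1 - t))) \<partial>V)"
          using ae
        proof eventually_elim
          fix t :: real assume "\<bar>t\<bar> \<le> 1"
          then show "(\<integral>\<^sup>+v. g (t * tanh v) * ennreal (1 - t * tanh v) \<partial>V)
          = (\<integral>\<^sup>+v. ennreal (1 / 2) * (ennreal (1 + t) * (g (t * tanh v) * ennreal (1 - tanh v))
           + ennreal (1 + tanh v) * (g (t * tanh v) * ennreal (1 - t))) \<partial>V)"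
            by (intro nn_integral_cong) (simp only: split, simp only: distrib_left mult_ac)
        qed
      qed
      also have "\<dots> = ennreal (1 / 2) * ((\<integral>\<^sup>+t. \<integral>\<^sup>+v. ennreal (1 + t) * (g (t * tanh v) * ennreal (1 - tanh v)) \<partial>V \<partial>?\<rho>)
        + (\<integral>\<^sup>+t. \<integral>\<^sup>+v. ennreal (1 + tanh v) * (g (t * tanh v) * ennreal (1 - t)) \<partial>V \<partial>?\<rho>))"
        by (simp add: nn_integral_cmult nn_integral_add)
      also have "(\<integral>\<^sup>+t. \<integral>\<^sup>+v. ennreal (1 + tanh v) * (g (t * tanh v) * ennreal (1 - t)) \<partial>V \<partial>?\<rho>)
        = (\<integral>\<^sup>+v. \<integral>\<^sup>+t. ennreal (1 + tanh v) * (g (t * tanh v) * ennreal (1 - t)) \<partial>?\<rho> \<partial>V)"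
        by (rule pr.Fubini'[symmetric]) measurable
      finally show ?thesis by (simp add: nn_integral_cmult)
    qed
    have 1: "(\<integral>\<^sup>+v. h (- (t * tanh v)) * ennreal (1 - tanh v) \<partial>V) = (\<integral>\<^sup>+v. h (t * tanh v) * ennreal (1 - tanh v) \<partial>V)" for t
      using sym_V[of "\<lambda>s. h (t * s)"] by simp
    have 2: "(\<integral>\<^sup>+t. h (- (t * tanh v)) * ennreal (1 - t) \<partial>?\<rho>) = (\<integral>\<^sup>+t. h (t * tanh v) * ennreal (1 - t) \<partial>?\<rho>)" for v
      using noise_symD[OF Suc, of "\<lambda>s. h (s * tanh v)"] by simp
    show "(\<integral>\<^sup>+t. h (- t) * ennreal (1 - t) \<partial>prod_law (Suc j)) = (\<integral>\<^sup>+t. h t * ennreal (1 - t) \<partial>prod_law (Suc j))"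
      using rep[of "\<lambda>t. h (- t)"] rep[of h] by (simp add: 1 2)
  qed
qed

lemma strict_noise_prod_law: "strict_noise (prod_law j)"
  unfolding strict_noise_def using noise_law_prod noise_sym_prod_law AE_prod_law_gt by simp

end

text \<open>Symmetry of the law of 2V reads f(v) = e^(2v) f(-v), and e^(2v) is the ratio of 1 + tanh
  v to 1 - tanh v; the substitution of -v for v then yields the reflected integral.\<close>

lemma sym_law_V_law:
  assumes "sym_density f" shows "sym_law (V_law f)"
proof -
  have [measurable]: "f \<in> borel_measurable borel" and f0: "0 \<le> f x" and f1: "(\<integral>\<^sup>+ x. ennreal (f x) \<partial>lborel) = 1"
    and fs: "f (x / 2) / 2 = exp x * (f (- x / 2) / 2)" for x
    using assms by (auto simp: sym_density_def)
  have fs': "f (- v) * (1 + tanh v) = f v * (1 - tanh v)" for v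
  proof -
    have c: "exp v + exp (- v) \<noteq> 0" using exp_gt_zero[of v] exp_gt_zero[of "- v"] by linarith
    have "f v = exp (2 * v) * f (- v)" using fs[of "2 * v"] by simp
    also have "exp (2 * v) = exp v * exp v" by (simp only: mult_2 exp_add)
    finally have e: "f v = exp v * exp v * f (- v)" .
    have p: "1 + tanh v = 2 * exp v / (exp v + exp (- v))" "1 - tanh v = 2 * exp (- v) / (exp v + exp (- v))"
      using c by (auto simp: tanh_def sinh_def cosh_def field_simps)
    have "exp v * exp v * f (- v) * (2 * exp (- v)) = f (- v) * (2 * exp v) * (exp v * exp (- v))"
      by (simp only: mult_ac)
    moreover have "f v * (1 - tanh v) = exp v * exp v * f (- v) * (2 * exp (- v)) / (exp v + exp (- v))"
      unfolding p by (subst e) simp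
    moreover have "f (- v) * (1 + tanh v) = f (- v) * (2 * exp v) / (exp v + exp (- v))"
      unfolding p by simp
    moreover have "exp v * exp (- v) = 1" by (simp add: exp_minus)
    ultimately show ?thesis by (simp only: mult_1_right)
  qed
  show ?thesis
  proof (rule sym_law.intro)
    show "prob_space (V_law f)"
      by standard (simp add: V_law_def emeasure_density f1)
    show "sym_law_axioms (V_law f)"
    proof
      fix h :: "real \<Rightarrow> ennreal" assume [measurable]: "h \<in> borel_measurable borel"
      have "(\<integral>\<^sup>+v. h (- tanh v) * ennreal (1 - tanh v) \<partial>V_law f)
         = (\<integral>\<^sup>+v. ennreal (f v) * (h (- tanh v) * ennreal (1 - tanh v)) \<partial>lborel)"
        unfolding V_law_def by (subst nn_integral_density) measurable
      also have "\<dots> = (\<integral>\<^sup>+v. ennreal (f (- v)) * (h (tanh v) * ennreal (1 + tanh v)) \<partial>lborel)"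
      proof -
        have m: "(\<lambda>v. ennreal (f v) * (h (- tanh v) * ennreal (1 - tanh v))) \<in> borel_measurable borel"
          by measurable
        show ?thesis using nn_integral_real_affine[OF m, of "-1" 0] by simp
      qed
      also have "\<dots> = (\<integral>\<^sup>+v. ennreal (f v) * (h (tanh v) * ennreal (1 - tanh v)) \<partial>lborel)"
      proof (rule nn_integral_cong)
        fix v :: real
        have "ennreal (f (- v)) * ennreal (1 + tanh v) = ennreal (f v) * ennreal (1 - tanh v)"
          using f0 tanh_real_bounds[of v] fs'[of v] by (simp add: ennreal_mult[symmetric])
        then show "ennreal (f (- v)) * (h (tanh v) * ennreal (1 + tanh v)) = ennreal (f v) * (h (tanh v) * ennreal (1 - tanh v))"
          by (subst (1 2) mult.left_commute) simp
      qed
      also have "\<dots> = (\<integral>\<^sup>+v. h (tanh v) * ennreal (1 - tanh v) \<partial>V_law f)"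
        unfolding V_law_def by (subst nn_integral_density) measurable
      finally show "(\<integral>\<^sup>+v. h (- tanh v) * ennreal (1 - tanh v) \<partial>V_law f) = (\<integral>\<^sup>+v. h (tanh v) * ennreal (1 - tanh v) \<partial>V_law f)" .
    qed (simp add: V_law_def)
  qed
qed

section \<open>The law of tanh U as a mixture over edge-perspective degrees\<close>

context sym_law begin

text \<open>At k = 0 the natural difference \<open>k - 1\<close> is 0, but degree 0 has edge
  probability 0.\<close>

definition mix :: "nat pmf \<Rightarrow> real measure" where
  "mix P = bind (edge_law P) (\<lambda>k. prod_law (k - 1))"

definition edge_prob :: "nat pmf \<Rightarrow> nat \<Rightarrow> real" where
  "edge_prob P k = real k * pmf P k / Lp1 P"

lemma prod_law_kernel: "(\<lambda>k. prod_law (k - 1)) \<in> measurable (edge_law P) (subprob_algebra borel)"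
proof -
  have "(\<lambda>k. prod_law (k - 1)) \<in> measurable (count_space UNIV) (subprob_algebra borel)"
    using prob_space_prod_law prob_space_imp_subprob_space sets_prod_law
    by (auto simp: space_subprob_algebra)
  moreover have "measurable (edge_law P) (subprob_algebra borel) = measurable (count_space UNIV) (subprob_algebra borel :: real measure measure)"
    by (rule measurable_cong_sets) (simp_all add: edge_law_def)
  ultimately show ?thesis by simp
qed

lemma sets_mix: "sets (mix P) = sets borel"
  unfolding mix_def using prod_law_kernel by (intro sets_bind[OF sets_kernel]) (auto simp: edge_law_def)

lemma nn_integral_mix:
  assumes P: "finite (set_pmf P)" and g[measurable]: "g \<in> borel_measurable borel"
  shows "(\<integral>\<^sup>+t. g t \<partial>mix P) = (\<Sum>k\<in>set_pmf P. ennreal (edge_prob P k) * (\<integral>\<^sup>+t. g t \<partial>prod_law (k - 1)))"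
proof -
  have "(\<integral>\<^sup>+t. g t \<partial>mix P) = (\<integral>\<^sup>+k. \<integral>\<^sup>+t. g t \<partial>prod_law (k - 1) \<partial>edge_law P)"
    unfolding mix_def by (rule nn_integral_bind[OF g prod_law_kernel])
  also have "\<dots> = (\<integral>\<^sup>+k. ennreal (edge_prob P k) * (\<integral>\<^sup>+t. g t \<partial>prod_law (k - 1)) \<partial>count_space UNIV)"
    unfolding edge_law_def edge_prob_def by (subst nn_integral_density) auto
  also have "\<dots> = (\<Sum>k\<in>set_pmf P. ennreal (edge_prob P k) * (\<integral>\<^sup>+t. g t \<partial>prod_law (k - 1)))"
    using P by (intro nn_integral_count_space') (auto simp: edge_prob_def set_pmf_iff)
  finally show ?thesis .
qed

lemma edge_prob_nonneg: "0 < Lp1 P \<Longrightarrow> 0 \<le> edge_prob P k"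
  by (simp add: edge_prob_def)

lemma edge_prob_sum: "0 < Lp1 P \<Longrightarrow> (\<Sum>k\<in>set_pmf P. edge_prob P k) = 1"
  by (simp add: edge_prob_def sum_divide_distrib[symmetric] Lp1_def)

lemma integral_mix:
  assumes P: "finite (set_pmf P)" "0 < Lp1 P" and h: "h \<in> borel_measurable borel"
    and pos: "\<And>j. AE t in prod_law j. 0 \<le> h t" and int: "\<And>j. integrable (prod_law j) h"
  shows "(\<integral>\<^sup>+t. ennreal (h t) \<partial>mix P) = ennreal (\<Sum>k\<in>set_pmf P. edge_prob P k * (\<integral>t. h t \<partial>prod_law (k - 1)))"
proof -
  have "(\<integral>\<^sup>+t. ennreal (h t) \<partial>prod_law j) = ennreal (\<integral>t. h t \<partial>prod_law j)" for j
    using int pos by (rule nn_integral_eq_integral)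
  moreover have "0 \<le> (\<integral>t. h t \<partial>prod_law j)" for j
    using pos by (rule integral_nonneg_AE)
  ultimately show ?thesis
    using edge_prob_nonneg[OF P(2)] h
    by (simp add: nn_integral_mix[OF P(1)] ennreal_mult[symmetric] sum_ennreal)
qed

lemma AE_mix:
  assumes P: "finite (set_pmf P)" and [measurable]: "Measurable.pred borel Q"
    and Q: "\<And>j. AE t in prod_law j. Q t"
  shows "AE t in mix P. Q t"
proof -
  have m: "(\<lambda>t. indicator {t. \<not> Q t} t :: ennreal) \<in> borel_measurable borel" by measurable
  have z: "(\<integral>\<^sup>+t. indicator {t. \<not> Q t} t \<partial>prod_law j) = 0" for j
    using Q[of j] by (subst nn_integral_0_iff_AE) (auto cong: measurable_cong_sets simp: sets_prod_law elim!: eventually_mono)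
  then have "(\<integral>\<^sup>+t. indicator {t. \<not> Q t} t \<partial>mix P) = 0"
    by (simp add: nn_integral_mix[OF P m])
  moreover have "(\<lambda>t. indicator {t. \<not> Q t} t :: ennreal) \<in> borel_measurable (mix P)"
    using m by (simp cong: measurable_cong_sets add: sets_mix)
  ultimately have "AE t in mix P. indicator {t. \<not> Q t} t = (0 :: ennreal)"
    by (simp add: nn_integral_0_iff_AE)
  then show ?thesis by eventually_elim (auto simp: indicator_def split: if_splits)
qed

lemma strict_noise_mix:
  assumes P: "finite (set_pmf P)" "0 < Lp1 P"
  shows "strict_noise (mix P)"
proof -
  have one: "(\<integral>\<^sup>+t. 1 \<partial>mix P) = 1"
  proof -
    have "(\<integral>\<^sup>+t. 1 \<partial>prod_law j) = 1" for j
      using prob_space.emeasure_space_1[OF prob_space_prod_law] by simp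
    then have "(\<integral>\<^sup>+t. 1 \<partial>mix P) = (\<Sum>k\<in>set_pmf P. ennreal (edge_prob P k))"
      by (simp add: nn_integral_mix[OF P(1)] del: nn_integral_const)
    then show ?thesis using edge_prob_nonneg[OF P(2)] edge_prob_sum[OF P(2)] by (simp add: sum_ennreal)
  qed
  have "prob_space (mix P)" by standard (use one in simp)
  moreover have "AE t in mix P. \<bar>t\<bar> \<le> 1" "AE t in mix P. -1 < t"
    using noise_law_prod AE_prod_law_gt by (auto intro!: AE_mix P(1) simp: noise_law_def)
  moreover have "noise_sym (mix P)"
    unfolding noise_sym_def
  proof (intro allI impI)
    fix h :: "real \<Rightarrow> ennreal" assume [measurable]: "h \<in> borel_measurable borel"
    have m: "(\<lambda>t. h (- t) * ennreal (1 - t)) \<in> borel_measurable borel" "(\<lambda>t. h t * ennreal (1 - t)) \<in> borel_measurable borel"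
      by measurable
    show "(\<integral>\<^sup>+t. h (- t) * ennreal (1 - t) \<partial>mix P) = (\<integral>\<^sup>+t. h t * ennreal (1 - t) \<partial>mix P)"
      unfolding nn_integral_mix[OF P(1) m(1)] nn_integral_mix[OF P(1) m(2)]
      by (simp add: noise_symD[OF noise_sym_prod_law])
  qed
  ultimately show ?thesis by (simp add: strict_noise_def noise_law_def sets_mix)
qed

end

section \<open>Logarithmic moments under a symmetric noise law\<close>

locale strict = 
  fixes \<rho> :: "real measure"
  assumes strict: "strict_noise \<rho>"
begin

lemma noise: "noise_law \<rho>" and sym: "noise_sym \<rho>" and gt: "AE t in \<rho>. -1 < t"
  using strict by (auto simp: strict_noise_def)

sublocale prob_space \<rho> using noise by (simp add: noise_law_def)

lemma prob_\<rho>: "prob_space \<rho>" by (rule prob_space_axioms)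

lemma sets_\<rho>[measurable_cong]: "sets \<rho> = sets borel" and le1: "AE t in \<rho>. \<bar>t\<bar> \<le> 1"
  using noise by (auto simp: noise_law_def)

text \<open>Split h into the shares (1 + t) / 2 and (1 - t) / 2 and reflect the second by
  \<open>noise_sym\<close>. What results averages over the sign of t with the weights of a noisy
  outcome.\<close>

lemma nn_integral_symmetrize:
  assumes [measurable]: "h \<in> borel_measurable borel"
  shows "(\<integral>\<^sup>+t. h t \<partial>\<rho>) = (\<integral>\<^sup>+t. ennreal ((1 + t) / 2) * h t + ennreal ((1 - t) / 2) * h (- t) \<partial>\<rho>)"
proof -
  have e: "ennreal ((1 - t) / 2) = ennreal (1 - t) * ennreal (1 / 2)" for t :: real
    by (subst ennreal_mult''[symmetric]) auto
  have "(\<integral>\<^sup>+t. h t \<partial>\<rho>) = (\<integral>\<^sup>+t. ennreal ((1 + t) / 2) * h t + ennreal ((1 - t) / 2) * h t \<partial>\<rho>)"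
  proof (rule nn_integral_cong_AE)
    show "AE t in \<rho>. h t = ennreal ((1 + t) / 2) * h t + ennreal ((1 - t) / 2) * h t"
      using le1
    proof eventually_elim
      fix t :: real assume "\<bar>t\<bar> \<le> 1"
      then have "ennreal ((1 + t) / 2) + ennreal ((1 - t) / 2) = ennreal ((1 + t) / 2 + (1 - t) / 2)"
        by (intro ennreal_plus[symmetric]) auto
      also have "(1 + t) / 2 + (1 - t) / 2 = 1" by (simp add: field_simps)
      finally show "h t = ennreal ((1 + t) / 2) * h t + ennreal ((1 - t) / 2) * h t"
        by (simp add: distrib_right[symmetric])
    qed
  qed
  also have "\<dots> = (\<integral>\<^sup>+t. ennreal ((1 + t) / 2) * h t \<partial>\<rho>) + ennreal (1 / 2) * (\<integral>\<^sup>+t. h t * ennreal (1 - t) \<partial>\<rho>)"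
    unfolding e by (subst nn_integral_add) (measurable, simp add: nn_integral_cmult[symmetric] mult_ac)
  also have "(\<integral>\<^sup>+t. h t * ennreal (1 - t) \<partial>\<rho>) = (\<integral>\<^sup>+t. h (- t) * ennreal (1 - t) \<partial>\<rho>)"
    using noise_symD[OF sym assms] by simp
  also have "(\<integral>\<^sup>+t. ennreal ((1 + t) / 2) * h t \<partial>\<rho>) + ennreal (1 / 2) * (\<integral>\<^sup>+t. h (- t) * ennreal (1 - t) \<partial>\<rho>)
    = (\<integral>\<^sup>+t. ennreal ((1 + t) / 2) * h t + ennreal ((1 - t) / 2) * h (- t) \<partial>\<rho>)"
    unfolding e by (subst nn_integral_add) (measurable, simp add: nn_integral_cmult[symmetric] mult_ac)
  finally show ?thesis .
qed

lemma phi_integrable: "integrable \<rho> phi"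
  by (rule integrable_const_bound[where B = "ln 2"])
     (use le1 in \<open>eventually_elim, use phi_bounds in auto\<close>, measurable)

text \<open>After symmetrisation the logarithms at t and -t combine with their weights into
  \<open>phi t\<close>. Subtracting from ln 2 makes the integrand nonnegative almost everywhere, so
  integrability need not be known beforehand.\<close>

lemma nn_integral_ln:
  "(\<integral>\<^sup>+t. ennreal (ln 2 - ln (1 + t)) \<partial>\<rho>) = ennreal (ln 2 - (\<integral>t. phi t \<partial>\<rho>))"
proof -
  have "(\<integral>\<^sup>+t. ennreal (ln 2 - ln (1 + t)) \<partial>\<rho>)
     = (\<integral>\<^sup>+t. ennreal ((1 + t) / 2) * ennreal (ln 2 - ln (1 + t)) + ennreal ((1 - t) / 2) * ennreal (ln 2 - ln (1 + - t)) \<partial>\<rho>)"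
    by (rule nn_integral_symmetrize) measurable
  also have "\<dots> = (\<integral>\<^sup>+t. ennreal (ln 2 - phi t) \<partial>\<rho>)"
  proof (rule nn_integral_cong_AE)
    show "AE t in \<rho>. ennreal ((1 + t) / 2) * ennreal (ln 2 - ln (1 + t)) + ennreal ((1 - t) / 2) * ennreal (ln 2 - ln (1 + - t))
       = ennreal (ln 2 - phi t)"
      using le1 gt
    proof eventually_elim
      fix t :: real assume t: "\<bar>t\<bar> \<le> 1" "-1 < t"
      have p: "0 \<le> ln 2 - ln (1 + s)" if "\<bar>s\<bar> \<le> 1" for s :: real
      proof (cases "s = -1")
        case False
        then show ?thesis using that by (simp add: ln_mono)
      qed simp
      have p1: "0 \<le> ln 2 - ln (1 + t)" "0 \<le> ln 2 - ln (1 + - t)" "0 \<le> (1 + t) / 2" "0 \<le> (1 - t) / 2"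
        using p[of t] p[of "- t"] t by auto
      have "ennreal ((1 + t) / 2) * ennreal (ln 2 - ln (1 + t)) + ennreal ((1 - t) / 2) * ennreal (ln 2 - ln (1 + - t))
        = ennreal ((1 + t) / 2 * (ln 2 - ln (1 + t)) + (1 - t) / 2 * (ln 2 - ln (1 + - t)))"
        using p1 by (subst ennreal_plus) (auto simp: ennreal_mult[symmetric])
      also have "(1 + t) / 2 * (ln 2 - ln (1 + t)) + (1 - t) / 2 * (ln 2 - ln (1 + - t)) = ln 2 - phi t"
        by (simp add: phi_def field_simps)
      finally show "ennreal ((1 + t) / 2) * ennreal (ln 2 - ln (1 + t)) + ennreal ((1 - t) / 2) * ennreal (ln 2 - ln (1 + - t))
         = ennreal (ln 2 - phi t)" .
    qed
  qed
  also have "\<dots> = ennreal (\<integral>t. ln 2 - phi t \<partial>\<rho>)"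
  proof (rule nn_integral_eq_integral)
    show "AE t in \<rho>. 0 \<le> ln 2 - phi t" using le1 by eventually_elim (use phi_bounds in auto)
  qed (use phi_integrable in auto)
  also have "(\<integral>t. ln 2 - phi t \<partial>\<rho>) = ln 2 - (\<integral>t. phi t \<partial>\<rho>)"
    using phi_integrable by (simp add: prob_space)
  finally show ?thesis .
qed

lemma ln_nonneg_AE: "AE t in \<rho>. 0 \<le> ln 2 - ln (1 + t)"
  using le1 gt by eventually_elim (simp add: ln_mono)

lemma phi_mean_le: "(\<integral>t. phi t \<partial>\<rho>) \<le> ln 2"
proof -
  have "(\<integral>t. phi t \<partial>\<rho>) \<le> (\<integral>t. ln 2 \<partial>\<rho>)"
    using le1 phi_integrable by (intro integral_mono_AE) (auto elim!: eventually_mono intro: phi_bounds)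
  then show ?thesis by (simp add: prob_space)
qed

lemma ln_integrable: "integrable \<rho> (\<lambda>t. ln (1 + t))"
  and ln_integral: "(\<integral>t. ln (1 + t) \<partial>\<rho>) = (\<integral>t. phi t \<partial>\<rho>)"
proof -
  have i: "integrable \<rho> (\<lambda>t. ln 2 - ln (1 + t))"
    by (rule integrableI_nonneg) (use ln_nonneg_AE nn_integral_ln in auto)
  from Bochner_Integration.integrable_diff[OF integrable_const[of "ln 2"] i]
  show 1: "integrable \<rho> (\<lambda>t. ln (1 + t))" by simp
  have "(\<integral>t. ln 2 - ln (1 + t) \<partial>\<rho>) = enn2real (ennreal (ln 2 - (\<integral>t. phi t \<partial>\<rho>)))"
    unfolding nn_integral_ln[symmetric] by (rule integral_eq_nn_integral) (use ln_nonneg_AE in auto)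
  also have "\<dots> = ln 2 - (\<integral>t. phi t \<partial>\<rho>)" using phi_mean_le by simp
  finally show "(\<integral>t. ln (1 + t) \<partial>\<rho>) = (\<integral>t. phi t \<partial>\<rho>)" using 1 by (simp add: prob_space)
qed

text \<open>The factor by which an observation of signed strength t changes the likelihood ratio of
  bit 1 to bit 0.\<close>

definition lr :: "real \<Rightarrow> real" where "lr t = (1 - t) / (1 + t)"

lemma lr_measurable[measurable]: "lr \<in> borel_measurable borel" unfolding lr_def by measurable

text \<open>\<open>bit_ent d r\<close> is the mean of \<open>ln (1 + r * (\<Prod>c<d. lr (t c)))\<close> over independent \<open>t c\<close>.\<close>
primrec bit_ent :: "nat \<Rightarrow> real \<Rightarrow> ennreal" where
  "bit_ent 0 r = ennreal (ln (1 + r))"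
| "bit_ent (Suc d) r = (\<integral>\<^sup>+t. bit_ent d (r * lr t) \<partial>\<rho>)"

lemma bit_ent_measurable[measurable]: "bit_ent d \<in> borel_measurable borel"
proof (induction d)
  case (Suc d)
  note [measurable] = Suc
  show ?case unfolding bit_ent.simps[abs_def] by measurable
qed (simp add: bit_ent.simps[abs_def])

lemma bit_ent_PiM:
  "bit_ent d r = (\<integral>\<^sup>+ts. ennreal (ln (1 + r * (\<Prod>c<d. lr (ts c)))) \<partial>PiM {..<d} (\<lambda>_. \<rho>))"
proof (induction d arbitrary: r)
  case 0
  then show ?case by (simp add: PiM_empty nn_integral_count_space_finite)
next
  case (Suc d)
  interpret pp: product_prob_space "\<lambda>_::nat. \<rho>" by unfold_locales
  have "bit_ent (Suc d) r = (\<integral>\<^sup>+t. \<integral>\<^sup>+ts. ennreal (ln (1 + r * lr t * (\<Prod>c<d. lr (ts c)))) \<partial>PiM {..<d} (\<lambda>_. \<rho>) \<partial>\<rho>)"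
    by (simp add: Suc)
  also have "\<dots> = (\<integral>\<^sup>+t. \<integral>\<^sup>+ts. ennreal (ln (1 + r * (\<Prod>c<Suc d. lr ((ts(d := t)) c)))) \<partial>PiM {..<d} (\<lambda>_. \<rho>) \<partial>\<rho>)"
    by (simp add: mult_ac)
  also have "\<dots> = (\<integral>\<^sup>+ts. ennreal (ln (1 + r * (\<Prod>c<Suc d. lr (ts c)))) \<partial>PiM (insert d {..<d}) (\<lambda>_. \<rho>))"
  proof (rule pp.product_nn_integral_insert_rev[symmetric])
    show "(\<lambda>ts. ennreal (ln (1 + r * (\<Prod>c<Suc d. lr (ts c))))) \<in> borel_measurable (PiM (insert d {..<d}) (\<lambda>_. \<rho>))"
      unfolding lessThan_Suc[symmetric] by measurable
  qed auto
  finally show ?case by (simp only: lessThan_Suc)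
qed

lemma lr_nonneg: "\<bar>t\<bar> \<le> 1 \<Longrightarrow> 0 \<le> lr t" by (auto simp: lr_def)

lemma bit_ent_le:
  assumes "0 \<le> r"
  shows "bit_ent d r \<le> ennreal (ln (1 + r) + real d * ln 2)"
  using assms
proof (induction d arbitrary: r)
  case (Suc d)
  have m: "0 \<le> (\<integral>t. phi t \<partial>\<rho>)"
    using le1 by (intro integral_nonneg_AE) (auto elim!: eventually_mono intro: phi_bounds)
  have nn: "0 \<le> ln (1 + r) + real d * ln 2" using Suc.prems by simp
  have "bit_ent (Suc d) r \<le> (\<integral>\<^sup>+t. ennreal (ln (1 + r) + real d * ln 2) + ennreal (ln 2 - ln (1 + t)) \<partial>\<rho>)"
    unfolding bit_ent.simps
  proof (rule nn_integral_mono_AE)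
    show "AE t in \<rho>. bit_ent d (r * lr t) \<le> ennreal (ln (1 + r) + real d * ln 2) + ennreal (ln 2 - ln (1 + t))"
      using le1 gt
    proof eventually_elim
      fix t :: real assume t: "\<bar>t\<bar> \<le> 1" "-1 < t"
      have "1 + r * lr t = (1 + t + r * (1 - t)) / (1 + t)" using t by (simp add: lr_def field_simps)
      \<comment> \<open>By bounding r (1 - t) by 2 r, each observation raises the logarithm by at
        most ln 2 - ln (1 + t), whose mean is at most ln 2.\<close>
      also have "\<dots> \<le> ((1 + r) * 2) / (1 + t)"
      proof (rule divide_right_mono)
        have "r * (1 - t) \<le> r * 2" using t Suc.prems by (intro mult_left_mono) auto
        then show "1 + t + r * (1 - t) \<le> (1 + r) * 2" using t by (simp add: algebra_simps)
      qed (use t in auto)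
      finally have "1 + r * lr t \<le> (1 + r) * (2 / (1 + t))" by simp
      moreover have "0 \<le> r * lr t" using lr_nonneg[OF t(1)] Suc.prems by simp
      ultimately have "ln (1 + r * lr t) \<le> ln ((1 + r) * (2 / (1 + t)))" by (intro ln_mono) auto
      also have "\<dots> = ln (1 + r) + (ln 2 - ln (1 + t))" using t Suc.prems by (subst ln_mult) (auto simp: ln_div)
      finally have l: "ln (1 + r * lr t) + real d * ln 2 \<le> (ln (1 + r) + real d * ln 2) + (ln 2 - ln (1 + t))" by simp
      have "0 \<le> ln 2 - ln (1 + t)" using t by (simp add: ln_mono)
      have "bit_ent d (r * lr t) \<le> ennreal (ln (1 + r * lr t) + real d * ln 2)"
        using Suc.IH[OF \<open>0 \<le> r * lr t\<close>] .
      also have "\<dots> \<le> ennreal ((ln (1 + r) + real d * ln 2) + (ln 2 - ln (1 + t)))"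
        by (rule ennreal_leI[OF l])
      also have "\<dots> = ennreal (ln (1 + r) + real d * ln 2) + ennreal (ln 2 - ln (1 + t))"
        using nn \<open>0 \<le> ln 2 - ln (1 + t)\<close> by (rule ennreal_plus)
      finally show "bit_ent d (r * lr t) \<le> ennreal (ln (1 + r) + real d * ln 2) + ennreal (ln 2 - ln (1 + t))" .
    qed
  qed
  also have "\<dots> = ennreal (ln (1 + r) + real d * ln 2) + ennreal (ln 2 - (\<integral>t. phi t \<partial>\<rho>))"
    by (subst nn_integral_add) (auto simp: nn_integral_ln emeasure_space_1)
  also have "\<dots> = ennreal (ln (1 + r) + real d * ln 2 + (ln 2 - (\<integral>t. phi t \<partial>\<rho>)))"
    using nn phi_mean_le by (intro ennreal_plus[symmetric]) auto
  also have "\<dots> \<le> ennreal (ln (1 + r) + real (Suc d) * ln 2)"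
    using m by (intro ennreal_leI) (simp add: algebra_simps)
  finally show ?case .
qed simp

lemma bit_ent_finite: "0 \<le> r \<Longrightarrow> bit_ent d r < \<infinity>"
  using bit_ent_le[of r d] by (auto intro: le_less_trans)

text \<open>The product of the factors \<open>1 + ts c\<close> is positive almost everywhere and is
  taken out of the logarithm. The cofactor gives \<open>bit_ent\<close>, and each extracted
  logarithm has the mean of \<open>phi\<close>.\<close>

lemma integral_ln_products:
  assumes r: "0 \<le> r"
  shows "(\<integral>ts. ln ((\<Prod>c<d. 1 + ts c) + r * (\<Prod>c<d. 1 - ts c)) \<partial>PiM {..<d} (\<lambda>_. \<rho>))
     = enn2real (bit_ent d r) + real d * (\<integral>t. phi t \<partial>\<rho>)"
proof -
  let ?M = "PiM {..<d} (\<lambda>_. \<rho>)"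
  interpret M: prob_space ?M by (intro prob_space_PiM) (rule prob_\<rho>)
  have ae: "AE ts in ?M. \<forall>c\<in>{..<d}. \<bar>ts c\<bar> \<le> 1 \<and> -1 < ts c"
    using le1 gt by (intro AE_finite_allI AE_PiM_component prob_\<rho>) (auto elim: eventually_elim2)
  have pr: "0 \<le> (\<Prod>c<d. lr (ts c))" if "\<forall>c\<in>{..<d}. \<bar>ts c\<bar> \<le> 1 \<and> -1 < ts c" for ts
    using that by (intro prod_nonneg) (auto intro: lr_nonneg)
  have comp: "integrable ?M (\<lambda>ts. ln (1 + ts c))" "(\<integral>ts. ln (1 + ts c) \<partial>?M) = (\<integral>t. phi t \<partial>\<rho>)" if "c < d" for c
  proof -
    have d: "distr ?M \<rho> (\<lambda>ts. ts c) = \<rho>" using that prob_\<rho> by (intro distr_PiM_component) auto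
    have mc: "(\<lambda>ts. ts c) \<in> measurable ?M \<rho>" using that by simp
    have ml: "(\<lambda>t. ln (1 + t)) \<in> borel_measurable \<rho>" by measurable
    show "integrable ?M (\<lambda>ts. ln (1 + ts c))"
      using integrable_distr_eq[OF mc ml] ln_integrable by (simp add: d)
    show "(\<integral>ts. ln (1 + ts c) \<partial>?M) = (\<integral>t. phi t \<partial>\<rho>)"
      using integral_distr[OF mc ml] ln_integral by (simp add: d)
  qed
  let ?h = "\<lambda>ts. ln (1 + r * (\<Prod>c<d. lr (ts c)))"
  have h0: "AE ts in ?M. 0 \<le> ?h ts" using ae by eventually_elim (use pr r in auto)
  have hm: "?h \<in> borel_measurable ?M" by measurable
  have hi: "integrable ?M ?h"
    by (rule integrableI_nonneg[OF hm h0]) (use bit_ent_finite[OF r, of d] in \<open>simp add: bit_ent_PiM\<close>)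
  have hv: "(\<integral>ts. ?h ts \<partial>?M) = enn2real (bit_ent d r)"
    unfolding bit_ent_PiM by (rule integral_eq_nn_integral[OF hm h0])
  have "(\<integral>ts. ln ((\<Prod>c<d. 1 + ts c) + r * (\<Prod>c<d. 1 - ts c)) \<partial>?M) = (\<integral>ts. ?h ts + (\<Sum>c<d. ln (1 + ts c)) \<partial>?M)"
  proof (rule integral_cong_AE)
    show "AE ts in ?M. ln ((\<Prod>c<d. 1 + ts c) + r * (\<Prod>c<d. 1 - ts c)) = ?h ts + (\<Sum>c<d. ln (1 + ts c))"
      using ae
    proof eventually_elim
      fix ts :: "nat \<Rightarrow> real" assume ts: "\<forall>c\<in>{..<d}. \<bar>ts c\<bar> \<le> 1 \<and> -1 < ts c"
      have p: "0 < (\<Prod>c<d. 1 + ts c)" 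
      proof (rule prod_pos)
        fix c assume "c \<in> {..<d}"
        then have "-1 < ts c" using ts by blast
        then show "0 < 1 + ts c" by linarith
      qed
      have "(\<Prod>c<d. 1 - ts c) = (\<Prod>c<d. lr (ts c) * (1 + ts c))"
      proof (rule prod.cong)
        fix c assume "c \<in> {..<d}"
        then have "-1 < ts c" using ts by blast
        then have "1 + ts c \<noteq> 0" by linarith
        then show "1 - ts c = lr (ts c) * (1 + ts c)" by (simp add: lr_def)
      qed simp
      then have "(\<Prod>c<d. 1 + ts c) + r * (\<Prod>c<d. 1 - ts c) = (1 + r * (\<Prod>c<d. lr (ts c))) * (\<Prod>c<d. 1 + ts c)"
        unfolding prod.distrib by (simp only: distrib_right mult_1_left mult.assoc)
      moreover have "ln \<dots> = ?h ts + ln (\<Prod>c<d. 1 + ts c)"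
        using p pr[OF ts] r by (intro ln_mult_pos) (auto intro: add_pos_nonneg)
      moreover have "ln (\<Prod>c<d. 1 + ts c) = (\<Sum>c<d. ln (1 + ts c))"
      proof (rule ln_prod)
        fix c assume "c \<in> {..<d}"
        then have "-1 < ts c" using ts by blast
        then show "1 + ts c \<noteq> 0" by linarith
      qed simp
      ultimately show "ln ((\<Prod>c<d. 1 + ts c) + r * (\<Prod>c<d. 1 - ts c)) = ?h ts + (\<Sum>c<d. ln (1 + ts c))" by simp
    qed
  qed measurable
  also have "\<dots> = (\<integral>ts. ?h ts \<partial>?M) + (\<Sum>c<d. \<integral>ts. ln (1 + ts c) \<partial>?M)"
    using hi comp by (subst Bochner_Integration.integral_add) (auto intro!: Bochner_Integration.integrable_sum)
  finally show ?thesis using comp hv by simp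
qed

end

section \<open>A single bit under repeated noisy observations\<close>

definition bit_spin :: "bool \<Rightarrow> real" where
  "bit_spin b = (if b then -1 else 1)"

lemma spin_bit_spin: "spin bit_spin" by (auto simp: spin_def bit_spin_def)

interpretation bit: weights "UNIV :: bool set" by unfold_locales simp

context strict begin

text \<open>Outcome b multiplies the two weights by (1 + b t) / 2 and (1 - b t) / 2, and their ratio
  by \<open>lr (b * t)\<close> or \<open>lr (- (b * t))\<close>. Summed over b, this is the
  symmetrised integrand of \<open>bit_ent (Suc d)\<close> for either value of the bit, so the sum
  over outcomes turns into an integral over t alone.\<close>

lemma bit_noisy_ent:
  assumes w: "nonneg w"
  shows "ennreal ((noisy bit_spin \<rho> ^^ d) bit.ent w)
    = ennreal (w False) * bit_ent d (w True / w False) + ennreal (w True) * bit_ent d (w False / w True)"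
    and "bit.good ((noisy bit_spin \<rho> ^^ d) bit.ent)"
    and "\<And>u. nonneg u \<Longrightarrow> 0 \<le> (noisy bit_spin \<rho> ^^ d) bit.ent u"
proof -
  have good: "bit.good ((noisy bit_spin \<rho> ^^ d) bit.ent)" for d
    by (induction d) (auto intro!: bit.good_noisy bit.good_ent noise spin_bit_spin)
  have pos: "0 \<le> (noisy bit_spin \<rho> ^^ d) bit.ent u" if "nonneg u" for d u
    using that
  proof (induction d arbitrary: u)
    case (Suc d)
    have "AE t in \<rho>. 0 \<le> obs bit_spin t ((noisy bit_spin \<rho> ^^ d) bit.ent) u"
      using le1 by eventually_elim
        (use Suc upd_nonneg[OF _ spin_bit_spin] in \<open>auto simp: obs_def intro!: add_nonneg_nonneg\<close>)
    then show ?case by (simp add: noisy_def[of _ _ "(noisy bit_spin \<rho> ^^ d) bit.ent"] integral_nonneg_AE)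
  qed (simp add: bit.ent_nonneg)
  show "bit.good ((noisy bit_spin \<rho> ^^ d) bit.ent)" by (rule good)
  show "\<And>u. nonneg u \<Longrightarrow> 0 \<le> (noisy bit_spin \<rho> ^^ d) bit.ent u" by (rule pos)
  show "ennreal ((noisy bit_spin \<rho> ^^ d) bit.ent w)
    = ennreal (w False) * bit_ent d (w True / w False) + ennreal (w True) * bit_ent d (w False / w True)"
    using w
  proof (induction d arbitrary: w)
    case 0
    have n: "0 \<le> w True" "0 \<le> w False" using 0 by (auto simp: nonneg_def)
    have e: "x * ln ((x + y) / x) = x * ln (1 + y / x)" for x y :: real
      by (cases "x = 0") (auto simp: add_divide_distrib)
    have s: "(\<Sum>x\<in>UNIV. f x) = f False + f True" for f :: "bool \<Rightarrow> real"
      by (simp add: UNIV_bool)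
    have "bit.ent w = w False * ln (1 + w True / w False) + w True * ln (1 + w False / w True)"
      unfolding bit.ent_def bit.tot_def s e[symmetric] by (simp add: add.commute)
    then show ?case using n by (simp add: ennreal_mult[symmetric] ennreal_plus[symmetric] del: ennreal_plus)
  next
    case (Suc d)
    let ?G = "(noisy bit_spin \<rho> ^^ d) bit.ent"
    have n: "0 \<le> w True" "0 \<le> w False" using Suc.prems by (auto simp: nonneg_def)
    define F where "F r t = bit_ent d (r * lr t)" for r t
    have [measurable]: "F r \<in> borel_measurable borel" for r unfolding F_def by measurable
    let ?S = "\<lambda>r t. ennreal ((1 + t) / 2) * F r t + ennreal ((1 - t) / 2) * F r (- t)"
    have upd: "ennreal (?G (upd bit_spin t b w)) = ennreal (w False) * (ennreal ((1 + b * t) / 2) * F (w True / w False) (b * t))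
        + ennreal (w True) * (ennreal ((1 - b * t) / 2) * F (w False / w True) (- (b * t)))"
      if t: "\<bar>t\<bar> \<le> 1" and b: "b = 1 \<or> b = -1" for t b
    proof -
      have nu: "nonneg (upd bit_spin t b w)" using b upd_nonneg[OF t spin_bit_spin Suc.prems] by auto
      have p: "0 \<le> (1 + b * t) / 2" "0 \<le> (1 - b * t) / 2" using t b by auto
      have q: "(w True * ((1 - b * t) / 2)) / (w False * ((1 + b * t) / 2)) = w True / w False * lr (b * t)"
        "(w False * ((1 + b * t) / 2)) / (w True * ((1 - b * t) / 2)) = w False / w True * lr (- (b * t))"
      proof -
        have "((1 - s) * (1 / 2)) / ((1 + s) * (1 / 2)) = (1 - s) / (1 + s)" for s :: real
          by (rule mult_divide_mult_cancel_right) simp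
        then have l: "lr s = ((1 - s) / 2) / ((1 + s) / 2)" for s
          by (simp only: lr_def times_divide_eq_right mult_1_right)
        show "(w True * ((1 - b * t) / 2)) / (w False * ((1 + b * t) / 2)) = w True / w False * lr (b * t)"
          unfolding l by (rule times_divide_times_eq[symmetric])
        have "lr (- (b * t)) = ((1 + b * t) / 2) / ((1 - b * t) / 2)" unfolding l by simp
        then show "(w False * ((1 + b * t) / 2)) / (w True * ((1 - b * t) / 2)) = w False / w True * lr (- (b * t))"
          by (simp only: times_divide_times_eq)
      qed
      have u: "upd bit_spin t b w False = w False * ((1 + b * t) / 2)"
        "upd bit_spin t b w True = w True * ((1 - b * t) / 2)"
        by (simp_all add: upd_def bit_spin_def)
      show ?thesis
        unfolding Suc.IH[OF nu] u q F_def
        by (simp only: ennreal_mult[OF n(2) p(1)] ennreal_mult[OF n(1) p(2)] mult.assoc)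
    qed
    have "ennreal ((noisy bit_spin \<rho> ^^ Suc d) bit.ent w) = (\<integral>\<^sup>+t. ennreal (obs bit_spin t ?G w) \<partial>\<rho>)"
    proof -
      have "AE t in \<rho>. 0 \<le> obs bit_spin t ?G w"
        using le1 by eventually_elim
          (use Suc.prems pos upd_nonneg[OF _ spin_bit_spin] in \<open>auto simp: obs_def intro!: add_nonneg_nonneg\<close>)
      then show ?thesis
        using bit.obs_integrable[OF good noise spin_bit_spin Suc.prems, of d]
        by (simp add: noisy_def[of _ _ ?G] nn_integral_eq_integral)
    qed
    also have "\<dots> = (\<integral>\<^sup>+t. ennreal (w False) * ?S (w True / w False) t + ennreal (w True) * ?S (w False / w True) t \<partial>\<rho>)"
    proof (rule nn_integral_cong_AE)
      show "AE t in \<rho>. ennreal (obs bit_spin t ?G w)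
         = ennreal (w False) * ?S (w True / w False) t + ennreal (w True) * ?S (w False / w True) t"
        using le1
      proof eventually_elim
        fix t :: real assume t: "\<bar>t\<bar> \<le> 1"
        have "ennreal (obs bit_spin t ?G w) = ennreal (?G (upd bit_spin t 1 w)) + ennreal (?G (upd bit_spin t (-1) w))"
          unfolding obs_def using upd_nonneg[OF t spin_bit_spin Suc.prems] by (intro ennreal_plus pos)
        then show "ennreal (obs bit_spin t ?G w)
         = ennreal (w False) * ?S (w True / w False) t + ennreal (w True) * ?S (w False / w True) t"
          unfolding upd[OF t, of 1, simplified] upd[OF t, of "-1", simplified]
          by (simp add: distrib_left add_ac)
      qed
    qed
    also have "\<dots> = ennreal (w False) * (\<integral>\<^sup>+t. ?S (w True / w False) t \<partial>\<rho>) + ennreal (w True) * (\<integral>\<^sup>+t. ?S (w False / w True) t \<partial>\<rho>)"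
      by (subst nn_integral_add) (measurable, simp add: nn_integral_cmult)
    also have "\<dots> = ennreal (w False) * bit_ent (Suc d) (w True / w False) + ennreal (w True) * bit_ent (Suc d) (w False / w True)"
      by (simp only: nn_integral_symmetrize[symmetric] \<open>\<And>r. F r \<in> borel_measurable borel\<close>) (simp add: F_def)
    finally show ?case .
  qed
qed

end

subsection \<open>Decoupling of the variable nodes\<close>

context weights begin

text \<open>Likelihood factors multiply, so at fixed noise levels the order is irrelevant; Fubini,
  justified by the bound C times the total weight, extends this to random levels.\<close>

lemma noisy_commute:
  assumes f: "good f" and l: "noise_law \<rho>" "noise_law \<rho>'" and s: "spin g" "spin h" and w: "nonneg w"
  shows "noisy g \<rho> (noisy h \<rho>' f) w = noisy h \<rho>' (noisy g \<rho> f) w"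
proof -
  interpret p: prob_space \<rho> using l by (simp add: noise_law_def)
  interpret p': prob_space \<rho>' using l by (simp add: noise_law_def)
  interpret pr: pair_sigma_finite \<rho> \<rho>' by unfold_locales
  have [measurable_cong]: "sets \<rho> = sets borel" "sets \<rho>' = sets borel" using l by (auto simp: noise_law_def)
  have ae: "AE t in \<rho>. \<bar>t\<bar> \<le> 1" "AE t in \<rho>'. \<bar>t\<bar> \<le> 1" using l by (auto simp: noise_law_def)
  define K where "K t t' = obs g t (obs h t' f) w" for t t'
  have K: "noisy g \<rho> (noisy h \<rho>' f) w = (\<integral>t. \<integral>t'. K t t' \<partial>\<rho>' \<partial>\<rho>)"
    if "noise_law \<rho>" "noise_law \<rho>'" "spin g" "spin h" "K = (\<lambda>t t'. obs g t (obs h t' f) w)"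
      "(\<lambda>t. \<integral>t'. K t t' \<partial>\<rho>') \<in> borel_measurable \<rho>" for g h \<rho> \<rho>' K
    unfolding noisy_def[of g]
  proof (rule integral_cong_AE)
    show "(\<lambda>t. obs g t (noisy h \<rho>' f) w) \<in> borel_measurable \<rho>"
      using that f by (intro obs_noise_measurable good_noisy) (auto simp: noise_law_def)
    have "AE t in \<rho>. \<bar>t\<bar> \<le> 1" using that by (auto simp: noise_law_def)
    then show "AE t in \<rho>. obs g t (noisy h \<rho>' f) w = (\<integral>t'. K t t' \<partial>\<rho>')"
    proof eventually_elim
      fix t :: real assume t: "\<bar>t\<bar> \<le> 1"
      show "obs g t (noisy h \<rho>' f) w = (\<integral>t'. K t t' \<partial>\<rho>')"
        unfolding obs_def[of g] noisy_def that(5)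
        using f that upd_nonneg[OF t that(3) w]
        by (intro Bochner_Integration.integral_add[symmetric] obs_integrable) auto
    qed
  qed (rule that)
  have Km: "(\<lambda>(t, t'). K t t') \<in> borel_measurable (\<rho> \<Otimes>\<^sub>M \<rho>')"
  proof -
    note [measurable] = good_measurable[OF f]
    have [measurable]: "(\<lambda>p. upd h (snd p) b (upd g (fst p) c w)) \<in> measurable (\<rho> \<Otimes>\<^sub>M \<rho>') wspace" for b c
      unfolding upd_def by (intro measurable_abs_UNIV) measurable
    have "(\<lambda>p. f (upd h (snd p) 1 (upd g (fst p) 1 w)) + f (upd h (snd p) (-1) (upd g (fst p) 1 w))
       + (f (upd h (snd p) 1 (upd g (fst p) (-1) w)) + f (upd h (snd p) (-1) (upd g (fst p) (-1) w)))) \<in> borel_measurable (\<rho> \<Otimes>\<^sub>M \<rho>')"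
      by measurable
    then show ?thesis by (simp add: K_def obs_def case_prod_beta)
  qed
  obtain C where C: "0 \<le> C" "\<And>w. nonneg w \<Longrightarrow> \<bar>f w\<bar> \<le> C * tot w" using goodE[OF f] by auto
  have Kb: "\<bar>K t t'\<bar> \<le> C * tot w" if "\<bar>t\<bar> \<le> 1" "\<bar>t'\<bar> \<le> 1" for t t'
    unfolding K_def using that s by (intro obs_bound w) (auto intro: C)
  have Ki: "integrable (\<rho> \<Otimes>\<^sub>M \<rho>') (\<lambda>(t, t'). K t t')"
  proof -
    interpret P: prob_space "\<rho> \<Otimes>\<^sub>M \<rho>'" by (rule prob_space_pair) unfold_locales
    have "AE x in \<rho> \<Otimes>\<^sub>M \<rho>'. \<bar>fst x\<bar> \<le> 1 \<and> \<bar>snd x\<bar> \<le> 1"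
    proof (rule pr.AE_pair_measure)
      show "{x \<in> space (\<rho> \<Otimes>\<^sub>M \<rho>'). \<bar>fst x\<bar> \<le> 1 \<and> \<bar>snd x\<bar> \<le> 1} \<in> sets (\<rho> \<Otimes>\<^sub>M \<rho>')" by measurable
      show "AE x in \<rho>. AE y in \<rho>'. \<bar>fst (x, y)\<bar> \<le> 1 \<and> \<bar>snd (x, y)\<bar> \<le> 1"
        using ae(1) by eventually_elim (use ae(2) in auto)
    qed
    then have "AE x in \<rho> \<Otimes>\<^sub>M \<rho>'. norm (case x of (t, t') \<Rightarrow> K t t') \<le> C * tot w"
      by eventually_elim (use Kb in auto)
    then show ?thesis by (rule P.integrable_const_bound[OF _ Km])
  qed
  have "noisy g \<rho> (noisy h \<rho>' f) w = (\<integral>t. \<integral>t'. K t t' \<partial>\<rho>' \<partial>\<rho>)"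
    using l s Km by (intro K) (auto simp: K_def fun_eq_iff intro: p'.borel_measurable_lebesgue_integral)
  also have "\<dots> = (\<integral>t'. \<integral>t. K t t' \<partial>\<rho> \<partial>\<rho>')" by (rule pr.Fubini_integral[OF Ki, symmetric])
  also have "\<dots> = noisy h \<rho>' (noisy g \<rho> f) w"
  proof (rule K[symmetric])
    have "(\<lambda>(t', t). K t t') \<in> borel_measurable (\<rho>' \<Otimes>\<^sub>M \<rho>)"
      using measurable_compose[OF measurable_pair_swap' Km] by (simp add: case_prod_beta)
    then show "(\<lambda>t'. \<integral>t. K t t' \<partial>\<rho>) \<in> borel_measurable \<rho>'" by (rule p.borel_measurable_lebesgue_integral)
  qed (use l s in \<open>auto simp: K_def fun_eq_iff obs_commute[of g]\<close>)
  finally show ?thesis .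
qed

lemma noisys_noisy_commute:
  assumes "good f" "valid_obs us" "noise_law \<rho>" "spin g" "nonneg w"
  shows "noisys us (noisy g \<rho> f) w = noisy g \<rho> (noisys us f) w"
  using assms(2,5)
proof (induction us arbitrary: w)
  case (Cons u us)
  then have v: "valid_obs us" "spin (fst u)" "noise_law (snd u)" by (auto simp: valid_obs_def)
  have "noisys (u # us) (noisy g \<rho> f) w = noisy (fst u) (snd u) (noisy g \<rho> (noisys us f)) w"
    unfolding noisys.simps using v Cons assms
    by (intro noisy_cong good_noisy good_noisys) auto
  also have "\<dots> = noisy g \<rho> (noisys (u # us) f) w"
    unfolding noisys.simps using v assms Cons.prems by (intro noisy_commute good_noisys)
  finally show ?case .
qed simp

lemma noisys_mset:
  assumes "mset us = mset vs" "valid_obs us" "good f" "nonneg w"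
  shows "noisys us f w = noisys vs f w"
  using assms(1,2,4)
proof (induction us arbitrary: vs w)
  case (Cons u us)
  then have v: "valid_obs us" "spin (fst u)" "noise_law (snd u)" by (auto simp: valid_obs_def)
  have "u \<in> set vs" using Cons.prems(1) by (metis list.set_intros(1) set_mset_mset)
  then obtain l r where vs: "vs = l @ u # r" by (meson split_list)
  have ms: "mset us = mset (l @ r)" using Cons.prems(1) by (simp add: vs)
  then have vl: "valid_obs l" "valid_obs r" using v(1) mset_eq_setD[OF ms] by (auto simp: valid_obs_def)
  have vlr: "valid_obs (l @ r)" using vl by (auto simp: valid_obs_def)
  have "noisys vs f w = noisy (fst u) (snd u) (noisys (l @ r) f) w"
    unfolding vs noisys_append noisys.simps using vl v assms(3) Cons.prems(3)
    by (intro noisys_noisy_commute good_noisys)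
  also have "\<dots> = noisy (fst u) (snd u) (noisys us f) w"
    using v assms(3) Cons.prems Cons.IH[OF ms v(1)] vlr by (intro noisy_cong good_noisys) auto
  finally show ?case by simp
qed simp

lemma noisys_nonneg:
  assumes "valid_obs us" "good f" "nonneg w" "\<And>u. nonneg u \<Longrightarrow> 0 \<le> f u"
  shows "0 \<le> noisys us f w"
  using noisys_mono[OF assms(1) good_zero assms(2,3,4)] noisys_cmult[of us 0 f w] by simp

end

section \<open>Product weights on words\<close>

definition words :: "nat \<Rightarrow> (nat \<Rightarrow> bool) set" where
  "words n = {..<n} \<rightarrow>\<^sub>E UNIV"

lemma finite_words[simp]: "finite (words n)"
  unfolding words_def by (intro finite_PiE) auto

interpretation word: weights "words n" for n
  by unfold_locales simp

definition prodw :: "nat \<Rightarrow> (nat \<Rightarrow> bool \<Rightarrow> real) \<Rightarrow> (nat \<Rightarrow> bool) \<Rightarrow> real" where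
  "prodw n u x = (\<Prod>i<n. u i (x i))"

definition bit_at :: "nat \<Rightarrow> (nat \<Rightarrow> bool) \<Rightarrow> real" where
  "bit_at i x = bit_spin (x i)"

definition bit_noise :: "real measure list \<Rightarrow> (bool \<Rightarrow> real) \<Rightarrow> real" where
  "bit_noise rs = noisys (map (Pair bit_spin) rs) bit.ent"

lemma spin_bit_at: "spin (bit_at i)" by (auto simp: spin_def bit_at_def bit_spin_def)

lemma prodw_nonneg: "(\<And>i. i < n \<Longrightarrow> nonneg (u i)) \<Longrightarrow> nonneg (prodw n u)"
  by (auto simp: nonneg_def prodw_def intro!: prod_nonneg)

lemma sum_prod_words: "(\<Sum>x\<in>words n. \<Prod>i<n. v i (x i)) = (\<Prod>i<n. \<Sum>b\<in>UNIV. v i b)"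
  for v :: "nat \<Rightarrow> bool \<Rightarrow> real"
  unfolding words_def by (rule prod_sum_PiE[symmetric]) auto

lemma tot_prodw: "word.tot n (prodw n u) = (\<Prod>i<n. bit.tot (u i))"
  unfolding word.tot_def bit.tot_def prodw_def by (rule sum_prod_words)

definition others :: "nat \<Rightarrow> (nat \<Rightarrow> bool \<Rightarrow> real) \<Rightarrow> nat \<Rightarrow> real" where
  "others n u i = (\<Prod>j\<in>{..<n} - {i}. bit.tot (u j))"

lemma ent_prodw:
  assumes u: "\<And>i. i < n \<Longrightarrow> nonneg (u i)"
  shows "word.ent n (prodw n u) = (\<Sum>i<n. others n u i * bit.ent (u i))"
proof -
  have summand: "prodw n u x * ln (word.tot n (prodw n u) / prodw n u x)
     = (\<Sum>i<n. prodw n u x * ln (bit.tot (u i) / u i (x i)))" for x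
  proof (cases "prodw n u x = 0")
    case False
    then have nz: "u i (x i) \<noteq> 0" if "i < n" for i using that by (auto simp: prodw_def)
    then have pos: "0 < bit.tot (u i) / u i (x i)" if "i < n" for i
    proof -
      have "0 < u i (x i)" using nz[OF that] u[OF that] by (simp add: nonneg_def less_le)
      moreover have "u i (x i) \<le> bit.tot (u i)" by (rule bit.le_tot[OF u[OF that]]) simp
      ultimately show ?thesis by simp
    qed
    have "word.tot n (prodw n u) / prodw n u x = (\<Prod>i<n. bit.tot (u i) / u i (x i))"
      by (simp add: tot_prodw prodw_def prod_dividef)
    moreover have "ln (\<Prod>i<n. bit.tot (u i) / u i (x i)) = (\<Sum>i<n. ln (bit.tot (u i) / u i (x i)))"
      using pos by (intro ln_prod) fastforce+
    ultimately show ?thesis by (simp add: sum_distrib_left)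
  qed simp
  have "word.ent n (prodw n u) = (\<Sum>i<n. \<Sum>x\<in>words n. prodw n u x * ln (bit.tot (u i) / u i (x i)))"
    unfolding word.ent_def summand by (rule sum.swap)
  also have "\<dots> = (\<Sum>i<n. others n u i * bit.ent (u i))"
  proof (intro sum.cong refl)
    fix i assume i: "i \<in> {..<n}"
    define v where "v j = (if j = i then (\<lambda>b. u i b * ln (bit.tot (u i) / u i b)) else u j)" for j
    have "prodw n u x * ln (bit.tot (u i) / u i (x i)) = (\<Prod>j<n. v j (x j))" for x
      unfolding prodw_def using i by (subst (1 2) prod.remove[of _ i]) (auto simp: v_def intro!: prod.cong)
    then have "(\<Sum>x\<in>words n. prodw n u x * ln (bit.tot (u i) / u i (x i))) = (\<Prod>j<n. \<Sum>b\<in>UNIV. v j b)"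
      by (simp add: sum_prod_words)
    also have "\<dots> = (\<Sum>b\<in>UNIV. v i b) * (\<Prod>j\<in>{..<n} - {i}. \<Sum>b\<in>UNIV. v j b)"
      using i by (intro prod.remove) auto
    also have "\<dots> = others n u i * bit.ent (u i)"
      by (simp add: v_def others_def bit.ent_def bit.tot_def mult.commute)
    finally show "(\<Sum>x\<in>words n. prodw n u x * ln (bit.tot (u i) / u i (x i))) = others n u i * bit.ent (u i)" .
  qed
  finally show ?thesis .
qed

lemma good_bit_noise: "(\<And>r. r \<in> set rs \<Longrightarrow> noise_law r) \<Longrightarrow> bit.good (bit_noise rs)"
  unfolding bit_noise_def using spin_bit_spin
  by (intro bit.good_noisys bit.good_ent) (auto simp: valid_obs_def)

lemma upd_prodw:
  assumes "i < n"
  shows "upd (bit_at i) t b (prodw n u) = prodw n (u(i := upd bit_spin t b (u i)))"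
proof
  fix x
  have "prodw n (u(i := upd bit_spin t b (u i))) x = upd bit_spin t b (u i) (x i) * (\<Prod>j\<in>{..<n} - {i}. u j (x j))"
    unfolding prodw_def using assms by (subst prod.remove[of _ i]) auto
  moreover have "prodw n u x = u i (x i) * (\<Prod>j\<in>{..<n} - {i}. u j (x j))"
    unfolding prodw_def using assms by (intro prod.remove) auto
  ultimately show "upd (bit_at i) t b (prodw n u) x = prodw n (u(i := upd bit_spin t b (u i))) x"
    by (simp add: upd_def bit_at_def)
qed

text \<open>An observation of bit k alters only the k-th factor. In the terms of the other bits its
  two outcomes recombine to the old total, so each bit retains only the observations made on
  itself.\<close>

lemma noisys_prodw:
  assumes "\<And>l. l \<in> set ls \<Longrightarrow> fst l < n \<and> noise_law (snd l)" "\<And>i. i < n \<Longrightarrow> nonneg (u i)"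
  shows "noisys (map (\<lambda>l. (bit_at (fst l), snd l)) ls) (word.ent n) (prodw n u)
    = (\<Sum>i<n. others n u i * bit_noise (map snd (filter (\<lambda>l. fst l = i) ls)) (u i))"
  using assms
proof (induction ls arbitrary: u)
  case Nil
  then show ?case by (simp add: ent_prodw bit_noise_def)
next
  case (Cons l ls)
  define k where "k = fst l"
  define \<rho> where "\<rho> = snd l"
  have k: "k < n" and \<rho>: "noise_law \<rho>" using Cons.prems(1)[of l] by (auto simp: k_def \<rho>_def)
  interpret prob_space \<rho> using \<rho> by (simp add: noise_law_def)
  let ?us = "map (\<lambda>l. (bit_at (fst l), snd l)) ls"
  define H where "H i = bit_noise (map snd (filter (\<lambda>l. fst l = i) ls))" for i
  have vu: "valid_obs ?us" using Cons.prems(1) by (auto simp: valid_obs_def spin_bit_at)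
  have gW: "word.good n (noisys ?us (word.ent n))" by (rule word.good_noisys[OF word.good_ent vu])
  have gH: "bit.good (H i)" for i unfolding H_def using Cons.prems(1) by (intro good_bit_noise) auto
  have nk: "nonneg (u k)" using Cons.prems(2) k by simp
  define C where "C = (\<Sum>i\<in>{..<n} - {k}. others n u i * H i (u i))"
  have ptw: "obs (bit_at k) t (noisys ?us (word.ent n)) (prodw n u) = C + others n u k * obs bit_spin t (H k) (u k)"
    if t: "\<bar>t\<bar> \<le> 1" for t
  proof -
    define U where "U b = u(k := upd bit_spin t b (u k))" for b
    have each: "noisys ?us (word.ent n) (prodw n (U b))
      = others n u k * H k (upd bit_spin t b (u k))
        + (\<Sum>i\<in>{..<n} - {k}. bit.tot (upd bit_spin t b (u k)) * (\<Prod>j\<in>{..<n} - {i} - {k}. bit.tot (u j)) * H i (u i))"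
      if b: "b = 1 \<or> b = -1" for b
    proof -
      have nU: "nonneg (U b i)" if "i < n" for i
        using that Cons.prems(2) upd_nonneg[OF t spin_bit_spin nk] b by (auto simp: U_def)
      have "noisys ?us (word.ent n) (prodw n (U b)) = (\<Sum>i<n. others n (U b) i * H i (U b i))"
        unfolding H_def using Cons.prems(1) nU by (intro Cons.IH) auto
      also have "\<dots> = others n (U b) k * H k (U b k) + (\<Sum>i\<in>{..<n} - {k}. others n (U b) i * H i (U b i))"
        using k by (intro sum.remove) auto
      also have "others n (U b) k = others n u k" unfolding others_def U_def by (intro prod.cong) auto
      also have "(\<Sum>i\<in>{..<n} - {k}. others n (U b) i * H i (U b i))
         = (\<Sum>i\<in>{..<n} - {k}. bit.tot (upd bit_spin t b (u k)) * (\<Prod>j\<in>{..<n} - {i} - {k}. bit.tot (u j)) * H i (u i))"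
      proof (intro sum.cong refl)
        fix i assume i: "i \<in> {..<n} - {k}"
        have "others n (U b) i = bit.tot (U b k) * (\<Prod>j\<in>{..<n} - {i} - {k}. bit.tot (U b j))"
          unfolding others_def using k i by (intro prod.remove) auto
        also have "(\<Prod>j\<in>{..<n} - {i} - {k}. bit.tot (U b j)) = (\<Prod>j\<in>{..<n} - {i} - {k}. bit.tot (u j))"
          by (intro prod.cong) (auto simp: U_def)
        finally have o: "others n (U b) i = bit.tot (U b k) * (\<Prod>j\<in>{..<n} - {i} - {k}. bit.tot (u j))" .
        show "others n (U b) i * H i (U b i) = bit.tot (upd bit_spin t b (u k)) * (\<Prod>j\<in>{..<n} - {i} - {k}. bit.tot (u j)) * H i (u i)"
        proof -
          have "U b i = u i" "U b k = upd bit_spin t b (u k)" using i by (simp_all add: U_def)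
          then show ?thesis using o by simp
        qed
      qed
      also have "U b k = upd bit_spin t b (u k)" by (simp add: U_def)
      finally show ?thesis .
    qed
    have T: "bit.tot (upd bit_spin t 1 (u k)) + bit.tot (upd bit_spin t (-1) (u k)) = bit.tot (u k)"
      using bit.obs_tot[of bit_spin t "u k"] by (simp add: obs_def)
    have oth: "bit.tot (u k) * (\<Prod>j\<in>{..<n} - {i} - {k}. bit.tot (u j)) = others n u i" if "i \<in> {..<n} - {k}" for i
      unfolding others_def using that k by (intro prod.remove[symmetric]) auto
    have "obs (bit_at k) t (noisys ?us (word.ent n)) (prodw n u)
       = noisys ?us (word.ent n) (prodw n (U 1)) + noisys ?us (word.ent n) (prodw n (U (-1)))"
      unfolding obs_def upd_prodw[OF k] U_def ..
    also have "\<dots> = others n u k * obs bit_spin t (H k) (u k)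
       + (\<Sum>i\<in>{..<n} - {k}. (bit.tot (upd bit_spin t 1 (u k)) + bit.tot (upd bit_spin t (-1) (u k)))
           * (\<Prod>j\<in>{..<n} - {i} - {k}. bit.tot (u j)) * H i (u i))"
      unfolding each[of 1, simplified] each[of "-1", simplified]
      by (simp add: obs_def distrib_left distrib_right sum.distrib)
    also have "\<dots> = C + others n u k * obs bit_spin t (H k) (u k)"
      unfolding T C_def using oth by simp
    finally show ?thesis .
  qed
  have "noisys (map (\<lambda>l. (bit_at (fst l), snd l)) (l # ls)) (word.ent n) (prodw n u)
     = (\<integral>t. obs (bit_at k) t (noisys ?us (word.ent n)) (prodw n u) \<partial>\<rho>)"
    by (simp add: noisy_def k_def \<rho>_def)
  also have "\<dots> = (\<integral>t. C + others n u k * obs bit_spin t (H k) (u k) \<partial>\<rho>)"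
  proof (rule integral_cong_AE)
    have "AE t in \<rho>. \<bar>t\<bar> \<le> 1" using \<rho> by (simp add: noise_law_def)
    then show "AE t in \<rho>. obs (bit_at k) t (noisys ?us (word.ent n)) (prodw n u) = C + others n u k * obs bit_spin t (H k) (u k)"
      by eventually_elim (rule ptw)
    show "(\<lambda>t. obs (bit_at k) t (noisys ?us (word.ent n)) (prodw n u)) \<in> borel_measurable \<rho>"
      using \<rho> by (intro word.obs_noise_measurable[OF gW]) (simp add: noise_law_def)
    have "(\<lambda>t. obs bit_spin t (H k) (u k)) \<in> borel_measurable \<rho>"
      using \<rho> by (intro bit.obs_noise_measurable[OF gH]) (simp add: noise_law_def)
    then show "(\<lambda>t. C + others n u k * obs bit_spin t (H k) (u k)) \<in> borel_measurable \<rho>" by measurable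
  qed
  also have "\<dots> = C + others n u k * noisy bit_spin \<rho> (H k) (u k)"
    using bit.obs_integrable[OF gH \<rho> spin_bit_spin nk] by (simp add: prob_space noisy_def)
  also have "noisy bit_spin \<rho> (H k) = bit_noise (map snd (filter (\<lambda>l. fst l = k) (l # ls)))"
    by (simp add: H_def bit_noise_def k_def \<rho>_def)
  also have "C = (\<Sum>i\<in>{..<n} - {k}. others n u i * bit_noise (map snd (filter (\<lambda>l. fst l = i) (l # ls))) (u i))"
    unfolding C_def H_def by (intro sum.cong) (auto simp: k_def)
  also have "\<dots> + others n u k * bit_noise (map snd (filter (\<lambda>l. fst l = k) (l # ls))) (u k)
     = (\<Sum>i<n. others n u i * bit_noise (map snd (filter (\<lambda>l. fst l = i) (l # ls))) (u i))"
    using k by (subst (2) sum.remove[of _ k]) auto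
  finally show ?case .
qed

text \<open>Drawing a law at random and observing with it is observing with the mixed law; the
  newest observation is innermost, so the induction absorbs it into F.\<close>

lemma iid_bit_noise:
  assumes law: "\<And>e. e \<in> E \<Longrightarrow> noise_law (law e)" and \<rho>: "noise_law \<rho>"
    and mixture: "\<And>F u. bit.good F \<Longrightarrow> (\<And>u. nonneg u \<Longrightarrow> 0 \<le> F u) \<Longrightarrow> nonneg u \<Longrightarrow>
       (\<Sum>e\<in>E. noisy bit_spin (law e) F u) / real (card E) = noisy bit_spin \<rho> F u"
    and F: "bit.good F" "\<And>u. nonneg u \<Longrightarrow> 0 \<le> F u" and u: "nonneg u"
  shows "iid E d (\<lambda>es. noisys (map (\<lambda>e. (bit_spin, law e)) es) F u) = (noisy bit_spin \<rho> ^^ d) F u"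
  using F
proof (induction d arbitrary: F)
  case (Suc d)
  have gn: "bit.good (noisy bit_spin (law e) F)" if "e \<in> E" for e
    using Suc.prems law[OF that] spin_bit_spin by (intro bit.good_noisy)
  have g\<rho>: "bit.good (noisy bit_spin \<rho> F)" using Suc.prems \<rho> spin_bit_spin by (intro bit.good_noisy)
  have p\<rho>: "0 \<le> noisy bit_spin \<rho> F v" if "nonneg v" for v
    using bit.noisys_nonneg[of "[(bit_spin, \<rho>)]" F v] Suc.prems that \<rho> spin_bit_spin by (simp add: valid_obs_def)
  have "iid E (Suc d) (\<lambda>es. noisys (map (\<lambda>e. (bit_spin, law e)) es) F u)
     = iid E d (\<lambda>xs. noisys (map (\<lambda>e. (bit_spin, law e)) xs) (noisy bit_spin \<rho> F) u)"
    unfolding iid.simps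
  proof (rule iid_cong)
    fix xs assume xs: "set xs \<subseteq> E"
    let ?us = "map (\<lambda>e. (bit_spin, law e)) xs"
    have v: "valid_obs ?us" using xs law spin_bit_spin by (auto simp: valid_obs_def)
    have "(\<Sum>e\<in>E. noisys (map (\<lambda>e. (bit_spin, law e)) (xs @ [e])) F u) / real (card E)
       = inverse (real (card E)) * (\<Sum>e\<in>E. noisys ?us (noisy bit_spin (law e) F) u)"
      by (simp add: noisys_append divide_inverse mult.commute)
    also have "\<dots> = noisys ?us (\<lambda>v. inverse (real (card E)) * (\<Sum>e\<in>E. noisy bit_spin (law e) F v)) u"
      using gn by (simp add: bit.noisys_cmult bit.noisys_sum[OF v _ u])
    also have "\<dots> = noisys ?us (noisy bit_spin \<rho> F) u"
    proof (rule bit.noisys_cong[OF v _ g\<rho> u])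
      show "bit.good (\<lambda>v. inverse (real (card E)) * (\<Sum>e\<in>E. noisy bit_spin (law e) F v))"
        by (intro bit.good_cmult bit.good_sum gn)
      show "inverse (real (card E)) * (\<Sum>e\<in>E. noisy bit_spin (law e) F v) = noisy bit_spin \<rho> F v" if "nonneg v" for v
        using mixture[OF Suc.prems that] by (simp add: divide_inverse mult.commute)
    qed
    finally show "(\<Sum>e\<in>E. noisys (map (\<lambda>e. (bit_spin, law e)) (xs @ [e])) F u) / real (card E)
      = noisys ?us (noisy bit_spin \<rho> F) u" .
  qed
  also have "\<dots> = (noisy bit_spin \<rho> ^^ d) (noisy bit_spin \<rho> F) u"
    by (rule Suc.IH[OF g\<rho> p\<rho>])
  finally show ?case by (simp add: funpow_swap1)
qed simp

text \<open>Without checks, node i is seen only through the d i check sockets matched to it, a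
  sample without replacement from all N. \<open>perm_avg_iid\<close> with the bound
  \<open>2 * bit.tot (u i)\<close> on the entropy of a bit gives the subtracted error.\<close>

lemma tree_average:
  assumes law: "\<And>e. noise_law (law e)" and \<rho>: "noise_law \<rho>"
    and mixture: "\<And>F u. 0 < N \<Longrightarrow> bit.good F \<Longrightarrow> (\<And>u. nonneg u \<Longrightarrow> 0 \<le> F u) \<Longrightarrow> nonneg u \<Longrightarrow>
       (\<Sum>e<N. noisy bit_spin (law e) F u) / real N = noisy bit_spin \<rho> F u"
    and own: "\<And>s. s < N \<Longrightarrow> own s < n" and d: "\<And>i. i < n \<Longrightarrow> d i = card {s. s < N \<and> own s = i}"
    and u: "\<And>i. i < n \<Longrightarrow> nonneg (u i)"
  shows "fact N * (\<Sum>i<n. others n u i * ((noisy bit_spin \<rho> ^^ d i) bit.ent (u i) - 4 * bit.tot (u i) * (real (d i))\<^sup>2 / real N))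
    \<le> (\<Sum>\<tau> | \<tau> permutes {..<N}. noisys (map (\<lambda>e. (bit_at (own (\<tau> e)), law e)) [0..<N]) (word.ent n) (prodw n u))"
proof -
  let ?perms = "{\<tau>. \<tau> permutes {..<N}}"
  define blk where "blk i = filter (\<lambda>s. own s = i) [0..<N]" for i
  have blk: "distinct (blk i)" "set (blk i) \<subseteq> {..<N}" for i by (auto simp: blk_def)
  have lb: "length (blk i) = d i" if "i < n" for i
    using distinct_card[OF blk(1)[of i]] d[OF that] by (simp add: blk_def conj_commute cong: conj_cong)
  define f where "f i es = bit_noise (map law es) (u i)" for i es
  have tree: "noisys (map (\<lambda>e. (bit_at (own (\<tau> e)), law e)) [0..<N]) (word.ent n) (prodw n u)
     = (\<Sum>i<n. others n u i * f i (map (inv \<tau>) (blk i)))" if \<tau>: "\<tau> permutes {..<N}" for \<tau>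
  proof -
    let ?ls = "map (\<lambda>e. (own (\<tau> e), law e)) [0..<N]"
    have "\<tau> e < N" if "e < N" for e using permutes_in_image[OF \<tau>, of e] that by simp
    then have ok: "\<And>l. l \<in> set ?ls \<Longrightarrow> fst l < n \<and> noise_law (snd l)" using own law by auto
    have "noisys (map (\<lambda>e. (bit_at (own (\<tau> e)), law e)) [0..<N]) (word.ent n) (prodw n u)
       = noisys (map (\<lambda>l. (bit_at (fst l), snd l)) ?ls) (word.ent n) (prodw n u)" by (simp add: comp_def)
    also have "\<dots> = (\<Sum>i<n. others n u i * bit_noise (map snd (filter (\<lambda>l. fst l = i) ?ls)) (u i))"
      by (rule noisys_prodw[OF ok u])
    also have "\<dots> = (\<Sum>i<n. others n u i * f i (map (inv \<tau>) (blk i)))"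
    proof (intro sum.cong refl arg_cong2[where f = "(*)"])
      fix i assume i: "i \<in> {..<n}"
      define es where "es = filter (\<lambda>e. own (\<tau> e) = i) [0..<N]"
      have m: "map snd (filter (\<lambda>l. fst l = i) ?ls) = map law es"
        by (simp add: es_def filter_map comp_def)
      have "set es = inv \<tau> ` set (blk i)"
      proof -
        have "e \<in> inv \<tau> ` {s. s < N \<and> own s = i}" if "e < N" "own (\<tau> e) = i" for e
          using that permutes_in_image[OF \<tau>, of e] permutes_inverses(2)[OF \<tau>] by (intro image_eqI[of _ _ "\<tau> e"]) auto
        moreover have "inv \<tau> s < N" "\<tau> (inv \<tau> s) = s" if "s < N" for s
          using permutes_in_image[OF permutes_inv[OF \<tau>], of s] permutes_inverses(1)[OF \<tau>] that by auto
        ultimately show ?thesis by (auto simp: es_def blk_def)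
      qed
      moreover have "distinct es" "distinct (map (inv \<tau>) (blk i))"
        using blk permutes_inj[OF permutes_inv[OF \<tau>]] by (auto simp: es_def distinct_map inj_on_def)
      ultimately have "mset es = mset (map (inv \<tau>) (blk i))" by (simp add: set_eq_iff_mset_eq_distinct[symmetric] del: mset_map)
      then have "mset (map (Pair bit_spin) (map law es)) = mset (map (Pair bit_spin) (map law (map (inv \<tau>) (blk i))))"
        by (metis mset_map)
      then show "bit_noise (map snd (filter (\<lambda>l. fst l = i) ?ls)) (u i) = f i (map (inv \<tau>) (blk i))"
        unfolding m f_def bit_noise_def
        using law spin_bit_spin u i by (intro bit.noisys_mset bit.good_ent) (auto simp: valid_obs_def)
    qed
    finally show ?thesis .
  qed
  have "(\<Sum>\<tau>\<in>?perms. noisys (map (\<lambda>e. (bit_at (own (\<tau> e)), law e)) [0..<N]) (word.ent n) (prodw n u))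
     = (\<Sum>\<tau>\<in>?perms. \<Sum>i<n. others n u i * f i (map (inv \<tau>) (blk i)))"
    by (intro sum.cong refl tree) simp
  \<comment> \<open>The check sockets of a node are the preimages of its variable sockets; inversion
    permutes the matchings, so \<open>inv\<close> may be dropped.\<close>
  also have "\<dots> = (\<Sum>\<tau>\<in>?perms. \<Sum>i<n. others n u i * f i (map \<tau> (blk i)))"
    by (rule sum_permutations_inverse[symmetric, of "\<lambda>\<tau>. \<Sum>i<n. others n u i * f i (map \<tau> (blk i))"])
  also have "\<dots> = (\<Sum>i<n. others n u i * (fact N * perm_avg {..<N} (\<lambda>\<tau>. f i (map \<tau> (blk i)))))"
  proof -
    have "fact N * perm_avg {..<N} g = (\<Sum>\<tau>\<in>?perms. g \<tau>)" for g by (simp add: perm_avg_def)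
    then show ?thesis by (subst sum.swap) (simp add: sum_distrib_left)
  qed
  also have "\<dots> \<ge> (\<Sum>i<n. others n u i * (fact N * ((noisy bit_spin \<rho> ^^ d i) bit.ent (u i) - 4 * bit.tot (u i) * (real (d i))\<^sup>2 / real N)))"
  proof (intro sum_mono mult_left_mono)
    fix i assume i: "i \<in> {..<n}"
    then have ui: "nonneg (u i)" using u by simp
    have vo: "valid_obs (map (Pair bit_spin) (map law es))" for es
      using law spin_bit_spin by (auto simp: valid_obs_def)
    have fb: "\<bar>f i es\<bar> \<le> 2 * bit.tot (u i)" for es
    proof -
      have "f i es \<le> bit.ent (u i)" unfolding f_def bit_noise_def by (rule bit.noisys_ent_le_ent[OF vo ui])
      also have "\<dots> \<le> 2 * bit.tot (u i)" using bit.ent_le[OF ui] by simp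
      finally have "f i es \<le> 2 * bit.tot (u i)" .
      moreover have "0 \<le> f i es" unfolding f_def bit_noise_def
        by (rule bit.noisys_nonneg[OF vo bit.good_ent ui bit.ent_nonneg])
      ultimately show ?thesis by simp
    qed
    have "\<bar>perm_avg {..<N} (\<lambda>\<tau>. f i (map \<tau> (blk i))) - iid {..<N} (d i) (f i)\<bar>
       \<le> 2 * (2 * bit.tot (u i)) * (real (d i))\<^sup>2 / real N"
      using perm_avg_iid[of "{..<N}" "blk i" "f i" "2 * bit.tot (u i)"] blk fb lb i by simp
    moreover have "iid {..<N} (d i) (f i) = (noisy bit_spin \<rho> ^^ d i) bit.ent (u i)"
    proof -
      have fi: "f i = (\<lambda>es. noisys (map (\<lambda>e. (bit_spin, law e)) es) bit.ent (u i))"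
        unfolding f_def bit_noise_def by (simp add: comp_def)
      show ?thesis
      proof (cases "d i = 0")
        case True
        then show ?thesis by (simp add: fi)
      next
        case False
        then have "0 < N" using d[of i] i by (cases N) auto
        show ?thesis unfolding fi
        proof (rule iid_bit_noise[OF law \<rho> _ bit.good_ent bit.ent_nonneg ui])
        fix F :: "(bool \<Rightarrow> real) \<Rightarrow> real" and u :: "bool \<Rightarrow> real"
        assume "bit.good F" "\<And>u. nonneg u \<Longrightarrow> 0 \<le> F u" "nonneg u"
        then show "(\<Sum>e<N. noisy bit_spin (law e) F u) / real (card {..<N}) = noisy bit_spin \<rho> F u"
          using mixture \<open>0 < N\<close> by simp
        qed
      qed
    qed
    ultimately show "(noisy bit_spin \<rho> ^^ d i) bit.ent (u i) - 4 * bit.tot (u i) * (real (d i))\<^sup>2 / real N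
       \<le> perm_avg {..<N} (\<lambda>\<tau>. f i (map \<tau> (blk i)))" by (simp add: mult_ac)
    show "0 \<le> others n u i" unfolding others_def using u bit.tot_nonneg by (intro prod_nonneg) auto
  qed simp
  finally show ?thesis by (simp add: sum_distrib_left mult_ac)
qed

subsection \<open>Degree sequences\<close>

lemma sock_owner_eq:
  assumes "(\<Sum>j<i. deg j) \<le> s" "s < (\<Sum>j<Suc i. deg j)"
  shows "sock_owner deg s = i"
  unfolding sock_owner_def
proof (rule Least_equality)
  show "s < (\<Sum>j\<le>i. deg j)" using assms(2) by (simp add: lessThan_Suc_atMost)
  fix y assume y: "s < (\<Sum>j\<le>y. deg j)"
  show "i \<le> y"
  proof (rule ccontr)
    assume "\<not> i \<le> y"
    then have "(\<Sum>j\<le>y. deg j) \<le> (\<Sum>j<i. deg j)" by (intro sum_mono2) auto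
    then show False using y assms(1) by linarith
  qed
qed

lemma sock_ownerE:
  fixes deg :: "nat \<Rightarrow> nat"
  assumes "s < (\<Sum>j<n. deg j)"
  obtains i where "i < n" "(\<Sum>j<i. deg j) \<le> s" "s < (\<Sum>j<Suc i. deg j)" "sock_owner deg s = i"
proof -
  define i where "i = (LEAST i. s < (\<Sum>j<Suc i. deg j))"
  obtain n' where n': "n = Suc n'" using assms by (cases n) auto
  have 1: "s < (\<Sum>j<Suc i. deg j)" unfolding i_def by (rule LeastI[of _ n']) (use assms n' in simp)
  have "i \<le> n'" unfolding i_def by (rule Least_le) (use assms n' in simp)
  have 2: "(\<Sum>j<i. deg j) \<le> s"
  proof (cases i)
    case (Suc k)
    then have "\<not> s < (\<Sum>j<Suc k. deg j)" using not_less_Least[of k "\<lambda>i. s < (\<Sum>j<Suc i. deg j)"] by (simp add: i_def)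
    then show ?thesis using Suc by simp
  qed simp
  show thesis using that[of i] 1 2 \<open>i \<le> n'\<close> n' sock_owner_eq[OF 2 1] by simp
qed

lemma sock_owner_less:
  fixes deg :: "nat \<Rightarrow> nat"
  shows "s < (\<Sum>j<n. deg j) \<Longrightarrow> sock_owner deg s < n"
  by (auto elim: sock_ownerE)

lemma sock_owner_block:
  fixes deg :: "nat \<Rightarrow> nat"
  assumes "i < n"
  shows "{s. s < (\<Sum>j<n. deg j) \<and> sock_owner deg s = i} = {(\<Sum>j<i. deg j)..<(\<Sum>j<Suc i. deg j)}"
proof -
  have "(\<Sum>j<Suc i. deg j) \<le> (\<Sum>j<n. deg j)" using assms by (intro sum_mono2) auto
  then show ?thesis by (auto elim: sock_ownerE intro: sock_owner_eq)
qed

locale degrees =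
  fixes L :: "nat pmf" and n :: nat
  assumes fin: "finite (set_pmf L)" and int: "real n * pmf L d \<in> \<nat>"
begin

definition cnt :: "nat \<Rightarrow> nat" where "cnt d = nat \<lfloor>real n * pmf L d\<rfloor>"

lemma cnt: "real (cnt d) = real n * pmf L d"
proof -
  obtain k where "real n * pmf L d = real k" using int[of d] by (auto elim: Nats_cases)
  then show ?thesis by (simp add: cnt_def)
qed

lemma sum_cnt: "real (\<Sum>j<d. cnt j) = real n * (\<Sum>j<d. pmf L j)"
  by (simp add: cnt sum_distrib_left)

lemma node_deg_eq:
  assumes "(\<Sum>j<d. cnt j) \<le> i" "i < (\<Sum>j<Suc d. cnt j)"
  shows "node_deg L n i = d"
proof -
  \<comment> \<open>Degree d owns \<open>cnt d\<close> consecutive nodes, so the degree of a node is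
    found like the owner of a socket.\<close>
  have "node_deg L n i = sock_owner cnt i"
    unfolding node_deg_def sock_owner_def
  proof (intro arg_cong[where f = Least] ext)
    fix d show "(real i < real n * (\<Sum>j\<le>d. pmf L j)) = (i < (\<Sum>j\<le>d. cnt j))"
      using sum_cnt[of "Suc d"] unfolding lessThan_Suc_atMost by (metis of_nat_less_iff)
  qed
  then show ?thesis using sock_owner_eq[OF assms] by simp
qed

lemma total: obtains D where "set_pmf L \<subseteq> {..<D}" "(\<Sum>j<D. cnt j) = n"
proof -
  obtain D where D: "set_pmf L \<subseteq> {..<D}" using fin finite_nat_iff_bounded by auto
  have "(\<Sum>j<D. pmf L j) = 1" using D by (intro sum_pmf_eq_1) auto
  then have "real (\<Sum>j<D. cnt j) = real n" by (simp add: sum_cnt del: of_nat_sum)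
  then show thesis using that D by (metis of_nat_eq_iff)
qed

lemma node_deg_in_set: 
  assumes "i < n" shows "node_deg L n i \<in> set_pmf L"
proof -
  obtain D where D: "set_pmf L \<subseteq> {..<D}" "(\<Sum>j<D. cnt j) = n" by (rule total)
  obtain d where d: "(\<Sum>j<d. cnt j) \<le> i" "i < (\<Sum>j<Suc d. cnt j)"
    using sock_ownerE[where s = i and n = D and deg = cnt] assms D(2) by metis
  then have "cnt d \<noteq> 0" by auto
  then have "pmf L d \<noteq> 0" using cnt[of d] by auto
  then show ?thesis using node_deg_eq[OF d] by (simp add: set_pmf_iff)
qed

lemma sum_node_deg: "(\<Sum>i<n. h (node_deg L n i)) = (\<Sum>d\<in>set_pmf L. real n * pmf L d * (h d :: real))"
proof -
  obtain D where D: "set_pmf L \<subseteq> {..<D}" "(\<Sum>j<D. cnt j) = n" by (rule total)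
  have "(\<Sum>i<(\<Sum>j<d. cnt j). h (node_deg L n i)) = (\<Sum>j<d. real (cnt j) * h j)" for d
  proof (induction d)
    case (Suc d)
    have "(\<Sum>i<(\<Sum>j<Suc d. cnt j). h (node_deg L n i))
      = (\<Sum>i<(\<Sum>j<d. cnt j). h (node_deg L n i)) + (\<Sum>i=(\<Sum>j<d. cnt j)..<(\<Sum>j<Suc d. cnt j). h (node_deg L n i))"
      using sum.atLeastLessThan_concat[of 0 "\<Sum>j<d. cnt j" "\<Sum>j<Suc d. cnt j" "\<lambda>i. h (node_deg L n i)"]
      by (simp add: lessThan_atLeast0)
    also have "(\<Sum>i=(\<Sum>j<d. cnt j)..<(\<Sum>j<Suc d. cnt j). h (node_deg L n i)) = (\<Sum>i=(\<Sum>j<d. cnt j)..<(\<Sum>j<Suc d. cnt j). h d)"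
      by (intro sum.cong refl arg_cong[where f = h] node_deg_eq) auto
    finally show ?case using Suc by simp
  qed simp
  from this[of D] have "(\<Sum>i<n. h (node_deg L n i)) = (\<Sum>j<D. real n * pmf L j * h j)"
    unfolding D(2) cnt .
  also have "\<dots> = (\<Sum>d\<in>set_pmf L. real n * pmf L d * h d)"
    using D(1) by (intro sum.mono_neutral_right) (auto simp: set_pmf_iff)
  finally show ?thesis .
qed

lemma sum_node_deg_Lp1: "real (\<Sum>i<n. node_deg L n i) = real n * Lp1 L"
  using sum_node_deg[of real] by (simp add: Lp1_def sum_distrib_left mult_ac)

end

lemma sum_sock_owner:
  fixes deg :: "nat \<Rightarrow> nat" and h :: "nat \<Rightarrow> real"
  shows "(\<Sum>s<(\<Sum>j<m. deg j). h (sock_owner deg s)) = (\<Sum>j<m. real (deg j) * h j)"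
proof (induction m)
  case (Suc m)
  have "(\<Sum>s<(\<Sum>j<Suc m. deg j). h (sock_owner deg s))
    = (\<Sum>s<(\<Sum>j<m. deg j). h (sock_owner deg s)) + (\<Sum>s=(\<Sum>j<m. deg j)..<(\<Sum>j<Suc m. deg j). h (sock_owner deg s))"
    using sum.atLeastLessThan_concat[of 0 "\<Sum>j<m. deg j" "\<Sum>j<Suc m. deg j" "\<lambda>s. h (sock_owner deg s)"]
    by (simp add: lessThan_atLeast0)
  also have "(\<Sum>s=(\<Sum>j<m. deg j)..<(\<Sum>j<Suc m. deg j). h (sock_owner deg s)) = (\<Sum>s=(\<Sum>j<m. deg j)..<(\<Sum>j<Suc m. deg j). h m)"
    by (intro sum.cong refl arg_cong[where f = h] sock_owner_eq) auto
  finally show ?case using Suc by simp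
qed simp

subsection \<open>Random syndromes and the channel\<close>

lemma mult_ln_ratio_bounds:
  fixes u v :: real
  assumes "0 \<le> u" "u \<le> v"
  shows "0 \<le> u * ln (v / u)" "u * ln (v / u) \<le> v"
proof -
  show "0 \<le> u * ln (v / u)"
  proof (cases "u = 0")
    case False
    then show ?thesis using assms by (intro mult_nonneg_nonneg ln_ge_zero) auto
  qed simp
  show "u * ln (v / u) \<le> v"
  proof (cases "u = 0")
    case False
    then have u: "0 < u" using assms by simp
    then have "ln (v / u) \<le> v / u - 1" using assms by (intro ln_le_minus_one) auto
    then have "u * ln (v / u) \<le> u * (v / u - 1)" using u by (intro mult_left_mono) auto
    also have "\<dots> \<le> v" using u by (simp add: right_diff_distrib)
    finally show ?thesis .
  qed (use assms in simp)
qed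

context weights begin

text \<open>An exact outcome b deletes the words with \<open>g x\<close> different from b, so every
  word survives under a single outcome sequence, its own syndrome. What remains is the uncertainty
  among the words sharing it.\<close>

lemma reveal_ent_eq:
  assumes "list_all spin gs"
  shows "reveal gs ent w = (\<Sum>x\<in>A. w x * ln ((\<Sum>x'\<in>{x'\<in>A. \<forall>g\<in>set gs. g x' = g x}. w x') / w x))"
  using assms
proof (induction gs arbitrary: w)
  case Nil
  then show ?case by (simp add: ent_def tot_def)
next
  case (Cons g gs)
  let ?c = "\<lambda>gs x. {x'\<in>A. \<forall>g\<in>set gs. g x' = g x}"
  have g: "g x = 1 \<or> g x = -1" for x using Cons.prems by (auto simp: spin_def)
  have u: "upd g 1 b w x = (if g x = b then w x else 0)" if "b = 1 \<or> b = -1" for b x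
    using g[of x] that by (auto simp: upd_def)
  have S: "(\<Sum>x'\<in>?c gs x. upd g 1 (g x) w x') = (\<Sum>x'\<in>?c (g # gs) x. w x')" for x
  proof -
    have "(\<Sum>x'\<in>?c gs x. upd g 1 (g x) w x') = (\<Sum>x'\<in>?c gs x. if g x' = g x then w x' else 0)"
      using u[OF g] by simp
    also have "\<dots> = (\<Sum>x'\<in>?c gs x \<inter> {x'. g x' = g x}. w x')" by (subst sum.inter_restrict) auto
    also have "?c gs x \<inter> {x'. g x' = g x} = ?c (g # gs) x" by auto
    finally show ?thesis .
  qed
  have "reveal (g # gs) ent w = (\<Sum>x\<in>A. upd g 1 1 w x * ln ((\<Sum>x'\<in>?c gs x. upd g 1 1 w x') / upd g 1 1 w x)
      + upd g 1 (-1) w x * ln ((\<Sum>x'\<in>?c gs x. upd g 1 (-1) w x') / upd g 1 (-1) w x))"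
    using Cons by (simp add: obs_def sum.distrib)
  also have "\<dots> = (\<Sum>x\<in>A. w x * ln ((\<Sum>x'\<in>?c (g # gs) x. w x') / w x))"
  proof (intro sum.cong refl)
    fix x
    show "upd g 1 1 w x * ln ((\<Sum>x'\<in>?c gs x. upd g 1 1 w x') / upd g 1 1 w x)
      + upd g 1 (-1) w x * ln ((\<Sum>x'\<in>?c gs x. upd g 1 (-1) w x') / upd g 1 (-1) w x)
      = w x * ln ((\<Sum>x'\<in>?c (g # gs) x. w x') / w x)"
      using g[of x] S[of x] u[of 1 x] u[of "-1" x] by auto
  qed
  finally show ?case .
qed

end

section \<open>Symmetric channels and the symmetry of cosets\<close>

locale bms = sigma_finite_measure \<mu> for \<mu> :: "'y measure" +
  fixes p :: "bool \<Rightarrow> 'y \<Rightarrow> real" and flip :: "'y \<Rightarrow> 'y"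
  assumes p_measurable[measurable]: "p x \<in> borel_measurable \<mu>"
    and p_nonneg: "0 \<le> p x y" and p_one: "(\<integral>\<^sup>+y. ennreal (p x y) \<partial>\<mu>) = 1"
    and flip_measurable[measurable]: "flip \<in> \<mu> \<rightarrow>\<^sub>M \<mu>"
    and flip_flip: "y \<in> space \<mu> \<Longrightarrow> flip (flip y) = y"
    and flip_distr: "distr \<mu> \<mu> flip = \<mu>"
    and p_flip: "y \<in> space \<mu> \<Longrightarrow> p True y = p False (flip y)"
begin

sublocale pm: product_sigma_finite "\<lambda>_::nat. \<mu>" by unfold_locales

lemma p_flip': "y \<in> space \<mu> \<Longrightarrow> p (\<not> b) y = p b (flip y)"
  using p_flip[of y] p_flip[of "flip y"] flip_flip[of y] measurable_space[OF flip_measurable, of y]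
  by (cases b) auto

lemma p_integrable: "integrable \<mu> (p x)" and p_integral: "(\<integral>y. p x y \<partial>\<mu>) = 1"
proof -
  show "integrable \<mu> (p x)" using p_nonneg p_one by (intro integrableI_nonneg) auto
  show "(\<integral>y. p x y \<partial>\<mu>) = 1" using p_nonneg p_one[of x] by (subst integral_eq_nn_integral) auto
qed

definition lik :: "'y \<Rightarrow> bool \<Rightarrow> real" where "lik y = (\<lambda>b. p b y)"

text \<open>The unnormalised posterior under the uniform prior on words; leaving out the prior is
  the source of the factors 2^n below.\<close>

definition wy :: "nat \<Rightarrow> (nat \<Rightarrow> 'y) \<Rightarrow> (nat \<Rightarrow> bool) \<Rightarrow> real" where
  "wy n y = prodw n (\<lambda>i. lik (y i))"

abbreviation Y :: "nat \<Rightarrow> (nat \<Rightarrow> 'y) measure" where "Y n \<equiv> PiM {..<n} (\<lambda>_. \<mu>)"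

lemma lik_nonneg: "nonneg (lik y)" by (simp add: nonneg_def lik_def p_nonneg)
lemma wy_nonneg: "nonneg (wy n y)" unfolding wy_def by (intro prodw_nonneg lik_nonneg)

lemma wy_apply: "wy n y x = (\<Prod>i<n. p (x i) (y i))" by (simp add: wy_def prodw_def lik_def)

lemma lik_measurable[measurable]: "lik \<in> measurable \<mu> wspace"
  unfolding lik_def[abs_def] by (intro measurable_abs_UNIV) measurable

lemma wy_measurable[measurable]: "wy n \<in> measurable (Y n) wspace"
  unfolding wy_apply[abs_def] by (intro measurable_abs_UNIV) measurable

lemma bit_tot_lik: "bit.tot (lik y) = p False y + p True y"
  unfolding bit.tot_def lik_def by (simp add: UNIV_bool)

lemma bit_good_integrable:
  assumes "bit.good F" shows "integrable \<mu> (\<lambda>y. F (lik y))"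
proof -
  obtain C where C: "0 \<le> C" "\<And>w. nonneg w \<Longrightarrow> \<bar>F w\<bar> \<le> C * bit.tot w" using bit.goodE[OF assms] by metis
  note [measurable] = bit.good_measurable[OF assms]
  show ?thesis
  proof (rule Bochner_Integration.integrable_bound)
    show "integrable \<mu> (\<lambda>y. C * (p False y + p True y))" using p_integrable by auto
    show "AE y in \<mu>. norm (F (lik y)) \<le> norm (C * (p False y + p True y))"
      using C(2)[OF lik_nonneg] C(1) p_nonneg by (auto simp: bit_tot_lik)
  qed measurable
qed

lemma integral_bit_tot: "(\<integral>y. bit.tot (lik y) \<partial>\<mu>) = 2"
  using p_integrable p_integral by (simp add: bit_tot_lik)

lemma integral_others:
  assumes "bit.good F" "i < n"
  shows "integrable (Y n) (\<lambda>y. others n (\<lambda>i. lik (y i)) i * F (lik (y i)))"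
    and "(\<integral>y. others n (\<lambda>i. lik (y i)) i * F (lik (y i)) \<partial>Y n) = 2 ^ (n - 1) * (\<integral>y. F (lik y) \<partial>\<mu>)"
proof -
  define g where "g j = (if j = i then (\<lambda>y. F (lik y)) else (\<lambda>y. bit.tot (lik y)))" for j
  have g: "integrable \<mu> (g j)" for j
    using bit_good_integrable[OF assms(1)] bit_good_integrable[OF bit.good_tot] by (simp add: g_def)
  have e: "others n (\<lambda>i. lik (y i)) i * F (lik (y i)) = (\<Prod>j<n. g j (y j))" for y
    unfolding others_def using assms(2) by (subst prod.remove[of "{..<n}" i]) (auto simp: g_def mult.commute intro!: prod.cong)
  show "integrable (Y n) (\<lambda>y. others n (\<lambda>i. lik (y i)) i * F (lik (y i)))"
    unfolding e using g by (intro pm.product_integrable_prod) auto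
  have "(\<integral>y. others n (\<lambda>i. lik (y i)) i * F (lik (y i)) \<partial>Y n) = (\<Prod>j<n. \<integral>y. g j y \<partial>\<mu>)"
    unfolding e using g by (intro pm.product_integral_prod) auto
  also have "\<dots> = (\<integral>y. F (lik y) \<partial>\<mu>) * (\<Prod>j\<in>{..<n} - {i}. 2)"
    using assms(2) by (subst prod.remove[of "{..<n}" i]) (auto simp: g_def integral_bit_tot)
  also have "(\<Prod>j\<in>{..<n} - {i}. 2 :: real) = 2 ^ (n - 1)" using assms(2) by simp
  finally show "(\<integral>y. others n (\<lambda>i. lik (y i)) i * F (lik (y i)) \<partial>Y n) = 2 ^ (n - 1) * (\<integral>y. F (lik y) \<partial>\<mu>)"
    by simp
qed

lemma tot_wy: "word.tot n (wy n y) = (\<Prod>i<n. bit.tot (lik (y i)))"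
  unfolding wy_def by (rule tot_prodw)

lemma integral_tot_wy: "integrable (Y n) (\<lambda>y. word.tot n (wy n y))" "(\<integral>y. word.tot n (wy n y) \<partial>Y n) = 2 ^ n"
proof -
  have g: "integrable \<mu> (\<lambda>y. bit.tot (lik y))" by (rule bit_good_integrable[OF bit.good_tot])
  show "integrable (Y n) (\<lambda>y. word.tot n (wy n y))"
    unfolding tot_wy using g by (intro pm.product_integrable_prod) auto
  show "(\<integral>y. word.tot n (wy n y) \<partial>Y n) = 2 ^ n"
    unfolding tot_wy using g by (subst pm.product_integral_prod) (auto simp: integral_bit_tot)
qed

lemma word_good_integrable:
  assumes "word.good n F" shows "integrable (Y n) (\<lambda>y. F (wy n y))"
proof -
  obtain C where C: "0 \<le> C" "\<And>w. nonneg w \<Longrightarrow> \<bar>F w\<bar> \<le> C * word.tot n w" using word.goodE[OF assms] by metis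
  note [measurable] = word.good_measurable[OF assms]
  show ?thesis
  proof (rule Bochner_Integration.integrable_bound)
    show "integrable (Y n) (\<lambda>y. C * word.tot n (wy n y))" using integral_tot_wy(1) by auto
    show "AE y in Y n. norm (F (wy n y)) \<le> norm (C * word.tot n (wy n y))"
      using C(2)[OF wy_nonneg] C(1) word.tot_nonneg[OF wy_nonneg] by (auto simp: abs_mult)
  qed measurable
qed

definition flips :: "nat \<Rightarrow> (nat \<Rightarrow> bool) \<Rightarrow> (nat \<Rightarrow> 'y) \<Rightarrow> nat \<Rightarrow> 'y" where
  "flips n x y = (\<lambda>i\<in>{..<n}. if x i then flip (y i) else y i)"

lemma flips_measurable[measurable]: "flips n x \<in> measurable (Y n) (Y n)"
  unfolding flips_def[abs_def] by (intro measurable_restrict) (auto simp: measurable_If)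

lemma distr_flips: "distr (Y n) (Y n) (flips n x) = Y n"
proof (rule pm.PiM_eqI)
  fix A :: "nat \<Rightarrow> 'y set" assume A: "\<And>i. i \<in> {..<n} \<Longrightarrow> A i \<in> sets \<mu>"
  define B where "B i = (if x i then flip -` A i \<inter> space \<mu> else A i)" for i
  have B: "B i \<in> sets \<mu>" if "i \<in> {..<n}" for i
    using A[OF that] measurable_sets[OF flip_measurable] by (auto simp: B_def)
  have eB: "emeasure \<mu> (B i) = emeasure \<mu> (A i)" if "i \<in> {..<n}" for i
    using emeasure_distr[OF flip_measurable A[OF that]] flip_distr by (simp add: B_def)
  have "Pi\<^sub>E {..<n} A \<in> sets (Y n)" using A by (intro sets_PiM_I_finite) auto
  then have "emeasure (distr (Y n) (Y n) (flips n x)) (Pi\<^sub>E {..<n} A) = emeasure (Y n) (flips n x -` Pi\<^sub>E {..<n} A \<inter> space (Y n))"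
    by (rule emeasure_distr[OF flips_measurable])
  also have "flips n x -` Pi\<^sub>E {..<n} A \<inter> space (Y n) = Pi\<^sub>E {..<n} B"
  proof -
    have "A i \<subseteq> space \<mu>" if "i < n" for i using A[of i] that sets.sets_into_space by auto
    then show ?thesis
      by (auto simp: flips_def B_def space_PiM PiE_iff split: if_splits) blast+
  qed
  also have "emeasure (Y n) (Pi\<^sub>E {..<n} B) = (\<Prod>i<n. emeasure \<mu> (B i))"
    using B by (intro pm.emeasure_PiM) auto
  also have "\<dots> = (\<Prod>i\<in>{..<n}. emeasure \<mu> (A i))" using eB by simp
  finally show "emeasure (distr (Y n) (Y n) (flips n x)) (Pi\<^sub>E {..<n} A) = (\<Prod>i\<in>{..<n}. emeasure \<mu> (A i))" .
qed auto

definition xorw :: "nat \<Rightarrow> (nat \<Rightarrow> bool) \<Rightarrow> (nat \<Rightarrow> bool) \<Rightarrow> nat \<Rightarrow> bool" where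
  "xorw n x z = (\<lambda>i\<in>{..<n}. x i \<noteq> z i)"

text \<open>Channel symmetry acts as translation: flipping the outputs at the ones of x is the same
  as adding x to the word.\<close>

lemma wy_flips:
  assumes "y \<in> space (Y n)" shows "wy n (flips n x y) z = wy n y (xorw n x z)"
  unfolding wy_apply
proof (intro prod.cong refl)
  fix i assume "i \<in> {..<n}"
  then have "y i \<in> space \<mu>" using assms by (auto simp: space_PiM)
  then show "p (z i) (flips n x y i) = p (xorw n x z i) (y i)"
    using p_flip'[of "y i" "z i"] \<open>i \<in> {..<n}\<close> by (auto simp: flips_def xorw_def)
qed

lemma xorw_words: "xorw n x z \<in> words n" by (auto simp: xorw_def words_def)

lemma xorw_xorw: "z \<in> words n \<Longrightarrow> xorw n x (xorw n x z) = z"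
  by (auto simp: xorw_def words_def fun_eq_iff PiE_iff extensional_def)

text \<open>By channel symmetry all cosets of a code have the same conditional entropy, so the code may be
  replaced by its cosets, weighted by a uniform word.\<close>
lemma coset_entropy:
  assumes gs: "\<And>g. g \<in> set gs \<Longrightarrow> spin g"
    and hom: "\<And>g x z. g \<in> set gs \<Longrightarrow> g (xorw n x z) = g x * g z"
    and C: "C = {x \<in> words n. \<forall>g\<in>set gs. g x = 1}"
  shows "(\<integral>y. reveal gs (word.ent n) (wy n y) \<partial>Y n) = 2 ^ n * cond_entropy \<mu> p n C"
proof -
  let ?c = "\<lambda>x. {z \<in> words n. \<forall>g\<in>set gs. g z = g x}"
  define G where "G x y = wy n y x * ln ((\<Sum>z\<in>?c x. wy n y z) / wy n y x)" for x y
  let ?z = "\<lambda>i\<in>{..<n}. False"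
  have zw: "?z \<in> words n" by (auto simp: words_def)
  have g1: "g x * g x = 1" if "g \<in> set gs" for g x using gs[OF that] by (auto simp: spin_def) (metis mult_cancel_left1 mult_minus_left mult_minus_right minus_minus)
  have gz: "g ?z = 1" if "g \<in> set gs" for g
  proof -
    have "xorw n ?z ?z = ?z" by (auto simp: xorw_def)
    then show ?thesis using hom[OF that, of ?z ?z] g1[OF that] by simp
  qed
  have Gm[measurable]: "G x \<in> borel_measurable (Y n)" for x unfolding G_def wy_apply by measurable
  \<comment> \<open>The output flips by x preserve the measure and carry the contribution of the
    zero word to that of x.\<close>
  have shift: "(\<integral>y. G x y \<partial>Y n) = (\<integral>y. G ?z y \<partial>Y n)" if x: "x \<in> words n" for x
  proof -
    have "(\<integral>y. G ?z y \<partial>Y n) = (\<integral>y. G ?z y \<partial>distr (Y n) (Y n) (flips n x))" by (simp add: distr_flips)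
    also have "\<dots> = (\<integral>y. G ?z (flips n x y) \<partial>Y n)" by (rule integral_distr) measurable
    also have "\<dots> = (\<integral>y. G x y \<partial>Y n)"
    proof (rule Bochner_Integration.integral_cong[OF refl])
      fix y assume y: "y \<in> space (Y n)"
      have xz: "xorw n x ?z = x" using x by (auto simp: xorw_def words_def fun_eq_iff PiE_iff extensional_def)
      have "(\<Sum>z\<in>?c ?z. wy n (flips n x y) z) = (\<Sum>z\<in>?c x. wy n y z)"
      proof (rule sum.reindex_bij_witness[of _ "xorw n x" "xorw n x"])
        fix z assume z: "z \<in> ?c x"
        show "xorw n x (xorw n x z) = z" using z xorw_xorw by auto
        have "g (xorw n x z) = g ?z" if "g \<in> set gs" for g
        proof -
          have "g z = g x" using z that by blast
          then show ?thesis using hom[OF that, of x z] g1[OF that, of x] gz[OF that] by simp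
        qed
        then show "xorw n x z \<in> ?c ?z" using xorw_words by blast
      next
        fix z assume z: "z \<in> ?c ?z"
        show "xorw n x (xorw n x z) = z" using z xorw_xorw by auto
        have "g (xorw n x z) = g x" if "g \<in> set gs" for g
        proof -
          have "g z = g ?z" using z that by blast
          then show ?thesis using hom[OF that, of x z] gz[OF that] by simp
        qed
        then show "xorw n x z \<in> ?c x" using xorw_words by blast
        show "wy n y (xorw n x z) = wy n (flips n x y) z" using wy_flips[OF y] by simp
      qed
      then show "G ?z (flips n x y) = G x y" unfolding G_def wy_flips[OF y] xz by simp
    qed
    finally show ?thesis by simp
  qed
  have Gi: "integrable (Y n) (G x)" if x: "x \<in> words n" for x
  proof (rule Bochner_Integration.integrable_bound[OF integral_tot_wy(1) Gm])
    show "AE y in Y n. norm (G x y) \<le> norm (word.tot n (wy n y))"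
    proof (rule AE_I2)
      fix y
      have nn: "0 \<le> wy n y z" for z using wy_nonneg by (simp add: nonneg_def)
      have "wy n y x \<le> (\<Sum>z\<in>?c x. wy n y z)" using x nn by (intro member_le_sum) auto
      moreover have "(\<Sum>z\<in>?c x. wy n y z) \<le> word.tot n (wy n y)"
        unfolding word.tot_def using nn by (intro sum_mono2) auto
      ultimately show "norm (G x y) \<le> norm (word.tot n (wy n y))"
        unfolding G_def using mult_ln_ratio_bounds[OF nn[of x], of "\<Sum>z\<in>?c x. wy n y z"] by simp
    qed
  qed
  have cw: "card (words n) = 2 ^ n" unfolding words_def by (simp add: card_PiE)
  have "(\<integral>y. reveal gs (word.ent n) (wy n y) \<partial>Y n) = (\<integral>y. (\<Sum>x\<in>words n. G x y) \<partial>Y n)"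
    unfolding G_def using gs by (subst word.reveal_ent_eq) (auto simp: list_all_iff)
  also have "\<dots> = (\<Sum>x\<in>words n. \<integral>y. G x y \<partial>Y n)" using Gi by (rule Bochner_Integration.integral_sum)
  also have "\<dots> = 2 ^ n * (\<integral>y. G ?z y \<partial>Y n)" using shift by (simp add: cw)
  also have "(\<integral>y. G ?z y \<partial>Y n) = cond_entropy \<mu> p n C"
  proof -
    have Cx: "?c x = C" if "x \<in> C" for x using that C by auto
    have "finite C" "C \<noteq> {}" using C zw gz by (auto intro: finite_subset[OF _ finite_words])
    then have cC: "0 < real (card C)" by (simp add: card_gt_0_iff)
    have "(\<integral>y. (\<Prod>i<n. p (x i) (y i)) * - ln ((\<Prod>i<n. p (x i) (y i)) / (\<Sum>x'\<in>C. \<Prod>i<n. p (x' i) (y i))) \<partial>Y n)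
       = (\<integral>y. G ?z y \<partial>Y n)" if x: "x \<in> C" for x
    proof -
      have "- ln (a / b) = ln (b / a)" if "0 < a" "0 < b" for a b :: real using that by (simp add: ln_div)
      moreover have "wy n y x \<le> (\<Sum>z\<in>C. wy n y z)" for y
        using x \<open>finite C\<close> wy_nonneg by (intro member_le_sum) (auto simp: nonneg_def)
      moreover have "0 \<le> wy n y x" for y using wy_nonneg by (simp add: nonneg_def)
      ultimately have "wy n y x * - ln (wy n y x / (\<Sum>z\<in>C. wy n y z)) = G x y" for y
        unfolding G_def Cx[OF x]
      proof (cases "wy n y x = 0")
        case False
        with \<open>\<And>y. 0 \<le> wy n y x\<close>[of y] have "0 < wy n y x" by simp
        moreover with \<open>\<And>y. wy n y x \<le> (\<Sum>z\<in>C. wy n y z)\<close>[of y] have "0 < (\<Sum>z\<in>C. wy n y z)" by linarith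
        ultimately show "wy n y x * - ln (wy n y x / (\<Sum>z\<in>C. wy n y z)) = wy n y x * ln ((\<Sum>z\<in>C. wy n y z) / wy n y x)"
          by (simp add: ln_div)
      qed simp
      then have "(\<integral>y. (\<Prod>i<n. p (x i) (y i)) * - ln ((\<Prod>i<n. p (x i) (y i)) / (\<Sum>x'\<in>C. \<Prod>i<n. p (x' i) (y i))) \<partial>Y n)
         = (\<integral>y. G x y \<partial>Y n)" by (simp add: wy_apply[symmetric])
      then show ?thesis using shift x C by auto
    qed
    then have "(\<Sum>x\<in>C. \<integral>y. (\<Prod>i<n. p (x i) (y i)) * - ln ((\<Prod>i<n. p (x i) (y i)) / (\<Sum>x'\<in>C. \<Prod>i<n. p (x' i) (y i))) \<partial>Y n)
       = real (card C) * (\<integral>y. G ?z y \<partial>Y n)" by simp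
    then show ?thesis unfolding cond_entropy_def using cC by simp
  qed
  finally show ?thesis .
qed

text \<open>The two transmitted bits contribute equally by channel symmetry.\<close>
lemma variable_term:
  assumes "strict_noise \<rho>"
  shows "(\<integral>y. p False y * (\<integral>ts. ln ((\<Prod>c<d. 1 + ts c) + (p True y / p False y) * (\<Prod>c<d. 1 - ts c)) \<partial>PiM {..<d} (\<lambda>_. \<rho>)) \<partial>\<mu>)
    = (\<integral>y. (noisy bit_spin \<rho> ^^ d) bit.ent (lik y) \<partial>\<mu>) / 2 + real d * (\<integral>t. phi t \<partial>\<rho>)"
proof -
  interpret strict \<rho> by unfold_locales fact
  let ?F = "(noisy bit_spin \<rho> ^^ d) bit.ent"
  let ?r = "\<lambda>y. p True y / p False y"
  define A where "A = (\<integral>\<^sup>+y. ennreal (p False y) * bit_ent d (p True y / p False y) \<partial>\<mu>)"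
  have r: "0 \<le> ?r y" for y using p_nonneg by simp
  have g: "bit.good ?F" and F0: "\<And>u. nonneg u \<Longrightarrow> 0 \<le> ?F u"
    using bit_noisy_ent(2,3)[OF lik_nonneg] by auto
  have AB: "(\<integral>\<^sup>+y. ennreal (p True y) * bit_ent d (p False y / p True y) \<partial>\<mu>) = A"
  proof -
    have "A = (\<integral>\<^sup>+y. ennreal (p False y) * bit_ent d (p True y / p False y) \<partial>distr \<mu> \<mu> flip)"
      by (simp add: A_def flip_distr)
    also have "\<dots> = (\<integral>\<^sup>+y. ennreal (p False (flip y)) * bit_ent d (p True (flip y) / p False (flip y)) \<partial>\<mu>)"
      by (rule nn_integral_distr) measurable
    also have "\<dots> = (\<integral>\<^sup>+y. ennreal (p True y) * bit_ent d (p False y / p True y) \<partial>\<mu>)"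
      using p_flip'[of _ True] p_flip'[of _ False] by (intro nn_integral_cong) simp
    finally show ?thesis by simp
  qed
  have "ennreal (\<integral>y. ?F (lik y) \<partial>\<mu>) = (\<integral>\<^sup>+y. ennreal (?F (lik y)) \<partial>\<mu>)"
    using bit_good_integrable[OF g] F0[OF lik_nonneg] by (intro nn_integral_eq_integral[symmetric]) auto
  also have "\<dots> = A + A"
    unfolding bit_noisy_ent(1)[OF lik_nonneg] unfolding lik_def
    by (subst nn_integral_add) (measurable, simp add: AB A_def[symmetric])
  finally have J: "ennreal (\<integral>y. ?F (lik y) \<partial>\<mu>) = A + A" .
  have Jn: "0 \<le> (\<integral>y. ?F (lik y) \<partial>\<mu>)" using F0[OF lik_nonneg] by (intro Bochner_Integration.integral_nonneg)
  \<comment> \<open>A is half of a finite integral; this supplies the integrability used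
    below.\<close>
  have "A \<le> A + A" by simp
  also have "A + A < \<infinity>" unfolding J[symmetric] by simp
  finally have Afin: "A < \<infinity>" .
  then have "enn2real (A + A) = enn2real A + enn2real A" by (intro enn2real_plus) auto
  moreover have "enn2real (A + A) = (\<integral>y. ?F (lik y) \<partial>\<mu>)" using J Jn by (metis enn2real_ennreal)
  ultimately have A2: "enn2real A = (\<integral>y. ?F (lik y) \<partial>\<mu>) / 2" by linarith
  have e: "ennreal (p False y * enn2real (bit_ent d (?r y))) = ennreal (p False y) * bit_ent d (?r y)" for y
    using p_nonneg[of False y] bit_ent_finite[OF r, of d y] by (simp add: ennreal_mult' less_top)
  have m: "(\<lambda>y. p False y * enn2real (bit_ent d (?r y))) \<in> borel_measurable \<mu>" by measurable
  have nn: "AE y in \<mu>. 0 \<le> p False y * enn2real (bit_ent d (?r y))" using p_nonneg by simp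
  have i: "integrable \<mu> (\<lambda>y. p False y * enn2real (bit_ent d (?r y)))"
    by (rule integrableI_nonneg[OF m nn]) (use Afin in \<open>simp add: e A_def\<close>)
  have v: "(\<integral>y. p False y * enn2real (bit_ent d (?r y)) \<partial>\<mu>) = enn2real A"
    unfolding A_def e[symmetric] by (rule integral_eq_nn_integral[OF m nn])
  have "(\<integral>y. p False y * (\<integral>ts. ln ((\<Prod>c<d. 1 + ts c) + ?r y * (\<Prod>c<d. 1 - ts c)) \<partial>PiM {..<d} (\<lambda>_. \<rho>)) \<partial>\<mu>)
     = (\<integral>y. p False y * enn2real (bit_ent d (?r y)) + p False y * (real d * (\<integral>t. phi t \<partial>\<rho>)) \<partial>\<mu>)"
    unfolding integral_ln_products[OF r] by (simp add: distrib_left)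
  also have "\<dots> = enn2real A + real d * (\<integral>t. phi t \<partial>\<rho>)"
    using i p_integrable p_integral by (simp add: v)
  finally show ?thesis unfolding A2 .
qed

end

subsection \<open>The lower bound\<close>

lemma prod_list_mult:
  fixes f g :: "'a \<Rightarrow> 'b::comm_monoid_mult"
  shows "(\<Prod>x\<leftarrow>xs. f x * g x) = (\<Prod>x\<leftarrow>xs. f x) * (\<Prod>x\<leftarrow>xs. g x)"
  by (induction xs) (simp_all add: mult_ac)

context sym_law begin

lemma check_term: "(\<integral>v. ln (1 + (\<Prod>i<k. tanh (v i))) \<partial>PiM {..<k} (\<lambda>_. V)) = phi_mom vmom k 1"
proof -
  interpret sk: strict "prod_law k" by unfold_locales (rule strict_noise_prod_law)
  have "(\<integral>v. ln (1 + (\<Prod>i<k. tanh (v i))) \<partial>PiM {..<k} (\<lambda>_. V)) = (\<integral>t. ln (1 + t) \<partial>prod_law k)"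
    unfolding prod_law_def by (rule integral_distr[symmetric]) measurable
  also have "\<dots> = (\<integral>t. phi t \<partial>prod_law k)" by (rule sk.ln_integral)
  also have "\<dots> = phi_mom vmom k 1" using integral_phi_prod_law[of 1 k] by simp
  finally show ?thesis .
qed

lemma integral_phi_mix:
  assumes P: "finite (set_pmf P)" "0 < Lp1 P"
  shows "(\<integral>t. phi t \<partial>mix P) = (\<Sum>k\<in>set_pmf P. edge_prob P k * phi_mom vmom (k - 1) 1)"
proof -
  interpret M: strict "mix P" by unfold_locales (rule strict_noise_mix[OF P])
  have pos: "AE t in prod_law j. 0 \<le> phi t" for j
  proof -
    have "AE t in prod_law j. \<bar>t\<bar> \<le> 1" using noise_law_prod by (simp add: noise_law_def)
    then show ?thesis by eventually_elim (rule phi_bounds)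
  qed
  have "integrable (prod_law j) phi" for j
    by (rule strict.phi_integrable) (unfold_locales, rule strict_noise_prod_law)
  from integral_mix[OF P phi_measurable pos this]
  have "(\<integral>\<^sup>+t. ennreal (phi t) \<partial>mix P) = ennreal (\<Sum>k\<in>set_pmf P. edge_prob P k * phi_mom vmom (k - 1) 1)"
    using integral_phi_prod_law[of 1] by simp
  moreover have "(\<integral>t. phi t \<partial>mix P) = enn2real (\<integral>\<^sup>+t. ennreal (phi t) \<partial>mix P)"
  proof (rule integral_eq_nn_integral)
    show "AE t in mix P. 0 \<le> phi t" using M.le1 by (auto elim!: eventually_mono intro: phi_bounds)
  qed measurable
  moreover have "0 \<le> (\<Sum>k\<in>set_pmf P. edge_prob P k * phi_mom vmom (k - 1) 1)"
    using edge_prob_nonneg[OF P(2)] mom.phi_mom_bounds by (intro sum_nonneg mult_nonneg_nonneg) auto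
  ultimately show ?thesis by simp
qed

text \<open>tanh V times a product of k - 1 independent copies is a product of k copies, so
  \<open>prod_law k\<close> appears. H is nonnegative at all relevant arguments, which permits
  Tonelli before integrability is known, and degree 0 has no edges.\<close>

lemma edge_term:
  assumes P: "finite (set_pmf P)" "0 < Lp1 P"
  shows "(\<integral>v. (\<integral>t. ln (1 + tanh v * t) \<partial>mix P) \<partial>V) = (\<Sum>k\<in>set_pmf P. edge_prob P k * phi_mom vmom k 1)"
proof -
  interpret M: strict "mix P" by unfold_locales (rule strict_noise_mix[OF P])
  note [measurable_cong] = M.sets_\<rho>
  define H where "H s = ln 2 - ln (1 + s)" for s :: real
  have [measurable]: "H \<in> borel_measurable borel" unfolding H_def by measurable
  have H: "\<bar>H (t * tanh v)\<bar> \<le> ln 2 - ln (1 - \<bar>tanh v\<bar>)" "0 \<le> H (t * tanh v)" if "\<bar>t\<bar> \<le> 1" for t v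
  proof -
    have tv: "\<bar>t * tanh v\<bar> \<le> \<bar>tanh v\<bar>" unfolding abs_mult using that by (simp add: mult_left_le_one_le)
    have th: "\<bar>tanh v\<bar> < 1" using tanh_real_bounds[of v] by (auto simp: abs_less_iff)
    have "ln (1 - \<bar>tanh v\<bar>) \<le> ln (1 + t * tanh v)" "ln (1 + t * tanh v) \<le> ln 2"
      using tv th by (auto intro!: ln_mono)
    then show "\<bar>H (t * tanh v)\<bar> \<le> ln 2 - ln (1 - \<bar>tanh v\<bar>)" "0 \<le> H (t * tanh v)" by (auto simp: H_def)
  qed
  have total: "(\<integral>\<^sup>+v. \<integral>\<^sup>+t. ennreal (H (t * tanh v)) \<partial>mix P \<partial>V)
    = ennreal (ln 2 - (\<Sum>k\<in>set_pmf P. edge_prob P k * phi_mom vmom k 1))"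
  proof -
    have "(\<integral>\<^sup>+v. \<integral>\<^sup>+t. ennreal (H (t * tanh v)) \<partial>mix P \<partial>V)
       = (\<integral>\<^sup>+v. (\<Sum>k\<in>set_pmf P. ennreal (edge_prob P k) * (\<integral>\<^sup>+t. ennreal (H (t * tanh v)) \<partial>prod_law (k - 1))) \<partial>V)"
    proof -
      have m: "(\<lambda>t. ennreal (H (t * tanh v))) \<in> borel_measurable borel" for v by measurable
      show ?thesis by (simp add: nn_integral_mix[OF P(1) m])
    qed
    also have "\<dots> = (\<Sum>k\<in>set_pmf P. ennreal (edge_prob P k) * (\<integral>\<^sup>+v. \<integral>\<^sup>+t. ennreal (H (t * tanh v)) \<partial>prod_law (k - 1) \<partial>V))"
    proof -
      have "(\<lambda>v. \<integral>\<^sup>+t. ennreal (H (t * tanh v)) \<partial>prod_law j) \<in> borel_measurable V" for j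
      proof -
        interpret pj: prob_space "prod_law j" by (rule prob_space_prod_law)
        show ?thesis by measurable
      qed
      then show ?thesis by (subst nn_integral_sum) (auto simp: nn_integral_cmult)
    qed
    also have "\<dots> = (\<Sum>k\<in>set_pmf P. ennreal (edge_prob P k) * ennreal (ln 2 - phi_mom vmom k 1))"
    proof (intro sum.cong refl)
      fix k assume "k \<in> set_pmf P"
      show "ennreal (edge_prob P k) * (\<integral>\<^sup>+v. \<integral>\<^sup>+t. ennreal (H (t * tanh v)) \<partial>prod_law (k - 1) \<partial>V)
         = ennreal (edge_prob P k) * ennreal (ln 2 - phi_mom vmom k 1)"
      proof (cases k)
        case (Suc j)
        interpret pj: prob_space "prod_law j" by (rule prob_space_prod_law)
        interpret pr: pair_sigma_finite "prod_law j" V by unfold_locales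
        interpret sk: strict "prod_law k" by unfold_locales (rule strict_noise_prod_law)
        have "(\<integral>\<^sup>+v. \<integral>\<^sup>+t. ennreal (H (t * tanh v)) \<partial>prod_law j \<partial>V) = (\<integral>\<^sup>+t. \<integral>\<^sup>+v. ennreal (H (t * tanh v)) \<partial>V \<partial>prod_law j)"
          by (rule pr.Fubini') measurable
        also have "\<dots> = (\<integral>\<^sup>+t. ennreal (H t) \<partial>prod_law k)"
          unfolding Suc by (rule nn_integral_prod_law_Suc[symmetric]) measurable
        also have "\<dots> = ennreal (ln 2 - phi_mom vmom k 1)"
          unfolding H_def sk.nn_integral_ln using integral_phi_prod_law[of 1 k] by simp
        finally show ?thesis by (simp add: Suc)
      qed (simp add: edge_prob_def)
    qed
    also have "\<dots> = ennreal (\<Sum>k\<in>set_pmf P. edge_prob P k * (ln 2 - phi_mom vmom k 1))"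
      using edge_prob_nonneg[OF P(2)] mom.phi_mom_bounds
      by (subst sum_ennreal[symmetric]) (auto simp: ennreal_mult)
    also have "(\<Sum>k\<in>set_pmf P. edge_prob P k * (ln 2 - phi_mom vmom k 1))
       = ln 2 * (\<Sum>k\<in>set_pmf P. edge_prob P k) - (\<Sum>k\<in>set_pmf P. edge_prob P k * phi_mom vmom k 1)"
      by (simp add: right_diff_distrib sum_subtractf sum_distrib_left mult.commute)
    finally show ?thesis using edge_prob_sum[OF P(2)] by simp
  qed
  have le: "(\<Sum>k\<in>set_pmf P. edge_prob P k * phi_mom vmom k 1) \<le> ln 2"
  proof -
    have "(\<Sum>k\<in>set_pmf P. edge_prob P k * phi_mom vmom k 1) \<le> (\<Sum>k\<in>set_pmf P. edge_prob P k * ln 2)"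
      using edge_prob_nonneg[OF P(2)] mom.phi_mom_bounds by (intro sum_mono mult_left_mono) auto
    then show ?thesis using edge_prob_sum[OF P(2)] by (simp add: sum_distrib_right[symmetric])
  qed
  define Q where "Q v = (\<integral>t. H (t * tanh v) \<partial>mix P)" for v
  have Hi: "integrable (mix P) (\<lambda>t. H (t * tanh v))" for v
  proof (rule M.integrable_const_bound)
    show "AE t in mix P. norm (H (t * tanh v)) \<le> ln 2 - ln (1 - \<bar>tanh v\<bar>)"
      using M.le1 by eventually_elim (use H in auto)
  qed measurable
  have Hp: "AE t in mix P. 0 \<le> H (t * tanh v)" for v using M.le1 by eventually_elim (use H in auto)
  have Q: "ennreal (Q v) = (\<integral>\<^sup>+t. ennreal (H (t * tanh v)) \<partial>mix P)" "0 \<le> Q v" for v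
    unfolding Q_def using Hi Hp by (auto simp: nn_integral_eq_integral intro: integral_nonneg_AE)
  have Qm[measurable]: "Q \<in> borel_measurable V"
    unfolding Q_def by (rule M.borel_measurable_lebesgue_integral) measurable
  have QQ: "(\<integral>\<^sup>+v. ennreal (Q v) \<partial>V) = ennreal (ln 2 - (\<Sum>k\<in>set_pmf P. edge_prob P k * phi_mom vmom k 1))"
    unfolding Q(1) by (rule total)
  have Qi: "integrable V Q" using Q(2) QQ by (intro integrableI_nonneg) auto
  have Qv: "(\<integral>v. Q v \<partial>V) = ln 2 - (\<Sum>k\<in>set_pmf P. edge_prob P k * phi_mom vmom k 1)"
    using le by (subst integral_eq_nn_integral) (auto simp: QQ Q(2))
  have "(\<integral>t. ln (1 + tanh v * t) \<partial>mix P) = ln 2 - Q v" for v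
  proof -
    have "(\<integral>t. ln (1 + tanh v * t) \<partial>mix P) = (\<integral>t. ln 2 - H (t * tanh v) \<partial>mix P)" by (simp add: H_def mult.commute)
    then show ?thesis using Hi by (simp add: Q_def M.prob_space)
  qed
  then show ?thesis using Qi Qv by (simp add: prob_space)
qed

end

lemma tanhU_law_eq_mix:
  assumes "sym_density f" shows "tanhU_law P f = sym_law.mix (V_law f) P"
proof -
  interpret sym_law "V_law f" by (rule sym_law_V_law[OF assms])
  show ?thesis unfolding tanhU_law_def mix_def prod_law_def ..
qed

text \<open>Matchings of the ensemble map variable sockets to check sockets; \<open>inv \<pi>\<close> goes back.\<close>
lemma ldpc_code_spins:
  fixes L P n
  defines "m \<equiv> ncheck L P n" and "N \<equiv> nedges L P n" and "cd \<equiv> cdeg L P n" and "own \<equiv> sock_owner (vdeg L P n)"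
  assumes N: "(\<Sum>a<m. cd a) = N" and \<tau>: "\<tau> permutes {..<N}"
  shows "ldpc_code L P n (inv \<tau>)
    = {x \<in> words n. \<forall>a<m. (\<Prod>e\<leftarrow>[(\<Sum>j<a. cd j)..<(\<Sum>j<Suc a. cd j)]. bit_at (own (\<tau> e)) x) = 1}"
proof -
  have "(\<Prod>e\<leftarrow>[(\<Sum>j<a. cd j)..<(\<Sum>j<Suc a. cd j)]. bit_at (own (\<tau> e)) x) = 1
     \<longleftrightarrow> even (card {s. s < N \<and> sock_owner cd (inv \<tau> s) = a \<and> x (own s)})" if a: "a < m" for a x
  proof -
    let ?B = "{(\<Sum>j<a. cd j)..<(\<Sum>j<Suc a. cd j)}"
    have B: "{e. e < N \<and> sock_owner cd e = a} = ?B" using sock_owner_block[OF a, of cd] N by simp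
    have "(\<Prod>e\<leftarrow>[(\<Sum>j<a. cd j)..<(\<Sum>j<Suc a. cd j)]. bit_at (own (\<tau> e)) x) = (\<Prod>e\<in>?B. bit_at (own (\<tau> e)) x)"
      by (subst prod.distinct_set_conv_list[symmetric]) auto
    also have "\<dots> = (\<Prod>e\<in>?B. if x (own (\<tau> e)) then -1 else 1)"
      by (simp add: bit_at_def bit_spin_def)
    also have "\<dots> = (-1) ^ card (?B \<inter> {e. x (own (\<tau> e))})"
      by (subst prod.If_cases) auto
    also have "card (?B \<inter> {e. x (own (\<tau> e))}) = card {s. s < N \<and> sock_owner cd (inv \<tau> s) = a \<and> x (own s)}"
    proof (rule bij_betw_same_card[of \<tau>])
      have t: "\<tau> e < N \<longleftrightarrow> e < N" for e using permutes_in_image[OF \<tau>, of e] by simp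
      have i: "inv \<tau> (\<tau> e) = e" "\<tau> (inv \<tau> e) = e" for e using permutes_inverses[OF \<tau>] by auto
      have t': "inv \<tau> s < N \<longleftrightarrow> s < N" for s using t[of "inv \<tau> s"] i by simp
      show "bij_betw \<tau> (?B \<inter> {e. x (own (\<tau> e))}) {s. s < N \<and> sock_owner cd (inv \<tau> s) = a \<and> x (own s)}"
        unfolding B[symmetric]
        by (rule bij_betwI[of _ _ _ "inv \<tau>"]) (auto simp: t t' i)
    qed
    finally show ?thesis by (simp add: minus_one_power_iff)
  qed
  then show ?thesis
    unfolding ldpc_code_def m_def[symmetric] N_def[symmetric] cd_def[symmetric] own_def[symmetric] words_def
    by auto
qed

context bms begin

text \<open>For each output, \<open>interpolation\<close> bounds the codes below by the tree and
  \<open>tree_average\<close> evaluates the tree up to a bounded error. Integrating over the output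
  and dividing by 2^n, by the number of matchings and by n, the tree and the check constants
  assemble into the functional.\<close>

lemma finite_size_bound:
  fixes L P n and kmax dmax n0 M :: nat
  assumes L: "finite (set_pmf L)" and P: "finite (set_pmf P)" "0 < Lp1 P"
    and f: "sym_density f" and adm: "admissible L P n" and n: "0 < n"
    and kmax: "\<And>k. k \<in> set_pmf P \<Longrightarrow> k \<le> kmax" and dmax: "\<And>d. d \<in> set_pmf L \<Longrightarrow> d \<le> dmax"
    and n0: "0 < n0" "n0 \<le> M"
    and K: "0 \<le> K" "\<And>x y. \<bar>x\<bar> \<le> 1 \<Longrightarrow> \<bar>y\<bar> \<le> 1 \<Longrightarrow> phi x - phi y \<le> \<epsilon> + K * (x - y)\<^sup>2"
    and \<eta>: "0 \<le> \<eta>" "\<And>k c. k \<le> kmax \<Longrightarrow> real n0 * (c - \<eta>) \<le> real n0 * (c - \<epsilon>) - (real k)\<^sup>2 * ln 2 - K * 2 ^ k * (real k)\<^sup>2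
       - real n0 * (2 * (real k + 1) * ln 2 * (real n0 + real k)\<^sup>2 / real M)"
  shows "hRS L P \<mu> p f - \<eta> * (Lp1 L / Lp1 P) - ((2 * (real M + real kmax) + real n0) * ln 2 + 4 * real dmax) / real n
    \<le> avg_entropy L P \<mu> p n"
proof -
  interpret V: sym_law "V_law f" by (rule sym_law_V_law[OF f])
  define m where "m = ncheck L P n"
  define N where "N = nedges L P n"
  define vd where "vd = vdeg L P n"
  define cd where "cd = cdeg L P n"
  define own where "own = sock_owner vd"
  have vd: "vd = node_deg L n" by (simp add: vd_def vdeg_def)
  have cd: "cd = node_deg P m" by (simp add: cd_def cdeg_def m_def)
  interpret dL: degrees L n using adm L by unfold_locales (auto simp: admissible_def)
  interpret dP: degrees P m using adm P by unfold_locales (auto simp: admissible_def m_def)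
  have m: "real m = real n * Lp1 L / Lp1 P"
  proof -
    obtain k where "real n * Lp1 L / Lp1 P = real k" using adm by (auto simp: admissible_def elim: Nats_cases)
    then show ?thesis by (simp add: m_def ncheck_def)
  qed
  have Nv: "N = (\<Sum>i<n. vd i)" by (simp add: N_def nedges_def vd_def)
  have NL: "real N = real n * Lp1 L" using dL.sum_node_deg_Lp1 by (simp add: Nv vd)
  have NP: "real N = real m * Lp1 P" using NL m P(2) by simp
  have Nc: "(\<Sum>a<m. cd a) = N"
    using dP.sum_node_deg_Lp1 NP unfolding cd by (metis of_nat_eq_iff)
  have cdk: "cd a \<le> kmax" if "a < m" for a using dP.node_deg_in_set[OF that] kmax by (simp add: cd)
  have vdd: "vd i \<le> dmax" if "i < n" for i using dL.node_deg_in_set[OF that] dmax by (simp add: vd)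
  \<comment> \<open>Frozen from m on, because \<open>matching\<close> asks for monotone boundaries
    at every index.\<close>
  define Kb where "Kb a = (\<Sum>j<min a m. cd j)" for a
  have KbS: "Kb (Suc a) = (if a < m then Kb a + cd a else Kb a)" for a
    by (auto simp: Kb_def min_def le_Suc_eq not_less_eq_eq)
  have Kblt: "Kb a = (\<Sum>j<a. cd j)" if "a \<le> m" for a using that by (simp add: Kb_def min_def)
  have own: "own s < n" if "s < N" for s using sock_owner_less[of s vd n] that by (simp add: own_def Nv)
  define lw where "lw k = V.prod_law (k - 1)" for k
  define dg where "dg e = cd (sock_owner cd e)" for e
  interpret M: matching "words n" V.vmom N m Kb "\<lambda>s. bit_at (own s)" lw dg kmax
  proof unfold_locales
    show "Kb 0 = 0" "Kb m = N" by (simp_all add: Kb_def Nc)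
    show "Kb a \<le> Kb (Suc a)" for a by (simp add: KbS)
    show "Kb (Suc a) - Kb a \<le> kmax" for a using cdk by (simp add: KbS)
    show "dg e = Kb (Suc a) - Kb a" if e: "Kb a \<le> e" "e < Kb (Suc a)" for a e
    proof -
      have a: "a < m" using e by (auto simp: KbS split: if_splits)
      then have "sock_owner cd e = a" using e Kblt[of a] Kblt[of "Suc a"] by (intro sock_owner_eq) auto
      then show ?thesis using a by (simp add: dg_def KbS)
    qed
    show "spin (bit_at (own s))" for s by (rule spin_bit_at)
    show "noise_law (lw k)" for k unfolding lw_def by (rule V.noise_law_prod)
    show "(\<integral>t. phi (t * z) \<partial>lw k) = phi_mom V.vmom (k - 1) z" if "\<bar>z\<bar> \<le> 1" for z k
      unfolding lw_def by (rule V.integral_phi_prod_law[OF that])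
  qed
  have kd: "M.kd a = cd a" if "a < m" for a using that by (simp add: M.kd_def KbS)
  let ?perms = "{\<tau>. \<tau> permutes {..<N}}"
  let ?\<rho> = "V.mix P"
  let ?Phi = "\<lambda>k. phi_mom V.vmom k 1"
  interpret S: strict ?\<rho> by unfold_locales (rule V.strict_noise_mix[OF P])
  define F where "F d = (noisy bit_spin ?\<rho> ^^ d) bit.ent" for d
  have gF: "bit.good (F d)" for d unfolding F_def by (rule S.bit_noisy_ent(2)[OF lik_nonneg])
  define J where "J d = (\<integral>y. F d (lik y) \<partial>\<mu>)" for d

  have code: "(\<integral>y. M.real_ent \<tau> (wy n y) \<partial>Y n) = 2 ^ n * cond_entropy \<mu> p n (ldpc_code L P n (inv \<tau>))"
    if \<tau>: "\<tau> permutes {..<N}" for \<tau>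
    unfolding M.real_ent_def
  proof (rule coset_entropy)
    show "spin g" if "g \<in> set (map (M.chk \<tau>) [0..<m])" for g using that M.spin_chk by auto
    show "g (xorw n x z) = g x * g z" if g: "g \<in> set (map (M.chk \<tau>) [0..<m])" for g x z
    proof -
      obtain a where a: "g = M.chk \<tau> a" "a < m" using g by auto
      have "e < N" if "e < Kb (Suc a)" for e using that M.Kb_le[of "Suc a" m] a M.Kbm by simp
      then have "own (\<tau> e) < n" if "e < Kb (Suc a)" for e
        using that permutes_in_image[OF \<tau>, of e] own by auto
      then have "bit_at (own (\<tau> e)) (xorw n x z) = bit_at (own (\<tau> e)) x * bit_at (own (\<tau> e)) z" if "e < Kb (Suc a)" for e
        using that by (auto simp: bit_at_def bit_spin_def xorw_def)
      then have "map (\<lambda>e. bit_at (own (\<tau> e)) (xorw n x z)) [Kb a..<Kb (Suc a)]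
        = map (\<lambda>e. bit_at (own (\<tau> e)) x * bit_at (own (\<tau> e)) z) [Kb a..<Kb (Suc a)]" by auto
      then show ?thesis unfolding a M.chk_def prod_list_mult[symmetric] by (rule arg_cong[where f = prod_list])
    qed
    have "M.chk \<tau> a x = (\<Prod>e\<leftarrow>[(\<Sum>j<a. cd j)..<(\<Sum>j<Suc a. cd j)]. bit_at (own (\<tau> e)) x)" if "a < m" for a x
      unfolding M.chk_def using Kblt[of a] Kblt[of "Suc a"] that by simp
    then show "ldpc_code L P n (inv \<tau>) = {x \<in> words n. \<forall>g\<in>set (map (M.chk \<tau>) [0..<m]). g x = 1}"
      using ldpc_code_spins[where L = L and P = P and n = n and \<tau> = \<tau>] Nc \<tau> by (auto simp: m_def N_def cd_def own_def vd_def)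
  qed

  \<comment> \<open>A uniform check socket belongs to a check of degree k with the edge-perspective
    probability, so averaging the laws over the sockets reproduces \<open>mix P\<close>.\<close>
  have mixture: "(\<Sum>e<N. noisy bit_spin (lw (dg e)) G u) / real N = noisy bit_spin ?\<rho> G u"
    if N: "0 < N" and G: "bit.good G" "\<And>u. nonneg u \<Longrightarrow> 0 \<le> G u" and u: "nonneg u" for G u
  proof -
    define h where "h t = obs bit_spin t G u" for t
    have hm: "h \<in> borel_measurable borel" unfolding h_def by (rule bit.obs_noise_measurable[OF G(1)]) simp
    have h0: "0 \<le> h t" if "\<bar>t\<bar> \<le> 1" for t
      unfolding h_def obs_def using G(2) upd_nonneg[OF that spin_bit_spin u] by (intro add_nonneg_nonneg) auto
    have pos: "AE t in V.prod_law j. 0 \<le> h t" for j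
    proof -
      have "AE t in V.prod_law j. \<bar>t\<bar> \<le> 1" using V.noise_law_prod by (simp add: noise_law_def)
      then show ?thesis by eventually_elim (rule h0)
    qed
    have int: "integrable (V.prod_law j) h" for j
      unfolding h_def by (rule bit.obs_integrable[OF G(1) V.noise_law_prod spin_bit_spin u])
    let ?I = "\<lambda>k. \<integral>t. h t \<partial>V.prod_law (k - 1)"
    have I0: "0 \<le> ?I k" for k using pos by (rule integral_nonneg_AE)
    have "(\<integral>t. h t \<partial>?\<rho>) = enn2real (\<integral>\<^sup>+t. ennreal (h t) \<partial>?\<rho>)"
    proof (rule integral_eq_nn_integral)
      show "h \<in> borel_measurable ?\<rho>" using hm by (simp cong: measurable_cong_sets add: S.sets_\<rho>)
      show "AE t in ?\<rho>. 0 \<le> h t" using S.le1 by (auto elim!: eventually_mono intro: h0)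
    qed
    also have "\<dots> = (\<Sum>k\<in>set_pmf P. V.edge_prob P k * ?I k)"
      unfolding V.integral_mix[OF P hm pos int]
      using V.edge_prob_nonneg[OF P(2)] I0 by (intro enn2real_ennreal sum_nonneg mult_nonneg_nonneg)
    also have "\<dots> = (\<Sum>k\<in>set_pmf P. real m * pmf P k * (real k * ?I k)) / real N"
      unfolding sum_divide_distrib V.edge_prob_def using N NP P(2)
      by (intro sum.cong refl) (auto simp: field_simps)
    also have "(\<Sum>k\<in>set_pmf P. real m * pmf P k * (real k * ?I k)) = (\<Sum>a<m. real (cd a) * ?I (cd a))"
      unfolding cd by (rule dP.sum_node_deg[symmetric])
    also have "\<dots> = (\<Sum>e<N. ?I (dg e))"
      unfolding dg_def using sum_sock_owner[where deg = cd and m = m and h = "\<lambda>a. ?I (cd a)"] by (simp add: Nc)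
    finally show ?thesis unfolding noisy_def lw_def h_def by simp
  qed

  define c0 where "c0 = (\<Sum>a<m. check_const V.vmom (cd a)) - \<eta> * real m - (2 * (real M + real kmax) + real n0) * ln 2"
  define B where "B y = (\<Sum>i<n. others n (\<lambda>i. lik (y i)) i * F (vd i) (lik (y i)))
     - (\<Sum>i<n. others n (\<lambda>i. lik (y i)) i * bit.tot (lik (y i)) * (4 * (real (vd i))\<^sup>2 / real N)) + word.tot n (wy n y) * c0" for y
  have pointwise: "fact N * B y \<le> (\<Sum>\<tau>\<in>?perms. M.real_ent \<tau> (wy n y))" for y
  proof -
    have "fact N * (\<Sum>i<n. others n (\<lambda>i. lik (y i)) i * (F (vd i) (lik (y i)) - 4 * bit.tot (lik (y i)) * (real (vd i))\<^sup>2 / real N))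
      \<le> (\<Sum>\<tau>\<in>?perms. noisys (map (\<lambda>e. (bit_at (own (\<tau> e)), lw (dg e))) [0..<N]) (word.ent n) (prodw n (\<lambda>i. lik (y i))))"
      unfolding F_def
    proof (rule tree_average[OF _ S.noise mixture own])
      show "noise_law (lw (dg e))" for e unfolding lw_def by (rule V.noise_law_prod)
      show "vd i = card {s. s < N \<and> own s = i}" if "i < n" for i
        using sock_owner_block[OF that, of vd] by (simp add: Nv own_def)
    qed (assumption | rule lik_nonneg)+
    also have "\<dots> = (\<Sum>\<tau>\<in>?perms. M.tree_ent \<tau> (wy n y))"
      by (simp add: M.tree_ent_def M.nobs_def wy_def)
    finally have 1: "fact N * (\<Sum>i<n. others n (\<lambda>i. lik (y i)) i * (F (vd i) (lik (y i)) - 4 * bit.tot (lik (y i)) * (real (vd i))\<^sup>2 / real N))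
      \<le> (\<Sum>\<tau>\<in>?perms. M.tree_ent \<tau> (wy n y))" .
    have c0: "(\<Sum>a<m. check_const V.vmom (M.kd a)) - \<eta> * real m - (2 * (real M + real kmax) + real n0) * ln 2 = c0"
      unfolding c0_def using kd by simp
    have "(\<Sum>\<tau>\<in>?perms. M.tree_ent \<tau> (wy n y)) + fact N * (word.tot n (wy n y) * c0) \<le> (\<Sum>\<tau>\<in>?perms. M.real_ent \<tau> (wy n y))"
      using M.interpolation[OF wy_nonneg n0 K \<eta>] unfolding c0 .
    moreover have "(\<Sum>i<n. others n (\<lambda>i. lik (y i)) i * (F (vd i) (lik (y i)) - 4 * bit.tot (lik (y i)) * (real (vd i))\<^sup>2 / real N))
       = (\<Sum>i<n. others n (\<lambda>i. lik (y i)) i * F (vd i) (lik (y i)))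
        - (\<Sum>i<n. others n (\<lambda>i. lik (y i)) i * bit.tot (lik (y i)) * (4 * (real (vd i))\<^sup>2 / real N))"
      by (simp add: right_diff_distrib sum_subtractf mult_ac)
    ultimately show ?thesis using 1 unfolding B_def by (simp add: distrib_left)
  qed
  have gR: "word.good n (M.real_ent \<tau>)" for \<tau>
    unfolding M.real_ent_def[abs_def] by (intro word.good_reveal word.good_ent M.list_all_spin_chk)
  have iB: "integrable (Y n) B" and vB: "(\<integral>y. B y \<partial>Y n) = 2 ^ n * ((\<Sum>i<n. J (vd i) / 2) - (\<Sum>i<n. 4 * (real (vd i))\<^sup>2 / real N) + c0)"
  proof -
    have p2: "(2::real) ^ (n - 1) = 2 ^ n / 2" using n by (cases n) auto
    note i1 = integral_others[OF gF] and i2 = integral_others[OF bit.good_tot]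
    have a: "integrable (Y n) (\<lambda>y. \<Sum>i<n. others n (\<lambda>i. lik (y i)) i * F (vd i) (lik (y i)))"
      using i1(1) by (intro Bochner_Integration.integrable_sum) auto
    have b: "integrable (Y n) (\<lambda>y. \<Sum>i<n. others n (\<lambda>i. lik (y i)) i * bit.tot (lik (y i)) * (4 * (real (vd i))\<^sup>2 / real N))"
      using i2(1) by (intro Bochner_Integration.integrable_sum integrable_mult_left) auto
    have c: "integrable (Y n) (\<lambda>y. word.tot n (wy n y) * c0)" using integral_tot_wy(1) by (intro integrable_mult_left)
    show "integrable (Y n) B" unfolding B_def[abs_def] using a b c
      by (intro Bochner_Integration.integrable_add Bochner_Integration.integrable_diff)
    have "(\<integral>y. B y \<partial>Y n) = (\<Sum>i<n. 2 ^ (n - 1) * J (vd i)) - (\<Sum>i<n. 2 ^ (n - 1) * 2 * (4 * (real (vd i))\<^sup>2 / real N)) + 2 ^ n * c0"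
    proof -
      have "(\<integral>y. B y \<partial>Y n) = (\<integral>y. (\<Sum>i<n. others n (\<lambda>i. lik (y i)) i * F (vd i) (lik (y i))) \<partial>Y n)
        - (\<integral>y. (\<Sum>i<n. others n (\<lambda>i. lik (y i)) i * bit.tot (lik (y i)) * (4 * (real (vd i))\<^sup>2 / real N)) \<partial>Y n)
        + (\<integral>y. word.tot n (wy n y) * c0 \<partial>Y n)"
        unfolding B_def using a b c by simp
      moreover have "(\<integral>y. (\<Sum>i<n. others n (\<lambda>i. lik (y i)) i * F (vd i) (lik (y i))) \<partial>Y n) = (\<Sum>i<n. 2 ^ (n - 1) * J (vd i))"
        using i1 by (subst Bochner_Integration.integral_sum) (auto simp: J_def)
      moreover have "(\<integral>y. (\<Sum>i<n. others n (\<lambda>i. lik (y i)) i * bit.tot (lik (y i)) * (4 * (real (vd i))\<^sup>2 / real N)) \<partial>Y n)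
         = (\<Sum>i<n. 2 ^ (n - 1) * 2 * (4 * (real (vd i))\<^sup>2 / real N))"
        using i2 by (subst Bochner_Integration.integral_sum) (auto simp: integral_bit_tot)
      moreover have "(\<integral>y. word.tot n (wy n y) * c0 \<partial>Y n) = 2 ^ n * c0" by (simp add: integral_tot_wy(2))
      ultimately show ?thesis by simp
    qed
    also have "\<dots> = 2 ^ n * ((\<Sum>i<n. J (vd i) / 2) - (\<Sum>i<n. 4 * (real (vd i))\<^sup>2 / real N) + c0)"
      unfolding p2 by (simp add: sum_distrib_left algebra_simps)
    finally show "(\<integral>y. B y \<partial>Y n) = 2 ^ n * ((\<Sum>i<n. J (vd i) / 2) - (\<Sum>i<n. 4 * (real (vd i))\<^sup>2 / real N) + c0)" .
  qed
  define CE where "CE = (\<Sum>\<pi>\<in>?perms. cond_entropy \<mu> p n (ldpc_code L P n \<pi>))"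
  have "fact N * (2 ^ n * ((\<Sum>i<n. J (vd i) / 2) - (\<Sum>i<n. 4 * (real (vd i))\<^sup>2 / real N) + c0)) = (\<integral>y. fact N * B y \<partial>Y n)"
    by (simp add: vB)
  also have "\<dots> \<le> (\<integral>y. (\<Sum>\<tau>\<in>?perms. M.real_ent \<tau> (wy n y)) \<partial>Y n)"
    using word_good_integrable[OF gR] iB pointwise
    by (intro integral_mono Bochner_Integration.integrable_sum) auto
  also have "\<dots> = (\<Sum>\<tau>\<in>?perms. \<integral>y. M.real_ent \<tau> (wy n y) \<partial>Y n)"
    using word_good_integrable[OF gR] by (intro Bochner_Integration.integral_sum) auto
  also have "\<dots> = 2 ^ n * (\<Sum>\<tau>\<in>?perms. cond_entropy \<mu> p n (ldpc_code L P n (inv \<tau>)))"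
    using code by (simp add: sum_distrib_left)
  also have "(\<Sum>\<tau>\<in>?perms. cond_entropy \<mu> p n (ldpc_code L P n (inv \<tau>))) = CE"
    unfolding CE_def by (rule sum_permutations_inverse[symmetric])
  finally have "fact N * ((\<Sum>i<n. J (vd i) / 2) - (\<Sum>i<n. 4 * (real (vd i))\<^sup>2 / real N) + c0) \<le> CE"
    by (simp add: mult.left_commute)
  then have main: "(\<Sum>i<n. J (vd i) / 2) - (\<Sum>i<n. 4 * (real (vd i))\<^sup>2 / real N) + c0 \<le> CE / fact N"
    by (simp add: field_simps)
  have avg: "avg_entropy L P \<mu> p n = CE / fact N / real n"
    unfolding avg_entropy_def CE_def N_def[symmetric] sum_divide_distrib[symmetric] by simp

  \<comment> \<open>The square of a degree is at most \<open>dmax\<close> times the degree, and the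
    degrees sum to N, so the total sampling error is bounded in n.\<close>
  have dsq: "(\<Sum>i<n. 4 * (real (vd i))\<^sup>2 / real N) \<le> 4 * real dmax"
  proof -
    have "(\<Sum>i<n. 4 * (real (vd i))\<^sup>2) \<le> (\<Sum>i<n. 4 * real dmax * real (vd i))"
      using vdd by (intro sum_mono) (auto simp: power2_eq_square intro!: mult_right_mono)
    also have "\<dots> = 4 * real dmax * real N" by (simp add: Nv sum_distrib_left)
    finally show ?thesis unfolding sum_divide_distrib[symmetric]
      by (cases "N = 0") (auto simp: divide_le_eq)
  qed

  define T where "T d = (\<integral>y. p False y * (\<integral>ts. ln ((\<Prod>c<d. 1 + ts c) + (p True y / p False y) * (\<Prod>c<d. 1 - ts c)) \<partial>PiM {..<d} (\<lambda>_. ?\<rho>)) \<partial>\<mu>)" for d :: nat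
  define Phi where "Phi = (\<Sum>k\<in>set_pmf P. V.edge_prob P k * ?Phi (k - 1))"
  have T: "J d / 2 = T d - real d * Phi" for d
    using variable_term[OF S.strict, of d] V.integral_phi_mix[OF P] by (simp add: T_def J_def F_def Phi_def)
  have sJ: "(\<Sum>i<n. J (vd i) / 2) = real n * (\<Sum>d\<in>set_pmf L. pmf L d * T d) - real N * Phi"
  proof -
    have "(\<Sum>i<n. J (vd i) / 2) = (\<Sum>i<n. T (vd i)) - (\<Sum>i<n. real (vd i)) * Phi"
      by (simp add: T sum_subtractf sum_distrib_right)
    also have "(\<Sum>i<n. T (vd i)) = real n * (\<Sum>d\<in>set_pmf L. pmf L d * T d)"
      unfolding vd dL.sum_node_deg by (simp add: sum_distrib_left mult.assoc)
    also have "(\<Sum>i<n. real (vd i)) = real N" by (simp add: Nv)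
    finally show ?thesis .
  qed
  have edge: "real N * (\<Sum>k\<in>set_pmf P. V.edge_prob P k * g k) = real m * (\<Sum>k\<in>set_pmf P. pmf P k * (real k * g k))" for g
    unfolding NP V.edge_prob_def sum_distrib_left using P(2) by (intro sum.cong) auto
  define E2 where "E2 = (\<Sum>k\<in>set_pmf P. pmf P k * ?Phi k)"
  define E3 where "E3 = (\<Sum>k\<in>set_pmf P. V.edge_prob P k * ?Phi k)"
  \<comment> \<open>The term \<open>real N * Phi\<close> offsets the one subtracted in
    \<open>sJ\<close>; the others are n times the check, edge and constant terms of the
    functional.\<close>
  have sc: "(\<Sum>a<m. check_const V.vmom (cd a)) = real N * Phi - real N * E3 + real m * E2 - real m * ln 2"
  proof -
    have "(\<Sum>a<m. check_const V.vmom (cd a)) = real m * (\<Sum>k\<in>set_pmf P. pmf P k * check_const V.vmom k)"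
      unfolding cd dP.sum_node_deg by (simp add: sum_distrib_left mult.assoc)
    also have "(\<Sum>k\<in>set_pmf P. pmf P k * check_const V.vmom k)
      = (\<Sum>k\<in>set_pmf P. pmf P k * (real k * ?Phi (k - 1))) - (\<Sum>k\<in>set_pmf P. pmf P k * (real k * ?Phi k))
        + E2 - (\<Sum>k\<in>set_pmf P. pmf P k) * ln 2"
      unfolding check_const_def E2_def sum_distrib_right sum_subtractf[symmetric] sum.distrib[symmetric]
      by (intro sum.cong) (auto simp: algebra_simps)
    also have "(\<Sum>k\<in>set_pmf P. pmf P k) = 1" using P(1) by (intro sum_pmf_eq_1) auto
    finally show ?thesis unfolding Phi_def E3_def edge by (simp add: algebra_simps)
  qed
  have h: "hRS L P \<mu> p f = (\<Sum>d\<in>set_pmf L. pmf L d * T d) + Lp1 L / Lp1 P * E2 - Lp1 L * E3 - Lp1 L / Lp1 P * ln 2"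
    unfolding hRS_def tanhU_law_eq_mix[OF f] V.check_term V.edge_term[OF P] T_def E2_def E3_def ..
  have nh: "real n * hRS L P \<mu> p f = real n * (\<Sum>d\<in>set_pmf L. pmf L d * T d) + real m * E2 - real N * E3 - real m * ln 2"
    unfolding h m NL by (simp add: algebra_simps)
  have "real n * hRS L P \<mu> p f - \<eta> * real m - (2 * (real M + real kmax) + real n0) * ln 2 - 4 * real dmax \<le> CE / fact N"
    using main dsq unfolding sJ c0_def sc nh by linarith
  then have "(real n * hRS L P \<mu> p f - \<eta> * real m - ((2 * (real M + real kmax) + real n0) * ln 2 + 4 * real dmax)) / real n \<le> avg_entropy L P \<mu> p n"
    unfolding avg using n by (intro divide_right_mono) auto
  moreover have "(real n * hRS L P \<mu> p f - \<eta> * real m - ((2 * (real M + real kmax) + real n0) * ln 2 + 4 * real dmax)) / real n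
    = hRS L P \<mu> p f - \<eta> * (Lp1 L / Lp1 P) - ((2 * (real M + real kmax) + real n0) * ln 2 + 4 * real dmax) / real n"
    using n unfolding m by (simp add: diff_divide_distrib)
  ultimately show ?thesis by simp
qed

lemma RS_lower_bound_bms:
  assumes L: "finite (set_pmf L)" and P: "finite (set_pmf P)" "0 < Lp1 P"
  shows "RS_lower_bound L P \<mu> p"
  unfolding RS_lower_bound_def
proof (rule SUP_least)
  fix f assume "f \<in> {f. sym_density f}"
  then have f: "sym_density f" by simp
  let ?h = "hRS L P \<mu> p f"
  show "ereal ?h \<le> Liminf (sequentially \<sqinter> principal {n. admissible L P n}) (\<lambda>n. ereal (avg_entropy L P \<mu> p n))"
    unfolding le_Liminf_iff
  proof (intro allI impI)
    fix y assume y: "y < ereal ?h"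
    obtain r where r: "y < ereal r" "r < ?h" using ereal_dense2[OF y] by auto
    define s where "s = Lp1 L / Lp1 P"
    have s: "0 \<le> s" unfolding s_def using P(2) by (auto simp: Lp1_def intro!: divide_nonneg_nonneg sum_nonneg)
    \<comment> \<open>Makes \<eta> * s less than half of the gap between the functional and r,
      leaving the other half to the error of order 1/n; the added 1 covers s = 0.\<close>
    define \<eta> where "\<eta> = (?h - r) / (2 * (s + 1))"
    have \<eta>: "0 < \<eta>" using r s by (simp add: \<eta>_def)
    have "\<eta> * (2 * (s + 1)) = ?h - r" using s by (simp add: \<eta>_def)
    then have \<eta>s: "\<eta> * s < (?h - r) / 2" using \<eta> by (simp add: algebra_simps)
    define kmax where "kmax = Max (insert 0 (set_pmf P))"
    define dmax where "dmax = Max (insert 0 (set_pmf L))"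
    have kmax: "k \<le> kmax" if "k \<in> set_pmf P" for k using that P by (simp add: kmax_def)
    have dmax: "d \<le> dmax" if "d \<in> set_pmf L" for d using that L by (simp add: dmax_def)
    obtain n0 M :: nat and K \<epsilon> :: real where c: "0 < n0" "n0 \<le> M" "0 \<le> K"
      "\<And>x y. \<bar>x\<bar> \<le> 1 \<Longrightarrow> \<bar>y\<bar> \<le> 1 \<Longrightarrow> phi x - phi y \<le> \<epsilon> + K * (x - y)\<^sup>2"
      "\<And>k c. k \<le> kmax \<Longrightarrow> real n0 * (c - \<eta>) \<le> real n0 * (c - \<epsilon>) - (real k)\<^sup>2 * ln 2 - K * 2 ^ k * (real k)\<^sup>2
         - real n0 * (2 * (real k + 1) * ln 2 * (real n0 + real k)\<^sup>2 / real M)"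
      using choose_constants[OF \<eta>, of kmax] by metis
    define C where "C = (2 * (real M + real kmax) + real n0) * ln 2 + 4 * real dmax"
    have bound: "?h - \<eta> * s - C / real n \<le> avg_entropy L P \<mu> p n" if "admissible L P n" "0 < n" for n
      unfolding s_def C_def
      by (rule finite_size_bound[OF L P f that kmax dmax c(1-4) less_imp_le[OF \<eta>] c(5)])
    have "(\<lambda>n. C / real n) \<longlonglongrightarrow> 0" by (rule lim_const_over_n)
    then have "\<forall>\<^sub>F n in sequentially. C / real n < (?h - r) / 2"
      using r by (intro order_tendstoD) auto
    moreover have "\<forall>\<^sub>F n in sequentially. 0 < n" by (rule eventually_gt_at_top)
    ultimately have "\<forall>\<^sub>F n in sequentially. n \<in> {n. admissible L P n} \<longrightarrow> y < ereal (avg_entropy L P \<mu> p n)"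
    proof eventually_elim
      case (elim n)
      show ?case
      proof
        assume "n \<in> {n. admissible L P n}"
        then have "?h - \<eta> * s - C / real n \<le> avg_entropy L P \<mu> p n" using elim by (intro bound) auto
        moreover have "r \<le> v" if "h - a - b \<le> v" "b < (h - r) / 2" "a < (h - r) / 2" for h a b v :: real
          using that by (simp add: field_simps)
        ultimately have "r \<le> avg_entropy L P \<mu> p n" using elim(1) \<eta>s by blast
        then show "y < ereal (avg_entropy L P \<mu> p n)" using r(1) by (meson ereal_less_eq(3) less_le_trans)
      qed
    qed
    then show "\<forall>\<^sub>F n in sequentially \<sqinter> principal {n. admissible L P n}. y < ereal (avg_entropy L P \<mu> p n)"
      by (simp add: eventually_inf_principal)
  qed
qed

end

section \<open>The concrete channels and families as instances\<close>

lemma bms_BEC: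
  assumes "\<epsilon> \<in> {0..1}" shows "bms BEC_meas (BEC \<epsilon>) (map_option Not)"
proof -
  interpret f: finite_measure BEC_meas
    unfolding BEC_meas_def by (rule finite_measure_count_space) simp
  have inv: "map_option Not (map_option Not y) = y" for y :: "bool option"
    by (cases y) auto
  have U: "(UNIV :: bool option set) = {None, Some False, Some True}"
    by (auto simp: UNIV_option_conv UNIV_bool)
  show ?thesis
  proof unfold_locales
    show "BEC \<epsilon> x \<in> borel_measurable BEC_meas" for x by (simp add: BEC_meas_def)
    show "0 \<le> BEC \<epsilon> x y" for x y using assms by (auto simp: BEC_def split: option.splits)
    show "(\<integral>\<^sup>+y. ennreal (BEC \<epsilon> x y) \<partial>BEC_meas) = 1" for x
      unfolding BEC_meas_def using assms
      by (subst nn_integral_count_space_finite) (auto simp: U BEC_def ennreal_plus[symmetric] simp del: ennreal_plus)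
    show "map_option Not \<in> BEC_meas \<rightarrow>\<^sub>M BEC_meas" by (simp add: BEC_meas_def)
    show "map_option Not (map_option Not y) = y" for y by (rule inv)
    show "distr BEC_meas BEC_meas (map_option Not) = BEC_meas"
      unfolding BEC_meas_def
      by (rule distr_bij_count_space) (metis bij_betw_def inv involuntory_imp_bij)
    show "BEC \<epsilon> True y = BEC \<epsilon> False (map_option Not y)" for y
      by (cases y) (auto simp: BEC_def)
  qed
qed

text \<open>Negating the log-likelihood output preserves Lebesgue measure and exchanges the two
  Gaussians, whose means are opposite and whose variances agree.\<close>

lemma bms_BIAWGN:
  assumes "0 < \<epsilon>" shows "bms lborel (BIAWGN \<epsilon>) uminus"
proof unfold_locales
  have s: "0 < sqrt (2 / \<epsilon>\<^sup>2)" using assms by simp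
  show "BIAWGN \<epsilon> x \<in> borel_measurable lborel" for x unfolding BIAWGN_def by measurable
  show "0 \<le> BIAWGN \<epsilon> x y" for x y by (simp add: BIAWGN_def)
  show "(\<integral>\<^sup>+y. ennreal (BIAWGN \<epsilon> x y) \<partial>lborel) = 1" for x
    unfolding BIAWGN_def
    using prob_space.emeasure_space_1[OF prob_space_normal_density[OF s, of "if x then - (1 / \<epsilon>\<^sup>2) else 1 / \<epsilon>\<^sup>2"]]
    by (simp add: emeasure_density)
  show "uminus \<in> (lborel :: real measure) \<rightarrow>\<^sub>M lborel" by measurable
  show "distr (lborel :: real measure) lborel uminus = lborel"
  proof -
    have "distr (lborel :: real measure) lborel uminus = distr lborel borel uminus" by (rule distr_cong) auto
    then show ?thesis by (rule trans[OF _ lborel_distr_uminus])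
  qed
  show "BIAWGN \<epsilon> True y = BIAWGN \<epsilon> False (- y)" for y
    unfolding BIAWGN_def normal_density_def by (simp add: power2_eq_square algebra_simps)
qed simp

lemma bms_of_family:
  assumes "BMS_family \<mu> p \<sigma> a b" "e \<in> {a<..<b}"
  shows "bms \<mu> (p e) \<sigma>"
proof -
  have "sigma_finite_measure \<mu>" using assms by (simp add: BMS_family_def)
  then show ?thesis
    using assms unfolding bms_def bms_axioms_def BMS_family_def by auto
qed

theorem theorem1:
  fixes L P :: "nat pmf"
  assumes "finite (set_pmf L)" and "finite (set_pmf P)" and "Lp1 P > 0"
  shows "(\<forall>\<epsilon>\<in>{0..1}. RS_lower_bound L P BEC_meas (BEC \<epsilon>))
       \<and> (\<forall>\<epsilon>>0. RS_lower_bound L P lborel (BIAWGN \<epsilon>))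
       \<and> (\<forall>(\<mu> :: 'y measure) p \<sigma> a b.
            BMS_family \<mu> p \<sigma> a b \<and> smooth_moments \<mu> p a b \<and>
            (\<forall>e\<in>{a<..<b}. condition_H \<mu> p e)
            \<longrightarrow> (\<forall>e\<in>{a<..<b}. RS_lower_bound L P \<mu> (p e)))"
  using bms.RS_lower_bound_bms[OF bms_BEC assms] bms.RS_lower_bound_bms[OF bms_BIAWGN assms]
    bms.RS_lower_bound_bms[OF bms_of_family assms] by blast

end
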